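(* Let $\mathbb{A}^\circ_{n,\nu}(Q,\mu)$ refer to either of the sets $\mathbb{A}_{n,\nu}(Q,\mu)$ and $\mathbb{A}^*_{n,\nu}(Q,\mu)$ (the statement holds for each of them). For any integer $n\ge 2$ there is a positive constant $\nu$ depending on $n$ only such that for any $\mu$ satisfying $0<\mu\le\frac{n+1}{3}$ and any interval $J\subset[-\tfrac12,\tfrac12]$, for all sufficiently large $Q$, $$\#\big(\mathbb{A}^\circ_{n,\nu}(Q,\mu)\cap J\big)\ \ge\ \tfrac12\,Q^{n+1-2\mu}\,|J|.$$
   Context: $\#S$ is the cardinality of $S$ and $|J|$ is the length of an interval $J$. The height $H(\alpha)$ of an algebraic number $\alpha$ is the maximum of the absolute values of the coefficients of its minimal polynomial over $\mathbb{Z}$. Algebraic numbers are conjugate if they are roots of the same irreducible (over $\mathbb{Q}$) integer polynomial. Let $n\ge 2$ be an integer, $\mu\ge 0$, $0<\nu<1$ and $Q>1$. $\mathbb{A}_{n,\nu}(Q,\mu)$ is the set of algebraic numbers $\alpha_1\in\mathbb{R}$ of degree $n$ such that $$\nu Q\le H(\alpha_1)\le \nu^{-1}Q$$ and $$\nu Q^{-\mu}\le|\alpha_1-\alpha_2|\le\nu^{-1}Q^{-\mu}\quad\text{for some }\alpha_2\in\mathbb{R}\text{ conjugate to }\alpha_1.$$ $\mathbb{A}^*_{n,\nu}(Q,\mu)$ is the set of algebraic integers $\alpha_1\in\mathbb{R}$ of degree $n+1$ satisfying the same two conditions. *)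

theory Defs
  imports
    "HOL-Analysis.Analysis"
    "HOL-Computational_Algebra.Computational_Algebra"
begin

text \<open>
  A polynomial that is irreducible in the ring of integer polynomials and has a root in a field
  of characteristic 0 is non-constant and hence automatically primitive. So the
  polynomial selected below is the primitive irreducible one with positive leading coefficient;
  existence and uniqueness are shown in \<open>ex1_min_int_poly\<close>.
\<close>

definition is_min_int_poly :: "'a :: field_char_0 \<Rightarrow> int poly \<Rightarrow> bool" where
  "is_min_int_poly x p \<longleftrightarrow>
     irreducible p \<and> lead_coeff p > 0 \<and> poly (map_poly of_int p) x = 0"

definition min_int_poly :: "'a :: field_char_0 \<Rightarrow> int poly" where
  "min_int_poly x = (THE p. is_min_int_poly x p)"

definition alg_degree :: "'a :: field_char_0 \<Rightarrow> nat" where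
  "alg_degree x = degree (min_int_poly x)"

definition alg_height :: "'a :: field_char_0 \<Rightarrow> int" where
  "alg_height x = Max ((\<lambda>i. \<bar>coeff (min_int_poly x) i\<bar>) ` {..degree (min_int_poly x)})"

definition alg_conjugate :: "'a :: field_char_0 \<Rightarrow> 'a \<Rightarrow> bool" where
  "alg_conjugate x y \<longleftrightarrow>
     (\<exists>p :: int poly. irreducible (map_poly rat_of_int p) \<and>
        poly (map_poly of_int p) x = 0 \<and> poly (map_poly of_int p) y = 0)"

definition height_and_distance :: "real \<Rightarrow> real \<Rightarrow> real \<Rightarrow> real \<Rightarrow> bool" where
  "height_and_distance \<nu> Q \<mu> \<alpha>\<^sub>1 \<longleftrightarrow>
     \<nu> * Q \<le> real_of_int (alg_height \<alpha>\<^sub>1) \<and> real_of_int (alg_height \<alpha>\<^sub>1) \<le> inverse \<nu> * Q \<and>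
     (\<exists>\<alpha>\<^sub>2 :: real. alg_conjugate \<alpha>\<^sub>1 \<alpha>\<^sub>2 \<and>
        \<nu> * Q powr (-\<mu>) \<le> \<bar>\<alpha>\<^sub>1 - \<alpha>\<^sub>2\<bar> \<and> \<bar>\<alpha>\<^sub>1 - \<alpha>\<^sub>2\<bar> \<le> inverse \<nu> * Q powr (-\<mu>))"

definition close_algebraic_numbers :: "nat \<Rightarrow> real \<Rightarrow> real \<Rightarrow> real \<Rightarrow> real set" where
  "close_algebraic_numbers n \<nu> Q \<mu> =
     {\<alpha>\<^sub>1. algebraic \<alpha>\<^sub>1 \<and> alg_degree \<alpha>\<^sub>1 = n \<and> height_and_distance \<nu> Q \<mu> \<alpha>\<^sub>1}"

text \<open>The parameter \<open>n\<close> corresponds to algebraic integers of degree \<open>n + 1\<close>.\<close>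

definition close_algebraic_integers :: "nat \<Rightarrow> real \<Rightarrow> real \<Rightarrow> real \<Rightarrow> real set" where
  "close_algebraic_integers n \<nu> Q \<mu> =
     {\<alpha>\<^sub>1. algebraic_int \<alpha>\<^sub>1 \<and> alg_degree \<alpha>\<^sub>1 = n + 1 \<and> height_and_distance \<nu> Q \<mu> \<alpha>\<^sub>1}"


lemma of_int_poly_add:
  "map_poly (of_int :: int \<Rightarrow> 'a :: field_char_0) (p + q) = map_poly of_int p + map_poly of_int q"
  by (rule poly_eqI) (simp add: coeff_map_poly)

lemma of_int_poly_smult:
  "map_poly (of_int :: int \<Rightarrow> 'a :: field_char_0) (smult c p) = smult (of_int c) (map_poly of_int p)"
  by (rule poly_eqI) (simp add: coeff_map_poly)

lemma of_int_poly_mult: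
  "map_poly (of_int :: int \<Rightarrow> 'a :: field_char_0) (p * q) = map_poly of_int p * map_poly of_int q"
  by (rule poly_eqI) (simp add: coeff_map_poly coeff_mult)

lemma of_int_poly_root_degree:
  assumes "p \<noteq> 0" "poly (map_poly of_int p) (x :: 'a :: field_char_0) = 0"
  shows "degree p > 0"
proof (rule ccontr)
  assume "\<not> degree p > 0"
  then obtain c where "p = [:c:]" using degree_eq_zeroE by blast
  with assms show False by (simp add: map_poly_pCons)
qed

lemma irreducible_dvd_if_root:
  fixes x :: "'a :: field_char_0"
  assumes p: "irreducible p" "poly (map_poly of_int p) x = 0"
      and f: "poly (map_poly of_int f) x = 0"
  shows "(p :: int poly) dvd f"
proof -
  define R where "R = (\<lambda>q :: int poly. q \<noteq> 0 \<and> poly (map_poly of_int q) x = 0)"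
  have "R p" using p by (auto simp: R_def irreducible_def)
  then obtain m where m: "R m" and min: "\<And>q. R q \<Longrightarrow> degree m \<le> degree q"
    using ex_has_least_nat[of R p degree] by auto
  have m0: "m \<noteq> 0" and degm: "degree m > 0"
    using m of_int_poly_root_degree by (auto simp: R_def)
  have div: "\<exists>c d. c \<noteq> 0 \<and> smult c q = m * d" if q: "poly (map_poly of_int q) x = 0" for q
  proof -
    obtain d r where dr: "pseudo_divmod q m = (d, r)" by force
    define c where "c = lead_coeff m ^ (Suc (degree q) - degree m)"
    from pseudo_divmod[OF m0 dr]
    have eq: "smult c q = m * d + r" and r: "r = 0 \<or> degree r < degree m"
      by (auto simp: c_def)
    have "poly (map_poly of_int (smult c q)) x = poly (map_poly of_int (m * d + r)) x"
      using eq by simp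
    with q m have "poly (map_poly of_int r) x = 0"
      by (simp add: R_def of_int_poly_smult of_int_poly_add of_int_poly_mult)
    with r min[of r] have "r = 0" unfolding R_def by linarith
    with eq m0 show ?thesis by (intro exI[of _ c] exI[of _ d]) (auto simp: c_def)
  qed
  have prime: "prime_elem p"
    using p by (simp add: irreducible_imp_prime_elem)
  have p0: "p \<noteq> 0" and degp: "degree p > 0"
    using \<open>R p\<close> of_int_poly_root_degree by (auto simp: R_def)
  from div[OF p(2)] obtain c d where cd: "c \<noteq> 0" "smult c p = m * d" by blast
  have d0: "d \<noteq> 0" using cd p0 by auto
  have "degree (smult c p) = degree m + degree d"
    using cd m0 d0 by (simp add: degree_mult_eq)
  then have deg: "degree p = degree m + degree d"
    by (simp only: degree_smult_eq cd(1) if_False)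
  have "p dvd m * d" using cd by (metis dvd_refl dvd_smult)
  moreover have "\<not> p dvd d"
    using dvd_imp_degree_le[of p d] d0 deg degm by auto
  ultimately have pm: "p dvd m" using prime by (simp add: prime_elem_dvd_mult_iff)
  from div[OF f] obtain c' d' where cd': "c' \<noteq> 0" "smult c' f = m * d'" by blast
  have "p dvd [:c':] * f" using cd' pm by simp
  moreover have "\<not> p dvd [:c':]"
    using dvd_imp_degree_le[of p "[:c':]"] cd' degp by auto
  ultimately show ?thesis using prime by (metis prime_elem_dvd_multD)
qed

lemma ex_irreducible_root:
  fixes x :: "'a :: field_char_0" and f :: "int poly"
  assumes "f \<noteq> 0" "poly (map_poly of_int f) x = 0"
  shows "\<exists>p :: int poly. irreducible p \<and> poly (map_poly of_int p) x = 0"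
  using assms
proof (induction f rule: prime_divisors_induct)
  case (unit f)
  then show ?case
    using of_int_poly_root_degree[of f x] by (auto simp: is_unit_poly_iff)
next
  case (factor p f)
  then show ?case
    by (auto simp: of_int_poly_mult dest: prime_imp_prime_elem prime_elem_imp_irreducible)
qed auto

lemma ex1_min_int_poly:
  fixes x :: "'a :: field_char_0"
  assumes "algebraic x"
  shows "\<exists>!p. is_min_int_poly x p"
proof (rule ex_ex1I)
  obtain f :: "'a poly" where f: "\<And>i. coeff f i \<in> \<int>" "f \<noteq> 0" "poly f x = 0"
    using assms unfolding algebraic_def by blast
  define g :: "int poly" where "g = map_poly (\<lambda>y. SOME k. y = of_int k \<and> (y = 0 \<longrightarrow> k = 0)) f"
  have "of_int (SOME k. y = of_int k \<and> (y = 0 \<longrightarrow> k = 0)) = y" if "y \<in> \<int>" for y :: 'a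
  proof -
    from that obtain k where "y = of_int k" by (auto elim: Ints_cases)
    then have "\<exists>k. y = of_int k \<and> (y = 0 \<longrightarrow> k = 0)" by auto
    from someI_ex[OF this] show ?thesis by simp
  qed
  then have g: "f = map_poly of_int g"
    using f(1) by (intro poly_eqI) (simp add: g_def coeff_map_poly)
  have "g \<noteq> 0" using f g by auto
  with f g obtain p where p: "irreducible p" "poly (map_poly of_int p) x = 0"
    using ex_irreducible_root[of g x] by auto
  have "lead_coeff p < 0 \<or> lead_coeff p > 0" using p by (auto simp: irreducible_def neq_iff[symmetric])
  moreover have "irreducible (-p)"
    using p(1) irreducible_mult_unit_left[of "-1" p] by simp
  moreover have "poly (map_poly of_int (-p)) x = 0"
    using p(2) of_int_poly_smult[of "-1" p, where 'a = 'a] by simp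
  ultimately have "is_min_int_poly x p \<or> is_min_int_poly x (-p)"
    unfolding is_min_int_poly_def using p by auto
  then show "\<exists>p. is_min_int_poly x p" by blast
next
  fix p q assume pq: "is_min_int_poly x p" "is_min_int_poly x q"
  then have "p dvd q" "q dvd p"
    by (auto simp: is_min_int_poly_def intro: irreducible_dvd_if_root)
  then obtain k l where kl: "q = p * k" "p = q * l" unfolding dvd_def by blast
  have "p \<noteq> 0" using pq by (auto simp: is_min_int_poly_def)
  with kl have "k * l = 1" by (metis mult.assoc mult_cancel_left mult.right_neutral)
  then have "k dvd 1" by (metis dvdI)
  then obtain c where c: "k = [:c:]" "c dvd 1" by (auto simp: is_unit_poly_iff)
  then have "lead_coeff q = lead_coeff p * c" using kl(1) by (simp add: lead_coeff_mult)
  with pq have "c > 0" by (simp add: is_min_int_poly_def zero_less_mult_iff)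
  with c have "c = 1" by simp
  with c kl show "p = q" by (simp add: one_pCons)
qed

end

theory Submission
  imports Defs "Jordan_Normal_Form.Determinant"
begin

text \<open>
  For a real point \<open>x\<close>, the map that sends an integer polynomial of degree at most \<open>n\<close> to its
  Taylor coefficients at \<open>x\<close> has as its image a lattice of covolume \<open>1\<close> in \<open>(n + 1)\<close>-space. Put the
  weights \<open>Q\<close> to the power \<open>n - \<mu>\<close>, \<open>Q\<close> to the power \<open>\<mu> - 1\<close>, and \<open>1 / Q\<close>, ..., \<open>1 / Q\<close> on the
  coordinates; their product is \<open>1\<close>. If the weighted lattice at \<open>x\<close> has no nonzero vector shorter
  than a constant \<open>\<delta>\<close> that depends on \<open>n\<close> only, then every point of the space is within a constant
  \<open>R\<close> of it (\<open>lattice_covering\<close>). At such a point \<open>x\<close> the Taylor coefficients of an integer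
  polynomial can be prescribed up to a bounded weighted error, and this remains so for polynomials
  of the shape \<open>X ^ m + 2 + 4 L\<close>, which satisfy Eisenstein's criterion at \<open>2\<close>; the degree \<open>m = n\<close>
  serves the algebraic numbers, and \<open>m = n + 1\<close>, where \<open>L\<close> cannot touch the leading coefficient,
  the algebraic integers. Prescribe \<open>P(x)\<close> near \<open>0\<close>, \<open>P'(x)\<close> of size \<open>Q\<close> to the power
  \<open>1 - \<mu>\<close> with a large constant, and \<open>P''(x)\<close> of size \<open>Q\<close>. Then \<open>P\<close> has a root within
  \<open>r / 4\<close> of \<open>x\<close>, where \<open>r\<close> is \<open>Q\<close> to the power \<open>2 \<mu> - n - 1\<close>, and another real root at a
  distance of order \<open>s\<close>, where \<open>s\<close> is \<open>Q\<close> to the power \<open>- \<mu>\<close> (\<open>two_close_roots\<close>,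
  \<open>close_roots_near_point\<close>). The condition \<open>\<mu> \<le> (n + 1) / 3\<close> says precisely that \<open>r \<le> s\<close>.

  If at least half of the points of the interval are of this kind, the count is immediate: the roots
  found are the centres of intervals of length \<open>r / 2\<close> that cover half of the interval, so there are
  at least \<open>\<bar>J\<bar> / (2 r)\<close> of them, up to boundary effects that the slack in the constants absorbs.

  That short vectors are rare (\<open>short_vectors_rare\<close>) is an instance of the quantitative
  nondivergence of Kleinbock and Margulis. Attach to every subspace \<open>V\<close> spanned by integer
  polynomials the squared covolume of its integer points, a polynomial in \<open>x\<close> of bounded degree.
  A real polynomial that is at least \<open>1\<close> somewhere on an interval is small only on a small part of
  the interval. Therefore, outside a small set, each point admits a flag of subspaces whose squared
  covolumes lie between \<open>\<epsilon>\<close> and \<open>1\<close>, while all further subspaces compatible with the flag have squared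
  covolume at least \<open>1\<close> (\<open>most_points_marked\<close>). A short vector would enlarge a member of such a flag to a compatible
  subspace of squared covolume below \<open>\<epsilon>\<close>. What has to be checked is that each covolume does reach \<open>1\<close> somewhere
  on the interval: it is bounded below by a weighted Wronskian, which is a nonzero integer polynomial,
  and the product of the first \<open>k\<close> weights tends to infinity with \<open>Q\<close> for \<open>1 \<le> k \<le> n\<close>.

  The passage from the length of the shortest vector to the covering radius avoids successive minima.
  By the pigeonhole principle a box of size \<open>r\<close> contains of the order of \<open>r\<close> to the power \<open>n + 1\<close>
  lattice points, whereas a hyperplane contains at most of the order of \<open>r\<close> to the power \<open>n\<close> points
  with mutual distances at least \<open>\<delta>\<close>. For large \<open>r\<close> the short vectors therefore span the space, and
  rounding the coefficients of a representation in terms of them gives a nearby lattice point.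
\<close>

(* From here on det, mat, vec and $ refer to matrices whose size is a term, not a type. *)
no_notation vec_nth (infixl "$" 90)
hide_const (open) Determinants.det Finite_Cartesian_Product.vec Finite_Cartesian_Product.mat Module.smult

section \<open>Taylor coefficients\<close>

text \<open>
  The Hasse derivative: the \<open>j\<close>-th derivative divided by \<open>j!\<close>. Its value at \<open>x\<close> is the \<open>j\<close>-th
  Taylor coefficient at \<open>x\<close>, and it preserves integrality of the coefficients.
\<close>

definition hasse :: "nat \<Rightarrow> real poly \<Rightarrow> real poly" where
  "hasse j p = (\<Sum>i\<le>degree p. monom (of_nat (i choose j) * coeff p i) (i - j))"

lemma coeff_hasse: "coeff (hasse j p) m = of_nat ((m + j) choose j) * coeff p (m + j)"
proof -
  have "coeff (hasse j p) m
      = (\<Sum>i\<le>degree p. if i = m + j then of_nat ((m + j) choose j) * coeff p (m + j) else 0)"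
    unfolding hasse_def coeff_sum
  proof (rule sum.cong[OF refl])
    fix i
    show "coeff (monom (of_nat (i choose j) * coeff p i) (i - j)) m
        = (if i = m + j then of_nat ((m + j) choose j) * coeff p (m + j) else 0)"
      by (cases "i < j") (auto simp: binomial_eq_0)
  qed
  then show ?thesis
    by (auto simp: sum.delta coeff_eq_0)
qed

lemma hasse_add: "hasse j (p + q) = hasse j p + hasse j q"
  by (rule poly_eqI) (simp add: coeff_hasse algebra_simps)

lemma hasse_diff: "hasse j (p - q) = hasse j p - hasse j q"
  by (rule poly_eqI) (simp add: coeff_hasse algebra_simps)

lemma hasse_smult: "hasse j (smult c p) = smult c (hasse j p)"
  by (rule poly_eqI) (simp add: coeff_hasse algebra_simps)

lemma hasse_0 [simp]: "hasse j 0 = 0"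
  by (rule poly_eqI) (simp add: coeff_hasse)

lemma hasse_sum: "hasse j (sum f A) = (\<Sum>a\<in>A. hasse j (f a))"
  by (induction A rule: infinite_finite_induct) (auto simp: hasse_add)

lemma degree_hasse: "degree (hasse j p) \<le> degree p - j"
  by (rule degree_le) (auto simp: coeff_hasse coeff_eq_0)

lemma hasse_zero [simp]: "hasse 0 p = p"
  by (rule poly_eqI) (simp add: coeff_hasse)

lemma hasse_eq_0: "degree p < j \<Longrightarrow> hasse j p = 0"
  by (rule poly_eqI) (auto simp: coeff_hasse coeff_eq_0)

lemma poly_hasse:
  assumes "degree p \<le> n"
  shows "poly (hasse j p) x = (\<Sum>i\<le>n. of_nat (i choose j) * coeff p i * x ^ (i - j))"
proof -
  have "poly (hasse j p) x = (\<Sum>i\<le>degree p. of_nat (i choose j) * coeff p i * x ^ (i - j))"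
    by (simp add: hasse_def poly_sum poly_monom)
  also have "\<dots> = (\<Sum>i\<le>n. of_nat (i choose j) * coeff p i * x ^ (i - j))"
    by (rule sum.mono_neutral_left) (use assms in \<open>auto simp: coeff_eq_0\<close>)
  finally show ?thesis .
qed

lemma poly_as_sum_le:
  fixes p :: "real poly"
  assumes "degree p \<le> n"
  shows "poly p x = (\<Sum>i\<le>n. coeff p i * x ^ i)"
  using poly_hasse[OF assms, of 0 x] by simp

lemma taylor_expansion:
  assumes "degree p \<le> n"
  shows "poly p (x + h) = (\<Sum>j\<le>n. poly (hasse j p) x * h ^ j)"
proof -
  have "poly p (x + h) = (\<Sum>i\<le>n. coeff p i * (h + x) ^ i)"
    using assms by (simp add: poly_as_sum_le add.commute)
  also have "\<dots> = (\<Sum>i\<le>n. \<Sum>j\<le>n. of_nat (i choose j) * coeff p i * x ^ (i - j) * h ^ j)"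
  proof (rule sum.cong[OF refl])
    fix i assume i: "i \<in> {..n}"
    have "coeff p i * (h + x) ^ i = (\<Sum>j\<le>i. of_nat (i choose j) * coeff p i * x ^ (i - j) * h ^ j)"
      by (simp add: binomial_ring sum_distrib_left mult_ac)
    also have "\<dots> = (\<Sum>j\<le>n. of_nat (i choose j) * coeff p i * x ^ (i - j) * h ^ j)"
      by (rule sum.mono_neutral_left) (use i in \<open>auto simp: binomial_eq_0\<close>)
    finally show "coeff p i * (h + x) ^ i = \<dots>" .
  qed
  also have "\<dots> = (\<Sum>j\<le>n. \<Sum>i\<le>n. of_nat (i choose j) * coeff p i * x ^ (i - j) * h ^ j)"
    by (rule sum.swap)
  finally show ?thesis
    by (simp add: poly_hasse[OF assms] sum_distrib_right)
qed

text \<open>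
  Shifting a polynomial by \<open>x\<close> and then by \<open>- x\<close> returns it, so the coefficients depend on the Taylor
  coefficients at \<open>x\<close> in the same way as these depend on the coefficients, with \<open>- x\<close> for \<open>x\<close>.
\<close>

lemma coeff_eq_hasse:
  assumes "degree p \<le> n"
  shows "coeff p i = (\<Sum>j\<le>n. of_nat (j choose i) * poly (hasse j p) x * (- x) ^ (j - i))"
proof -
  define q where "q = (\<Sum>j\<le>n. monom (poly (hasse j p) x) j)"
  have cq: "coeff q j = (if j \<le> n then poly (hasse j p) x else 0)" for j
    by (simp add: q_def coeff_sum sum.delta)
  have dq: "degree q \<le> n"
    by (rule degree_le) (simp add: cq)
  have "poly q h = poly p (x + h)" for h
    by (simp add: taylor_expansion[OF assms] q_def poly_sum poly_monom)
  from this[of "- x + h" for h] have qp: "poly q (- x + h) = poly p h" for h by simp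
  define r where "r = (\<Sum>j\<le>n. monom (poly (hasse j q) (- x)) j)"
  have "poly r h = poly p h" for h
    using taylor_expansion[OF dq, of "- x" h] qp[of h] by (simp add: r_def poly_sum poly_monom)
  then have "poly r = poly p" by (rule ext)
  then have "r = p" by (simp add: poly_eq_poly_eq_iff)
  moreover have "coeff r i = (if i \<le> n then poly (hasse i q) (- x) else 0)"
    by (simp add: r_def coeff_sum sum.delta)
  ultimately have "coeff p i = (if i \<le> n then poly (hasse i q) (- x) else 0)" by simp
  also have "\<dots> = (\<Sum>j\<le>n. of_nat (j choose i) * poly (hasse j p) x * (- x) ^ (j - i))"
    by (auto simp: poly_hasse[OF dq] cq binomial_eq_0 intro!: sum.cong sum.neutral[symmetric])
  finally show ?thesis .
qed

lemma binomial_sum_bound: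
  fixes c :: "nat \<Rightarrow> real"
  assumes "\<And>j. j \<le> n \<Longrightarrow> \<bar>c j\<bar> \<le> M" "\<bar>x\<bar> \<le> 1"
  shows "\<bar>\<Sum>j\<le>n. of_nat (j choose i) * c j * x ^ (j - i)\<bar> \<le> real (n + 1) * 2 ^ n * M"
proof -
  have M: "0 \<le> M" using assms(1)[of 0] by linarith
  have "\<bar>of_nat (j choose i) * c j * x ^ (j - i)\<bar> \<le> 2 ^ n * M" if j: "j \<le> n" for j
  proof -
    have "real (j choose i) \<le> 2 ^ n"
    proof -
      have "j choose i \<le> 2 ^ j" by (rule binomial_le_pow2)
      also have "\<dots> \<le> (2::nat) ^ n" using j by (simp add: power_increasing)
      finally show ?thesis by (metis of_nat_le_iff of_nat_numeral of_nat_power)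
    qed
    moreover have "\<bar>x ^ (j - i)\<bar> \<le> 1"
      using assms(2) by (simp add: power_abs power_le_one)
    ultimately have "(real (j choose i) * \<bar>c j\<bar>) * \<bar>x ^ (j - i)\<bar> \<le> (2 ^ n * M) * 1"
      using assms(1)[OF j] M by (intro mult_mono) auto
    then show ?thesis by (simp add: abs_mult)
  qed
  then have "(\<Sum>j\<le>n. \<bar>of_nat (j choose i) * c j * x ^ (j - i)\<bar>) \<le> (\<Sum>j\<le>n. 2 ^ n * M)"
    by (intro sum_mono) auto
  from order_trans[OF sum_abs this] show ?thesis by simp
qed

lemma hasse_bound:
  assumes "degree p \<le> n" "\<And>i. i \<le> n \<Longrightarrow> \<bar>coeff p i\<bar> \<le> M" "\<bar>x\<bar> \<le> 1"
  shows "\<bar>poly (hasse j p) x\<bar> \<le> real (n + 1) * 2 ^ n * M"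
  unfolding poly_hasse[OF assms(1)] using assms by (intro binomial_sum_bound)

lemma coeff_bound:
  assumes "degree p \<le> n" "\<And>j. j \<le> n \<Longrightarrow> \<bar>poly (hasse j p) x\<bar> \<le> M" "\<bar>x\<bar> \<le> 1"
  shows "\<bar>coeff p i\<bar> \<le> real (n + 1) * 2 ^ n * M"
  unfolding coeff_eq_hasse[OF assms(1), of i x] using assms by (intro binomial_sum_bound) auto

lemma taylor_poly:
  assumes "degree p \<le> n"
  shows "p = (\<Sum>j\<le>n. smult (poly (hasse j p) x) ([:- x, 1:] ^ j))"
proof -
  have "poly p y = poly (\<Sum>j\<le>n. smult (poly (hasse j p) x) ([:- x, 1:] ^ j)) y" for y
    using taylor_expansion[OF assms, of x "y - x"] by (simp add: poly_sum)
  then show ?thesis by (intro poly_eq_poly_eq_iff[THEN iffD1] ext)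
qed

lemma hasse_shift_power: "poly (hasse j ([:- x, 1:] ^ k)) x = (if j = k then 1 else 0)"
proof -
  let ?q = "[:- x, 1:] ^ k"
  have dq: "degree ?q \<le> k" by (simp add: degree_linear_power)
  have "monom 1 k = (\<Sum>j\<le>k. monom (poly (hasse j ?q) x) j)"
  proof (rule poly_eq_poly_eq_iff[THEN iffD1], rule ext)
    fix h
    have "h ^ k = (\<Sum>j\<le>k. poly (hasse j ?q) x * h ^ j)"
      using taylor_expansion[OF dq, of x h] by simp
    then show "poly (monom 1 k) h = poly (\<Sum>j\<le>k. monom (poly (hasse j ?q) x) j) h"
      by (simp add: poly_sum poly_monom)
  qed
  from arg_cong[OF this, of "\<lambda>p. coeff p j"]
  have *: "(if k = j then 1 else 0) = (if j \<le> k then poly (hasse j ?q) x else 0)"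
    by (simp add: coeff_sum sum.delta)
  show ?thesis
  proof (cases "j \<le> k")
    case True
    with * show ?thesis by auto
  next
    case False
    then show ?thesis using dq by (simp add: hasse_eq_0)
  qed
qed

lemma hasse_top:
  assumes "degree p \<le> N"
  shows "poly (hasse N p) x = coeff p N"
proof -
  have "poly (hasse N p) x = (\<Sum>i\<le>N. if i = N then coeff p N else 0)"
    unfolding poly_hasse[OF assms] by (rule sum.cong) (auto simp: binomial_eq_0)
  then show ?thesis by simp
qed

section \<open>Integer polynomials\<close>

text \<open>
  Integer polynomials are kept inside the real vector space of real polynomials, so that spans and
  linear independence over the reals can be used without coercions.
\<close>

definition int_polys :: "nat \<Rightarrow> real poly set" where
  "int_polys n = {p. degree p \<le> n \<and> (\<forall>i. coeff p i \<in> \<int>)}"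

lemma finite_int_polys_bounded: "finite {p \<in> int_polys n. \<forall>i\<le>n. \<bar>coeff p i\<bar> \<le> M}"
proof (rule finite_subset)
  let ?B = "of_int ` {- \<lceil>M\<rceil> .. \<lceil>M\<rceil>} :: real set"
  show "{p \<in> int_polys n. \<forall>i\<le>n. \<bar>coeff p i\<bar> \<le> M} \<subseteq>
      (\<lambda>f. \<Sum>i\<le>n. monom (f i) i) ` (PiE {..n} (\<lambda>_. ?B))"
  proof safe
    fix p assume p: "p \<in> int_polys n" "\<forall>i\<le>n. \<bar>coeff p i\<bar> \<le> M"
    have "coeff p i \<in> ?B" if i: "i \<le> n" for i
    proof -
      obtain k where k: "coeff p i = of_int k" using p(1) unfolding int_polys_def by (blast elim: Ints_cases)
      with p(2) i have "\<bar>real_of_int k\<bar> \<le> M" by metis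
      then have "k \<in> {- \<lceil>M\<rceil> .. \<lceil>M\<rceil>}" by (simp add: abs_le_iff) linarith
      with k show ?thesis by blast
    qed
    then have "restrict (coeff p) {..n} \<in> PiE {..n} (\<lambda>_. ?B)" by auto
    moreover have "p = (\<Sum>i\<le>n. monom (restrict (coeff p) {..n} i) i)"
      using p poly_as_sum_of_monoms'[of p n] by (simp add: int_polys_def)
    ultimately show "p \<in> (\<lambda>f. \<Sum>i\<le>n. monom (f i) i) ` (PiE {..n} (\<lambda>_. ?B))" by blast
  qed
qed (intro finite_imageI finite_PiE; simp)

lemma int_polys_diff: "p \<in> int_polys n \<Longrightarrow> q \<in> int_polys n \<Longrightarrow> p - q \<in> int_polys n"
  by (auto simp: int_polys_def intro: degree_diff_le)

lemma int_polys_combination: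
  assumes "\<And>b. b \<in> B \<Longrightarrow> b \<in> int_polys n"
  shows "(\<Sum>b\<in>B. smult (of_int (f b)) b) \<in> int_polys n"
proof (cases "finite B")
  case True
  have "degree (\<Sum>b\<in>B. smult (of_int (f b)) b) \<le> n"
    using assms True
    by (intro degree_sum_le order_trans[OF degree_smult_le]) (auto simp: int_polys_def)
  then show ?thesis using assms by (auto simp: int_polys_def coeff_sum intro!: Ints_sum Ints_mult)
qed (simp add: int_polys_def)

lemma hasse_int_polys:
  assumes "p \<in> int_polys n"
  shows "hasse j p \<in> int_polys n"
proof -
  have "degree (hasse j p) \<le> n" using degree_hasse[of j p] assms by (auto simp: int_polys_def)
  then show ?thesis using assms by (auto simp: int_polys_def coeff_hasse)
qed

lemma int_polys_cast:
  assumes "p \<in> int_polys n"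
  obtains q where "p = map_poly of_int q" "degree q \<le> n"
proof -
  define q where "q = map_poly (floor :: real \<Rightarrow> int) p"
  have "p = map_poly of_int q"
  proof (rule poly_eqI)
    fix i
    have "coeff p i \<in> \<int>" using assms by (simp add: int_polys_def)
    then show "coeff p i = coeff (map_poly of_int q) i"
      by (auto simp: q_def coeff_map_poly elim: Ints_cases)
  qed
  moreover have "degree q \<le> n"
    using assms by (intro degree_le) (auto simp: q_def int_polys_def coeff_map_poly coeff_eq_0)
  ultimately show thesis by (rule that)
qed

section \<open>A polynomial is rarely small\<close>

text \<open>
  Factoring over the complex numbers turns estimates for a real polynomial into estimates for the
  distances from a real point to the roots.
\<close>

lemma real_poly_factor:
  fixes p :: "real poly"
  assumes "p \<noteq> 0"
  obtains A :: "complex multiset" where "size A = degree p"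
    "\<And>x. \<bar>poly p x\<bar> = \<bar>lead_coeff p\<bar> * (\<Prod>z\<in>#A. cmod (of_real x - z))"
proof -
  let ?q = "map_poly of_real p :: complex poly"
  have q0: "?q \<noteq> 0" using assms by (simp add: map_poly_eq_0_iff)
  have ev: "poly ?q (of_real x) = of_real (poly p x)" for x
    by (induction p) (auto simp: map_poly_pCons)
  have dq: "degree ?q = degree p" by (rule degree_map_poly) simp
  from alg_closed_imp_factorization[OF q0] obtain A
    where A: "size A = degree ?q" "?q = smult (lead_coeff ?q) (\<Prod>x\<in>#A. [:-x, 1:])" by blast
  have pr: "poly (\<Prod>x\<in>#A. [:-x, 1:]) w = (\<Prod>z\<in>#A. w - z)" for w :: complex
    by (induction A) (auto simp: algebra_simps)
  have nr: "cmod (\<Prod>z\<in>#A. w - z) = (\<Prod>z\<in>#A. cmod (w - z))" for w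
    by (induction A) (auto simp: norm_mult)
  have "\<bar>poly p x\<bar> = \<bar>lead_coeff p\<bar> * (\<Prod>z\<in>#A. cmod (of_real x - z))" for x
  proof -
    have "\<bar>poly p x\<bar> = cmod (poly ?q (of_real x))" by (simp add: ev)
    also have "poly ?q (of_real x) = lead_coeff ?q * (\<Prod>z\<in>#A. of_real x - z)"
      by (subst A(2)) (simp add: pr)
    also have "cmod \<dots> = \<bar>lead_coeff p\<bar> * (\<Prod>z\<in>#A. cmod (of_real x - z))"
      by (simp add: norm_mult nr dq coeff_map_poly)
    finally show ?thesis .
  qed
  with A(1) dq show thesis by (intro that) auto
qed

text \<open>
  The real points at distance at most \<open>t\<close> from the real part of a root. Outside this set every
  root is further away than \<open>t\<close>.
\<close>

definition strip :: "complex multiset \<Rightarrow> real \<Rightarrow> real set" where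
  "strip A t = (\<Union>z\<in>set_mset A. {Re z - t .. Re z + t})"

lemma strip_sets: "strip A t \<in> sets lborel"
  unfolding strip_def by (intro sets.finite_UN) auto

lemma emeasure_strip:
  assumes "0 \<le> t"
  shows "emeasure lborel (strip A t) \<le> ennreal (2 * real (size A) * t)"
proof (induction A)
  case empty
  then show ?case by (simp add: strip_def)
next
  case (add z A)
  have "strip (add_mset z A) t = {Re z - t .. Re z + t} \<union> strip A t" by (simp add: strip_def)
  then have "emeasure lborel (strip (add_mset z A) t)
      \<le> emeasure lborel {Re z - t .. Re z + t} + emeasure lborel (strip A t)"
    using emeasure_subadditive[of "{Re z - t .. Re z + t}" lborel "strip A t"] by (simp add: strip_sets del: sets_lborel)
  also have "\<dots> \<le> ennreal (2 * t) + ennreal (2 * real (size A) * t)"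
    using assms add by (intro add_mono) auto
  also have "\<dots> = ennreal (2 * real (size (add_mset z A)) * t)"
    using assms by (simp flip: ennreal_plus add: algebra_simps)
  finally show ?case .
qed

lemma notin_strip: "x \<notin> strip A t \<Longrightarrow> z \<in># A \<Longrightarrow> t < cmod (of_real x - z)"
proof -
  assume "x \<notin> strip A t" "z \<in># A"
  then have "t < \<bar>x - Re z\<bar>" by (auto simp: strip_def)
  also have "\<dots> \<le> cmod (of_real x - z)" using abs_Re_le_cmod[of "of_real x - z"] by simp
  finally show ?thesis .
qed

text \<open>
  Off the strip of width \<open>\<tau> (b - a)\<close> around the roots, moving from \<open>x\<close> to \<open>y\<close> changes the distance
  to each root by at most \<open>b - a\<close>, hence by at most a factor \<open>(1 + \<tau>) / \<tau>\<close>. So the value at \<open>x\<close> is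
  not much smaller than the largest value on the interval. The bounds depend on the degree only.
\<close>

lemma poly_large_off_small_set:
  fixes p :: "real poly"
  assumes "degree p \<le> D" "a < b" "0 < \<tau>" "y \<in> {a..b}" "\<rho> \<le> \<bar>poly p y\<bar>" "0 < \<rho>"
  obtains U where "U \<in> sets lborel" "emeasure lborel U \<le> ennreal (2 * real D * \<tau> * (b - a))"
    "\<And>x. x \<in> {a..b} - U \<Longrightarrow> (\<tau> / (1 + \<tau>)) ^ D * \<rho> \<le> \<bar>poly p x\<bar>"
proof -
  have "p \<noteq> 0" using assms by auto
  then obtain A where A: "size A = degree p"
      "\<And>x. \<bar>poly p x\<bar> = \<bar>lead_coeff p\<bar> * (\<Prod>z\<in>#A. cmod (of_real x - z))"
    using real_poly_factor[OF \<open>p \<noteq> 0\<close>] by blast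
  define \<theta> where "\<theta> = \<tau> / (1 + \<tau>)"
  have \<theta>: "0 < \<theta>" "\<theta> < 1" using assms by (auto simp: \<theta>_def field_simps)
  let ?U = "strip A (\<tau> * (b - a))"
  have "emeasure lborel ?U \<le> ennreal (2 * real (size A) * (\<tau> * (b - a)))"
    using assms by (intro emeasure_strip) auto
  also have "\<dots> \<le> ennreal (2 * real D * \<tau> * (b - a))"
    using assms A(1) by (intro ennreal_leI) (auto simp: mult.assoc intro!: mult_right_mono)
  finally have em: "emeasure lborel ?U \<le> ennreal (2 * real D * \<tau> * (b - a))" .
  have "\<theta> ^ D * \<rho> \<le> \<bar>poly p x\<bar>" if x: "x \<in> {a..b} - ?U" for x
  proof -
    have far: "\<theta> * cmod (of_real y - z) \<le> cmod (of_real x - z)" if z: "z \<in># A" for z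
    proof -
      have 1: "\<tau> * (b - a) < cmod (of_real x - z)" using x z notin_strip by blast
      have "cmod (of_real y - z) \<le> cmod (of_real x - z) + cmod (of_real y - of_real x)"
        using norm_triangle_ineq[of "of_real x - z" "of_real y - of_real x"] by simp
      also have "cmod (of_real y - of_real x) = \<bar>y - x\<bar>"
        by (metis norm_of_real of_real_diff)
      also have "\<bar>y - x\<bar> \<le> b - a" using x assms(4) by auto
      finally have 2: "cmod (of_real y - z) \<le> cmod (of_real x - z) + (b - a)" by simp
      have "\<tau> * cmod (of_real y - z) \<le> \<tau> * (cmod (of_real x - z) + (b - a))"
        using 2 assms(3) by (intro mult_left_mono) auto
      also have "\<dots> \<le> (1 + \<tau>) * cmod (of_real x - z)"
        using 1 by (simp add: algebra_simps)
      finally show ?thesis using assms(3) by (simp add: \<theta>_def field_simps)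
    qed
    have "\<theta> ^ size B * (\<Prod>z\<in>#B. cmod (of_real y - z)) \<le> (\<Prod>z\<in>#B. cmod (of_real x - z))"
      if "B \<subseteq># A" for B using that
    proof (induction B)
      case (add z B)
      from add.prems have "B \<subseteq># A" and z: "z \<in># A"
        by (auto intro: subset_mset.order_trans[of B "add_mset z B" A] mset_subset_eqD[of "add_mset z B" A])
      then have IH: "\<theta> ^ size B * (\<Prod>z\<in>#B. cmod (of_real y - z)) \<le> (\<Prod>z\<in>#B. cmod (of_real x - z))"
        by (intro add.IH)
      have "0 \<le> (\<Prod>z\<in>#B. cmod (of_real y - z))" by (induction B) auto
      then have "(\<theta> * cmod (of_real y - z)) * (\<theta> ^ size B * (\<Prod>z\<in>#B. cmod (of_real y - z)))
          \<le> cmod (of_real x - z) * (\<Prod>z\<in>#B. cmod (of_real x - z))"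
        using \<theta> by (intro mult_mono far[OF z] IH) auto
      then show ?case by (simp add: mult_ac)
    qed auto
    from this[of A] have "\<theta> ^ size A * (\<Prod>z\<in>#A. cmod (of_real y - z)) \<le> (\<Prod>z\<in>#A. cmod (of_real x - z))"
      by simp
    then have "\<bar>lead_coeff p\<bar> * (\<theta> ^ size A * (\<Prod>z\<in>#A. cmod (of_real y - z)))
        \<le> \<bar>lead_coeff p\<bar> * (\<Prod>z\<in>#A. cmod (of_real x - z))"
      by (intro mult_left_mono) auto
    then have "\<theta> ^ size A * \<bar>poly p y\<bar> \<le> \<bar>poly p x\<bar>"
      by (simp only: A(2) mult_ac)
    moreover have "\<theta> ^ D * \<rho> \<le> \<theta> ^ size A * \<bar>poly p y\<bar>"
      using \<theta> assms A(1) by (intro mult_mono power_decreasing) auto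
    ultimately show ?thesis by linarith
  qed
  with em strip_sets show thesis unfolding \<theta>_def by (intro that)
qed

text \<open>
  The leading coefficient is at least \<open>1\<close> in absolute value, and strips around the roots that are
  narrow in terms of the degree alone cannot cover the interval.
\<close>

lemma int_poly_large_somewhere:
  assumes "a < b"
  obtains c where "0 < c" "\<And>p. p \<in> int_polys D \<Longrightarrow> p \<noteq> 0 \<Longrightarrow> \<exists>y\<in>{a..b}. c \<le> \<bar>poly p y\<bar>"
proof -
  define t where "t = min 1 ((b - a) / (4 * real D + 4))"
  have t: "0 < t" "t \<le> 1" using assms by (auto simp: t_def)
  have "\<exists>y\<in>{a..b}. t ^ D \<le> \<bar>poly p y\<bar>" if p: "p \<in> int_polys D" "p \<noteq> 0" for p
  proof -
    obtain A where A: "size A = degree p"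
      "\<And>x. \<bar>poly p x\<bar> = \<bar>lead_coeff p\<bar> * (\<Prod>z\<in>#A. cmod (of_real x - z))"
      using real_poly_factor[OF p(2)] by blast
    have "\<not> {a..b} \<subseteq> strip A t"
    proof
      assume "{a..b} \<subseteq> strip A t"
      then have "emeasure lborel {a..b} \<le> emeasure lborel (strip A t)"
        by (intro emeasure_mono strip_sets)
      also have "\<dots> \<le> ennreal (2 * real (size A) * t)" using t by (intro emeasure_strip) auto
      finally have "b - a \<le> 2 * real (size A) * t"
        using assms t by (simp add: ennreal_le_iff)
      also have "\<dots> \<le> 2 * real D * ((b - a) / (4 * real D + 4))"
        using p A(1) t by (intro mult_mono) (auto simp: int_polys_def t_def)
      also have "\<dots> \<le> 1 / 2 * (b - a)" using assms by (simp add: field_simps)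
      also have "\<dots> < b - a" using assms by simp
      finally show False by simp
    qed
    then obtain y where y: "y \<in> {a..b}" "y \<notin> strip A t" by blast
    have "t ^ size B \<le> (\<Prod>z\<in>#B. cmod (of_real y - z))" if "B \<subseteq># A" for B using that
    proof (induction B)
      case (add z B)
      from add.prems have "B \<subseteq># A" and z: "z \<in># A"
        by (auto intro: subset_mset.order_trans[of B "add_mset z B" A] mset_subset_eqD[of "add_mset z B" A])
      then have IH: "t ^ size B \<le> (\<Prod>z\<in>#B. cmod (of_real y - z))"
        by (intro add.IH)
      have "t * t ^ size B \<le> cmod (of_real y - z) * (\<Prod>z\<in>#B. cmod (of_real y - z))"
        using t notin_strip[OF y(2) z] by (intro mult_mono IH) auto
      then show ?case by simp
    qed auto
    from this[of A] have 1: "t ^ size A \<le> (\<Prod>z\<in>#A. cmod (of_real y - z))" by simp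
    have "1 \<le> \<bar>lead_coeff p\<bar>"
    proof -
      have "lead_coeff p \<in> \<int>" using p by (auto simp: int_polys_def)
      then obtain k where k: "lead_coeff p = of_int k" by (elim Ints_cases)
      with p(2) have "k \<noteq> 0" by auto
      then show ?thesis unfolding k by linarith
    qed
    then have "1 * t ^ size A \<le> \<bar>poly p y\<bar>"
      unfolding A(2) using 1 t by (intro mult_mono) auto
    moreover have "t ^ D \<le> t ^ size A"
      using t p A(1) by (intro power_decreasing) (auto simp: int_polys_def)
    ultimately show ?thesis using y(1) by force
  qed
  then show thesis using t by (intro that[of "t ^ D"]) auto
qed

section \<open>Flags in a family of polynomials\<close>

text \<open>
  In a minimal subfamily with the same union, no point lies in three intervals: among these, the one
  that reaches furthest to the left and the one that reaches furthest to the right cover the third.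
  Integrating the number of intervals over a point gives the bound.
\<close>

lemma efficient_subcover:
  fixes F :: "(real \<times> real) set"
  assumes "finite F" and ab: "a < b" and sub: "\<And>l r. (l, r) \<in> F \<Longrightarrow> a \<le> l \<and> l < r \<and> r \<le> b"
  obtains G where "G \<subseteq> F" "(\<Union>(l, r)\<in>G. {l<..<r}) = (\<Union>(l, r)\<in>F. {l<..<r})"
    "(\<Sum>(l, r)\<in>G. r - l) \<le> 2 * (b - a)"
proof -
  define U where "U = (\<lambda>G :: (real \<times> real) set. \<Union>I\<in>G. {fst I<..<snd I})"
  define covers where "covers = (\<lambda>G. G \<subseteq> F \<and> U G = U F)"
  have "covers F" by (simp add: covers_def)
  from ex_has_least_nat[of covers, OF this, of card]
  obtain G where G': "covers G" and min': "\<And>G'. covers G' \<Longrightarrow> card G \<le> card G'" by metis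
  from G' have G: "G \<subseteq> F" "U G = U F" by (auto simp: covers_def)
  have min: "card G \<le> card G'" if "G' \<subseteq> F" "U G' = U F" for G'
    using min'[of G'] that by (simp add: covers_def)
  have fG: "finite G" using G assms finite_subset by blast
  have mult: "card {I \<in> G. x \<in> {fst I<..<snd I}} \<le> 2" for x
  proof (cases "{I \<in> G. x \<in> {fst I<..<snd I}} = {}")
    case False
    define H where "H = {I \<in> G. x \<in> {fst I<..<snd I}}"
    have fH: "finite H" "H \<noteq> {}" using fG False by (auto simp: H_def)
    obtain I1 where I1: "I1 \<in> H" "\<And>J. J \<in> H \<Longrightarrow> fst I1 \<le> fst J"
      using ex_is_arg_min_if_finite[OF fH, of fst] unfolding is_arg_min_linorder by metis
    obtain I2 where I2: "I2 \<in> H" "\<And>J. J \<in> H \<Longrightarrow> snd J \<le> snd I2"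
      using ex_is_arg_min_if_finite[OF fH, of "\<lambda>I. - snd I"]
      unfolding is_arg_min_linorder neg_le_iff_le by metis
    have "H \<subseteq> {I1, I2}"
    proof (rule ccontr)
      assume "\<not> H \<subseteq> {I1, I2}"
      then obtain J where J: "J \<in> H" "J \<noteq> I1" "J \<noteq> I2" by auto
      have "{fst J<..<snd J} \<subseteq> {fst I1<..<snd I1} \<union> {fst I2<..<snd I2}"
        using I1(1) I2(1) I1(2)[OF J(1)] I2(2)[OF J(1)] by (auto simp: H_def)
      moreover have "I1 \<in> G - {J}" "I2 \<in> G - {J}" using I1(1) I2(1) J by (auto simp: H_def)
      ultimately have "{fst J<..<snd J} \<subseteq> U (G - {J})" unfolding U_def by blast
      then have "U (G - {J}) = U G" unfolding U_def by blast
      then have "card G \<le> card (G - {J})" using G by (intro min) auto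
      moreover have "J \<in> G" using J by (auto simp: H_def)
      ultimately show False using fG by (metis card_Diff1_less not_le)
    qed
    then have "card H \<le> card {I1, I2}" by (intro card_mono) auto
    also have "\<dots> \<le> 2" by (simp add: card_insert_if)
    finally show ?thesis by (simp add: H_def)
  qed (metis card.empty le0)
  have len: "a \<le> fst I \<and> fst I < snd I \<and> snd I \<le> b" if "I \<in> G" for I
    using that G sub[of "fst I" "snd I"] by auto
  have "ennreal (\<Sum>I\<in>G. snd I - fst I) = (\<Sum>I\<in>G. ennreal (snd I - fst I))"
    using len by (intro sum_ennreal[symmetric]) (auto simp: less_imp_le)
  also have "\<dots> = (\<Sum>I\<in>G. \<integral>\<^sup>+x. indicator {fst I<..<snd I} x \<partial>lborel)"
    using len by (intro sum.cong refl) (auto simp: less_imp_le)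
  also have "\<dots> = (\<integral>\<^sup>+x. (\<Sum>I\<in>G. indicator {fst I<..<snd I} x) \<partial>lborel)"
    by (rule nn_integral_sum[symmetric]) auto
  also have "\<dots> \<le> (\<integral>\<^sup>+x. 2 * indicator {a<..<b} x \<partial>lborel)"
  proof (rule nn_integral_mono)
    fix x
    have "(\<Sum>I\<in>G. indicator {fst I<..<snd I} x :: ennreal) = (\<Sum>I\<in>{I \<in> G. x \<in> {fst I<..<snd I}}. 1)"
      unfolding sum.inter_filter[OF fG] by (rule sum.cong) (auto simp: indicator_def)
    also have "\<dots> = of_nat (card {I \<in> G. x \<in> {fst I<..<snd I}})" by simp
    also have "\<dots> \<le> 2 * indicator {a<..<b} x"
    proof (cases "x \<in> {a<..<b}")
      case True
      then show ?thesis using mult[of x] by (metis indicator_simps(1) mult.right_neutral of_nat_le_iff of_nat_numeral)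
    next
      case False
      have "{I \<in> G. x \<in> {fst I<..<snd I}} = {}"
        using len False by fastforce
      then show ?thesis by (metis card.empty of_nat_0 zero_le)
    qed
    finally show "(\<Sum>I\<in>G. indicator {fst I<..<snd I} x :: ennreal) \<le> 2 * indicator {a<..<b} x" .
  qed
  also have "\<dots> = 2 * ennreal (b - a)"
    using ab by (simp add: nn_integral_cmult)
  also have "\<dots> = ennreal (2 * (b - a))"
    by (subst ennreal_mult) (use ab in auto)
  finally have "(\<Sum>I\<in>G. snd I - fst I) \<le> 2 * (b - a)"
    using ab by (simp add: ennreal_le_iff)
  then show thesis using G unfolding U_def by (intro that[of G]) (auto simp: case_prod_beta)
qed

text \<open>
  A maximal interval on which the polynomial stays below \<open>\<rho>\<close> ends at a point with value \<open>\<rho>\<close> or at an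
  endpoint of the surrounding interval.
\<close>

lemma sublevel_component:
  fixes p :: "real poly"
  assumes "a < x" "x < b" "poly p x < \<rho>"
  obtains l r where "a \<le> l" "l < x" "x < r" "r \<le> b" "l = a \<or> poly p l = \<rho>" "r = b \<or> poly p r = \<rho>"
    "\<And>y. y \<in> {l<..<r} \<Longrightarrow> poly p y < \<rho>"
proof -
  define R where "R = insert a (insert b {y. poly (p - [:\<rho>:]) y = 0 \<and> a \<le> y \<and> y \<le> b})"
  have "p - [:\<rho>:] \<noteq> 0" using assms(3) by auto
  then have "finite {y. poly (p - [:\<rho>:]) y = 0}" by (rule poly_roots_finite)
  then have fR: "finite R" unfolding R_def by (auto intro: finite_subset[rotated])
  define l where "l = Max {y \<in> R. y < x}"
  define r where "r = Min {y \<in> R. x < y}"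
  have l: "l \<in> {y \<in> R. y < x}" unfolding l_def
    by (rule Max_in) (use fR assms in \<open>auto simp: R_def\<close>)
  have r: "r \<in> {y \<in> R. x < y}" unfolding r_def
    by (rule Min_in) (use fR assms in \<open>auto simp: R_def\<close>)
  have nR: "y \<notin> R \<or> y = x" if "y \<in> {l<..<r}" for y
  proof -
    have "y \<le> l" if "y \<in> R" "y < x" using that fR unfolding l_def by (intro Max_ge) auto
    moreover have "r \<le> y" if "y \<in> R" "x < y" using that fR unfolding r_def by (intro Min_le) auto
    ultimately show ?thesis using that by fastforce
  qed
  have lab: "a \<le> l" "r \<le> b" "l < x" "x < r" using l r assms by (auto simp: R_def)
  have noroot: "poly p y \<noteq> \<rho>" if "y \<in> {l<..<r}" for y
    using nR[OF that] that lab assms(3) by (auto simp: R_def)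
  have "poly p y < \<rho>" if y: "y \<in> {l<..<r}" for y
  proof (rule ccontr)
    assume "\<not> poly p y < \<rho>"
    then have gt: "poly p y > \<rho>" using noroot[OF y] by simp
    consider "y < x" | "y > x" using gt assms(3) by fastforce
    then show False
    proof cases
      case 1
      from IVT2[of "poly p" x \<rho> y] obtain z where "y \<le> z" "z \<le> x" "poly p z = \<rho>"
        using 1 gt assms(3) by (auto intro: poly_isCont)
      then show False using noroot[of z] y lab by auto
    next
      case 2
      from IVT[of "poly p" x \<rho> y] obtain z where "x \<le> z" "z \<le> y" "poly p z = \<rho>"
        using 2 gt assms(3) by (auto intro: poly_isCont)
      then show False using noroot[of z] y lab by auto
    qed
  qed
  moreover have "l = a \<or> poly p l = \<rho>" "r = b \<or> poly p r = \<rho>"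
    using l r assms by (auto simp: R_def)
  ultimately show thesis using lab by (intro that) auto
qed

text \<open>
  At the point \<open>x\<close> there is a chain \<open>F\<close> of sets on which the functions lie between \<open>\<epsilon> \<rho>\<close> and \<open>\<rho>\<close>,
  whereas they are at least \<open>\<rho>\<close> at all sets that could be added to the chain.
\<close>

definition marked :: "('a set \<Rightarrow> real poly) \<Rightarrow> real \<Rightarrow> real \<Rightarrow> 'a set set \<Rightarrow> real \<Rightarrow> bool" where
  "marked \<psi> \<epsilon> \<rho> S x \<longleftrightarrow> (\<exists>F\<subseteq>S. (\<forall>V\<in>F. \<forall>W\<in>F. V \<subseteq> W \<or> W \<subseteq> V) \<and>
     (\<forall>V\<in>F. \<epsilon> * \<rho> \<le> poly (\<psi> V) x \<and> poly (\<psi> V) x \<le> \<rho>) \<and>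
     (\<forall>V\<in>S - F. (\<forall>W\<in>F. V \<subseteq> W \<or> W \<subseteq> V) \<longrightarrow> \<rho> \<le> poly (\<psi> V) x))"

text \<open>
  Induction on the number of ranks. If all functions are at least \<open>\<rho>\<close> at \<open>x\<close>, the empty chain will do.
  Otherwise take, among all intervals around \<open>x\<close> on which some function stays below \<open>\<rho>\<close>, a maximal one,
  with the function of \<open>V\<close>, say. By maximality every function reaches \<open>\<rho>\<close> on its closure, so the
  induction hypothesis applies there to the sets comparable with \<open>V\<close>, whose ranks omit that of \<open>V\<close>;
  \<open>V\<close> joins the chain unless its own function is smaller than \<open>\<epsilon> \<rho>\<close>, which happens on a small set
  only. A cover by such intervals of multiplicity two accounts for the factor \<open>2 ^ m\<close>.
\<close>

lemma most_points_marked: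
  fixes \<psi> :: "'a set \<Rightarrow> real poly" and rk :: "'a set \<Rightarrow> nat"
  assumes "finite S" "\<And>V W. V \<in> S \<Longrightarrow> W \<in> S \<Longrightarrow> V \<subset> W \<Longrightarrow> rk V < rk W" "card (rk ` S) \<le> m" "a < b"
    and "\<And>V. V \<in> S \<Longrightarrow> degree (\<psi> V) \<le> D" "\<And>V. V \<in> S \<Longrightarrow> \<exists>y\<in>{a..b}. \<rho> \<le> poly (\<psi> V) y"
    and "\<And>V x. 0 \<le> poly (\<psi> V) x" "0 < \<rho>" "0 < \<tau>"
  shows "\<exists>X\<in>sets lborel. emeasure lborel X \<le> ennreal (real m * 2 ^ m * (2 * real D * \<tau>) * (b - a)) \<and>
      (\<forall>x\<in>{a<..<b} - X. marked \<psi> ((\<tau> / (1 + \<tau>)) ^ D) \<rho> S x)"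
  using assms(1-6)
proof (induction m arbitrary: S a b)
  case 0
  then have "S = {}" by simp
  then show ?case by (intro bexI[of _ "{}"]) (auto simp: marked_def)
next
  case (Suc m)
  define \<epsilon> where "\<epsilon> = (\<tau> / (1 + \<tau>)) ^ D"
  define \<eta> where "\<eta> = 2 * real D * \<tau>"
  have \<eta>: "0 \<le> \<eta>" using assms(9) by (simp add: \<eta>_def)
  \<comment> \<open>All endpoints of sublevel components are among finitely many points, so there are only finitely many candidate intervals.\<close>
  define R where "R = {a, b} \<union> (\<Union>V\<in>{V \<in> S. \<psi> V \<noteq> [:\<rho>:]}. {y. poly (\<psi> V - [:\<rho>:]) y = 0})"
  define K where "K = {(l, r). l \<in> R \<and> r \<in> R \<and> a \<le> l \<and> l < r \<and> r \<le> b \<and>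
      (\<exists>V\<in>S. \<forall>y\<in>{l<..<r}. poly (\<psi> V) y < \<rho>)}"
  have "finite {y. poly (\<psi> V - [:\<rho>:]) y = 0}" if "\<psi> V \<noteq> [:\<rho>:]" for V
    by (rule poly_roots_finite) (use that in simp)
  then have fR: "finite R"
    unfolding R_def using Suc.prems(1) by (intro finite_UnI finite_UN_I) auto
  have "K \<subseteq> R \<times> R" by (auto simp: K_def)
  then have fK: "finite K" using fR by (meson finite_SigmaI finite_subset)
  have comp: "\<exists>(l, r)\<in>K. x \<in> {l<..<r} \<and> (l = a \<or> poly (\<psi> V) l = \<rho>) \<and> (r = b \<or> poly (\<psi> V) r = \<rho>)"
    if V: "V \<in> S" "x \<in> {a<..<b}" "poly (\<psi> V) x < \<rho>" for V x
  proof -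
    from V(2,3) obtain l r where lr: "a \<le> l" "l < x" "x < r" "r \<le> b"
      "l = a \<or> poly (\<psi> V) l = \<rho>" "r = b \<or> poly (\<psi> V) r = \<rho>"
      "\<And>y. y \<in> {l<..<r} \<Longrightarrow> poly (\<psi> V) y < \<rho>"
      using sublevel_component[of a x b "\<psi> V" \<rho>] by auto
    have "\<psi> V \<noteq> [:\<rho>:]" using V(3) by auto
    then have "l \<in> R" "r \<in> R" using lr(5,6) V(1) by (auto simp: R_def)
    moreover have "\<exists>V\<in>S. \<forall>y\<in>{l<..<r}. poly (\<psi> V) y < \<rho>" using lr(7) V(1) by blast
    ultimately have "(l, r) \<in> K" using lr(1-4) unfolding K_def by simp
    then show ?thesis using lr by auto
  qed
  \<comment> \<open>The candidates that are maximal with respect to inclusion.\<close>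
  define M where "M = {(l, r) \<in> K. \<forall>(l', r')\<in>K. l' \<le> l \<and> r \<le> r' \<longrightarrow> l' = l \<and> r' = r}"
  have "M \<subseteq> K" by (auto simp: M_def)
  then have fM: "finite M" using fK finite_subset by blast
  have toM: "\<exists>I\<in>M. x \<in> {fst I<..<snd I}" if x: "J \<in> K" "x \<in> {fst J<..<snd J}" for J x
  proof -
    define L where "L = {I \<in> K. fst I \<le> fst J \<and> snd J \<le> snd I}"
    have "J \<in> L" using x(1) by (simp add: L_def)
    moreover have "finite L" using fK by (simp add: L_def)
    ultimately have "finite L" "L \<noteq> {}" by blast+
    from ex_is_arg_min_if_finite[OF this, of "\<lambda>I. fst I - snd I"]
    obtain I where I: "I \<in> L" "\<And>I'. I' \<in> L \<Longrightarrow> fst I - snd I \<le> fst I' - snd I'"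
      unfolding is_arg_min_linorder by metis
    have "I \<in> M"
    proof -
      have "l' = fst I \<and> r' = snd I" if "(l', r') \<in> K" "l' \<le> fst I" "snd I \<le> r'" for l' r'
      proof -
        have "(l', r') \<in> L" using that I(1) by (auto simp: L_def)
        from I(2)[OF this] that show ?thesis by simp
      qed
      then show ?thesis using I(1) by (auto simp: M_def L_def)
    qed
    then show ?thesis using I(1) x by (intro bexI[of _ I]) (auto simp: L_def)
  qed
  have step: "\<exists>X\<in>sets lborel. emeasure lborel X \<le> ennreal ((real m * 2 ^ m * \<eta> + \<eta>) * (snd I - fst I)) \<and>
      (\<forall>x\<in>{fst I<..<snd I} - X. marked \<psi> \<epsilon> \<rho> S x)" if "I \<in> M" for I
  proof -
    obtain l r where I: "I = (l, r)" by force
    have lrK: "(l, r) \<in> K" using that I by (auto simp: M_def)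
    then have lr: "a \<le> l" "l < r" "r \<le> b" by (auto simp: K_def)
    from lrK obtain V where V: "V \<in> S" "\<And>y. y \<in> {l<..<r} \<Longrightarrow> poly (\<psi> V) y < \<rho>"
      by (auto simp: K_def)
    \<comment> \<open>Otherwise a component of the sublevel set of \<open>W\<close> would contain this interval together with its endpoints in the interior of \<open>{a..b}\<close>, against maximality or the hypothesis on \<open>{a..b}\<close>.\<close>
    have big: "\<exists>y\<in>{l..r}. \<rho> \<le> poly (\<psi> W) y" if W: "W \<in> S" for W
    proof (rule ccontr)
      assume "\<not> ?thesis"
      then have small: "poly (\<psi> W) y < \<rho>" if "y \<in> {l..r}" for y using that by force
      define x where "x = (l + r) / 2"
      have x: "l < x" "x < r" using lr by (auto simp: x_def)
      obtain l' r' where lr': "(l', r') \<in> K" "x \<in> {l'<..<r'}"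
        "l' = a \<or> poly (\<psi> W) l' = \<rho>" "r' = b \<or> poly (\<psi> W) r' = \<rho>"
        using comp[OF W, of x] small[of x] x lr by fastforce
      have "l' \<le> l" using lr'(2,3) small[of l'] x lr by (cases "l' \<le> l") auto
      moreover have "r \<le> r'" using lr'(2,4) small[of r'] x lr by (cases "r \<le> r'") auto
      ultimately have eq: "l' = l" "r' = r" using that \<open>I \<in> M\<close> lr'(1) unfolding M_def I by auto
      have "l = a" using lr'(3) small[of l] lr eq by auto
      moreover have "r = b" using lr'(4) small[of r] lr eq by auto
      ultimately show False using Suc.prems(6)[OF W] small by force
    qed
    define S' where "S' = {W \<in> S. W \<subset> V \<or> V \<subset> W}"
    have "rk V \<notin> rk ` S'" using Suc.prems(2) V(1) unfolding S'_def by fastforce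
    then have "rk ` S' \<subset> rk ` S" using V(1) by (auto simp: S'_def)
    then have "card (rk ` S') < card (rk ` S)" using Suc.prems(1) by (intro psubset_card_mono) auto
    then have "card (rk ` S') \<le> m" using Suc.prems(3) by linarith
    then have "\<exists>X\<in>sets lborel. emeasure lborel X \<le> ennreal (real m * 2 ^ m * (2 * real D * \<tau>) * (r - l)) \<and>
        (\<forall>x\<in>{l<..<r} - X. marked \<psi> ((\<tau> / (1 + \<tau>)) ^ D) \<rho> S' x)"
      using Suc.prems big lr by (intro Suc.IH) (auto simp: S'_def)
    then obtain X where X: "X \<in> sets lborel" "emeasure lborel X \<le> ennreal (real m * 2 ^ m * \<eta> * (r - l))"
        "\<And>x. x \<in> {l<..<r} - X \<Longrightarrow> marked \<psi> \<epsilon> \<rho> S' x"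
      unfolding \<eta>_def \<epsilon>_def by auto
    obtain y where y: "y \<in> {l..r}" "\<rho> \<le> poly (\<psi> V) y" using big V by blast
    then have y': "\<rho> \<le> \<bar>poly (\<psi> V) y\<bar>" by linarith
    obtain U where U: "U \<in> sets lborel" "emeasure lborel U \<le> ennreal (\<eta> * (r - l))"
      "\<And>x. x \<in> {l..r} - U \<Longrightarrow> \<epsilon> * \<rho> \<le> \<bar>poly (\<psi> V) x\<bar>"
      using poly_large_off_small_set[OF Suc.prems(5)[OF V(1)] lr(2) assms(9) y(1) y' assms(8)]
      unfolding \<eta>_def \<epsilon>_def by blast
    have mk: "marked \<psi> \<epsilon> \<rho> S x" if x: "x \<in> {l<..<r} - (X \<union> U)" for x
    proof -
      have "marked \<psi> \<epsilon> \<rho> S' x" by (rule X(3)) (use x in auto)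
      then obtain F where F: "F \<subseteq> S'" "\<forall>V\<in>F. \<forall>W\<in>F. V \<subseteq> W \<or> W \<subseteq> V"
        "\<forall>V\<in>F. \<epsilon> * \<rho> \<le> poly (\<psi> V) x \<and> poly (\<psi> V) x \<le> \<rho>"
        "\<forall>V\<in>S' - F. (\<forall>W\<in>F. V \<subseteq> W \<or> W \<subseteq> V) \<longrightarrow> \<rho> \<le> poly (\<psi> V) x"
        unfolding marked_def by (elim exE conjE) (rule that)
      have "\<epsilon> * \<rho> \<le> poly (\<psi> V) x" using U(3)[of x] x assms(7)[of V x] by auto
      moreover have "poly (\<psi> V) x \<le> \<rho>" using V(2)[of x] x by auto
      ultimately have "\<forall>W\<in>insert V F. \<epsilon> * \<rho> \<le> poly (\<psi> W) x \<and> poly (\<psi> W) x \<le> \<rho>" using F(3) by blast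
      moreover have "insert V F \<subseteq> S" using F(1) V(1) by (auto simp: S'_def)
      moreover have "\<forall>A\<in>insert V F. \<forall>B\<in>insert V F. A \<subseteq> B \<or> B \<subseteq> A"
        using F(1,2) unfolding S'_def by blast
      moreover have "\<forall>A\<in>S - insert V F. (\<forall>B\<in>insert V F. A \<subseteq> B \<or> B \<subseteq> A) \<longrightarrow> \<rho> \<le> poly (\<psi> A) x"
        using F(4) unfolding S'_def by blast
      ultimately show ?thesis unfolding marked_def by (intro exI[of _ "insert V F"] conjI)
    qed
    have "emeasure lborel (X \<union> U) \<le> emeasure lborel X + emeasure lborel U"
      using X(1) U(1) by (intro emeasure_subadditive)
    also have "\<dots> \<le> ennreal (real m * 2 ^ m * \<eta> * (r - l)) + ennreal (\<eta> * (r - l))"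
      using X(2) U(2) by (intro add_mono)
    also have "\<dots> = ennreal ((real m * 2 ^ m * \<eta> + \<eta>) * (r - l))"
      using lr \<eta> by (subst ennreal_plus[symmetric]) (simp_all add: distrib_right)
    finally show ?thesis using mk X(1) U(1) unfolding I
      by (intro bexI[of _ "X \<union> U"]) auto
  qed
  have Mab: "a \<le> l \<and> l < r \<and> r \<le> b" if "(l, r) \<in> M" for l r
    using that by (auto simp: M_def K_def)
  obtain G where G: "G \<subseteq> M" "(\<Union>(l, r)\<in>G. {l<..<r}) = (\<Union>(l, r)\<in>M. {l<..<r})"
    "(\<Sum>(l, r)\<in>G. r - l) \<le> 2 * (b - a)"
    by (rule efficient_subcover[OF fM Suc.prems(4) Mab])
  have fG: "finite G" using G(1) fM finite_subset by blast
  from bchoice[of G] step G(1) obtain X where X: "\<And>I. I \<in> G \<Longrightarrow> X I \<in> sets lborel"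
    "\<And>I. I \<in> G \<Longrightarrow> emeasure lborel (X I) \<le> ennreal ((real m * 2 ^ m * \<eta> + \<eta>) * (snd I - fst I))"
    "\<And>I x. I \<in> G \<Longrightarrow> x \<in> {fst I<..<snd I} - X I \<Longrightarrow> marked \<psi> \<epsilon> \<rho> S x"
    by (metis (no_types, lifting) subsetD)
  have "emeasure lborel (\<Union>(X ` G)) \<le> (\<Sum>I\<in>G. emeasure lborel (X I))"
    using X(1) fG by (intro emeasure_subadditive_finite) auto
  also have "\<dots> \<le> (\<Sum>I\<in>G. ennreal ((real m * 2 ^ m * \<eta> + \<eta>) * (snd I - fst I)))"
    by (intro sum_mono X(2))
  also have "\<dots> = ennreal (\<Sum>I\<in>G. (real m * 2 ^ m * \<eta> + \<eta>) * (snd I - fst I))"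
  proof (rule sum_ennreal)
    fix I assume "I \<in> G"
    then have "fst I < snd I" using Mab[of "fst I" "snd I"] G(1) by auto
    then show "0 \<le> (real m * 2 ^ m * \<eta> + \<eta>) * (snd I - fst I)" using \<eta> by simp
  qed
  also have "\<dots> \<le> ennreal (real (Suc m) * 2 ^ Suc m * \<eta> * (b - a))"
  proof (rule ennreal_leI)
    have "(\<Sum>I\<in>G. (real m * 2 ^ m * \<eta> + \<eta>) * (snd I - fst I))
        = (real m * 2 ^ m * \<eta> + \<eta>) * (\<Sum>I\<in>G. snd I - fst I)"
      by (simp add: sum_distrib_left)
    also have "\<dots> \<le> (real m * 2 ^ m * \<eta> + \<eta>) * (2 * (b - a))"
      using G(3) \<eta> by (intro mult_left_mono) (auto simp: case_prod_beta)
    also have "\<dots> = (real m * 2 ^ Suc m + 2) * (\<eta> * (b - a))" by (simp add: algebra_simps)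
    also have "\<dots> \<le> (real (Suc m) * 2 ^ Suc m) * (\<eta> * (b - a))"
    proof (rule mult_right_mono)
      have "(2::real) \<le> 2 ^ Suc m" by simp
      then show "real m * 2 ^ Suc m + 2 \<le> real (Suc m) * 2 ^ Suc m" by (simp add: algebra_simps)
    qed (use \<eta> Suc.prems(4) in auto)
    finally show "(\<Sum>I\<in>G. (real m * 2 ^ m * \<eta> + \<eta>) * (snd I - fst I)) \<le> real (Suc m) * 2 ^ Suc m * \<eta> * (b - a)"
      by (simp add: mult.assoc)
  qed
  finally have em: "emeasure lborel (\<Union>(X ` G)) \<le> ennreal (real (Suc m) * 2 ^ Suc m * \<eta> * (b - a))" .
  have "marked \<psi> \<epsilon> \<rho> S x" if x: "x \<in> {a<..<b} - \<Union>(X ` G)" for x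
  proof (cases "\<exists>V\<in>S. poly (\<psi> V) x < \<rho>")
    case False
    then show ?thesis unfolding marked_def by (intro exI[of _ "{}"]) force
  next
    case True
    then obtain V where "V \<in> S" "poly (\<psi> V) x < \<rho>" by blast
    with comp[of V x] x obtain J where "J \<in> K" "x \<in> {fst J<..<snd J}" by auto
    then have "x \<in> (\<Union>(l, r)\<in>M. {l<..<r})" using toM[of J x] by (auto simp: case_prod_beta)
    then obtain I where I: "I \<in> G" "x \<in> {fst I<..<snd I}"
      unfolding G(2)[symmetric] by (auto simp: case_prod_beta)
    show ?thesis by (rule X(3)[OF I(1)]) (use I x in auto)
  qed
  then show ?case using em X(1) fG unfolding \<eta>_def \<epsilon>_def
    by (intro bexI[of _ "\<Union>(X ` G)"]) auto
qed

section \<open>Determinants of variable size\<close>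

text \<open>
  Determinants of size \<open>k\<close> with entries given by a function of the indices, since the dimensions of
  the subspaces below vary within one argument.
\<close>

definition det_fun :: "nat \<Rightarrow> (nat \<Rightarrow> nat \<Rightarrow> 'a :: comm_ring_1) \<Rightarrow> 'a" where
  "det_fun k f = Determinant.det (Matrix.mat k k (\<lambda>(i, j). f i j))"

lemma det_fun_leibniz:
  "det_fun k f = (\<Sum>p | p permutes {..<k}. signof p * (\<Prod>i<k. f i (p i)))"
proof -
  have "Matrix.mat k k (\<lambda>(i, j). f i j) \<in> carrier_mat k k" by simp
  then have "det_fun k f = (\<Sum>p | p permutes {0..<k}. signof p *
      (\<Prod>i = 0..<k. Matrix.mat k k (\<lambda>(i, j). f i j) $$ (i, p i)))"
    unfolding det_fun_def by (rule Determinant.det_def')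
  also have "\<dots> = (\<Sum>p | p permutes {..<k}. signof p * (\<Prod>i<k. f i (p i)))"
    unfolding atLeast0LessThan
  proof (intro sum.cong refl arg_cong2[where f = "(*)"] prod.cong)
    fix p i assume p: "p \<in> {p. p permutes {..<k}}" and i: "i \<in> {..<k}"
    then have "p i < k" using permutes_in_image[of p "{..<k}" i] by auto
    then show "Matrix.mat k k (\<lambda>(i, j). f i j) $$ (i, p i) = f i (p i)" using i by simp
  qed
  finally show ?thesis .
qed

lemma det_fun_cong: "(\<And>i j. i < k \<Longrightarrow> j < k \<Longrightarrow> f i j = g i j) \<Longrightarrow> det_fun k f = det_fun k g"
  unfolding det_fun_def by (rule arg_cong[where f = Determinant.det]) (auto intro!: eq_matI)

lemma det_fun_0 [simp]: "det_fun 0 f = 1"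
  by (simp add: det_fun_leibniz)

lemma det_fun_mult:
  "det_fun k (\<lambda>i j. \<Sum>l<k. f i l * g l j) = det_fun k f * det_fun k g"
proof -
  let ?M = "\<lambda>f. Matrix.mat k k (\<lambda>(i, j). f i j)"
  have "?M f * ?M g = ?M (\<lambda>i j. \<Sum>l<k. f i l * g l j)"
    by (rule eq_matI) (auto simp: scalar_prod_def atLeast0LessThan)
  then show ?thesis
    unfolding det_fun_def using det_mult[of "?M f" k "?M g"] by simp
qed

lemma det_fun_scale:
  "det_fun k (\<lambda>i j. r i * s j * f i j) = (\<Prod>i<k. r i) * (\<Prod>j<k. s j) * det_fun k f"
proof -
  have "(\<Prod>i<k. r i * s (p i) * f i (p i)) = (\<Prod>i<k. r i) * (\<Prod>j<k. s j) * (\<Prod>i<k. f i (p i))"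
    if "p permutes {..<k}" for p
  proof -
    have "(\<Prod>i<k. s (p i)) = (\<Prod>j<k. s j)"
      using prod.permute[OF that, of s] by (simp add: o_def)
    then show ?thesis by (simp add: prod.distrib)
  qed
  then show ?thesis
    by (auto simp: det_fun_leibniz sum_distrib_left mult_ac intro!: sum.cong)
qed

lemma det_fun_tendsto:
  fixes f :: "'b \<Rightarrow> nat \<Rightarrow> nat \<Rightarrow> real"
  assumes "\<And>i j. i < k \<Longrightarrow> j < k \<Longrightarrow> ((\<lambda>x. f x i j) \<longlongrightarrow> g i j) F"
  shows "((\<lambda>x. det_fun k (f x)) \<longlongrightarrow> det_fun k g) F"
  unfolding det_fun_leibniz
proof (intro tendsto_intros)
  fix p i assume p: "p \<in> {p. p permutes {..<k}}" and i: "i \<in> {..<k}"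
  then have "p i < k" using permutes_in_image[of p "{..<k}" i] by auto
  then show "((\<lambda>x. f x i (p i)) \<longlongrightarrow> g i (p i)) F" using assms i by auto
qed

lemma poly_det_fun: "poly (det_fun k f) x = det_fun k (\<lambda>i j. poly (f i j) x)"
proof -
  have "poly (signof p) x = signof p" for p :: "nat \<Rightarrow> nat" by (simp add: sign_def)
  then show ?thesis by (simp add: det_fun_leibniz poly_sum poly_prod)
qed

lemma det_fun_kernel:
  fixes f :: "nat \<Rightarrow> nat \<Rightarrow> 'a :: idom"
  assumes "det_fun k f = 0"
  shows "\<exists>v. (\<exists>j<k. v j \<noteq> 0) \<and> (\<forall>i<k. (\<Sum>j<k. f i j * v j) = 0)"
proof -
  let ?A = "Matrix.mat k k (\<lambda>(i, j). f i j)"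
  from assms obtain v where v: "v \<in> carrier_vec k" "v \<noteq> 0\<^sub>v k" "?A *\<^sub>v v = 0\<^sub>v k"
    unfolding det_fun_def using det_0_iff_vec_prod_zero[of ?A k] by auto
  have "\<exists>j<k. v $ j \<noteq> 0"
  proof (rule ccontr)
    assume "\<not> ?thesis"
    then have "v = 0\<^sub>v k" using v(1) by (intro eq_vecI) auto
    with v(2) show False by simp
  qed
  moreover have "(\<Sum>j<k. f i j * v $ j) = 0" if i: "i < k" for i
  proof -
    have "(?A *\<^sub>v v) $ i = (\<Sum>j<k. f i j * v $ j)"
      using i v(1) by (auto simp: scalar_prod_def atLeast0LessThan)
    with v(3) i show ?thesis by simp
  qed
  ultimately show ?thesis by (intro exI[of _ "vec_index v"]) auto
qed

lemma det_fun_lower_triangular: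
  assumes "\<And>i j. i < j \<Longrightarrow> j < k \<Longrightarrow> f i j = 0"
  shows "det_fun k f = (\<Prod>i<k. f i i)"
proof -
  let ?A = "Matrix.mat k k (\<lambda>(i, j). f i j)"
  have "det_fun k f = prod_list (diag_mat ?A)"
    unfolding det_fun_def by (rule det_lower_triangular[of k]) (use assms in auto)
  also have "diag_mat ?A = map (\<lambda>i. f i i) [0..<k]"
    unfolding diag_mat_def by simp
  also have "prod_list \<dots> = (\<Prod>i<k. f i i)"
    by (simp add: prod.distinct_set_conv_list[symmetric] atLeast0LessThan)
  finally show ?thesis .
qed

lemma det_fun_laplace_last:
  "det_fun (Suc k) f = (\<Sum>j<Suc k. f k j * ((-1) ^ (k + j) * det_fun k (\<lambda>i l. f i (insert_index j l))))"
proof -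
  let ?A = "Matrix.mat (Suc k) (Suc k) (\<lambda>(i, j). f i j)"
  have "cofactor ?A k j = (-1) ^ (k + j) * det_fun k (\<lambda>i l. f i (insert_index j l))" if j: "j < Suc k" for j
  proof -
    have "mat_delete ?A k j = Matrix.mat k k (\<lambda>(i, l). f i (insert_index j l))"
      unfolding mat_delete_def using j by (intro eq_matI) (auto simp: insert_index_def)
    then show ?thesis by (simp add: cofactor_def det_fun_def)
  qed
  then show ?thesis
    unfolding det_fun_def[of "Suc k"] by (subst laplace_expansion_row[of _ "Suc k" k]) auto
qed

section \<open>Wronskians\<close>

text \<open>
  The minor, with columns selected by \<open>c\<close>, of the matrix of all Taylor coefficients of \<open>v 0\<close>, ...,
  \<open>v (k - 1)\<close>, as a polynomial in the point of expansion. For \<open>c j = j\<close> this is the Wronskian up to a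
  constant.
\<close>

definition taylor_minor :: "nat \<Rightarrow> (nat \<Rightarrow> real poly) \<Rightarrow> (nat \<Rightarrow> nat) \<Rightarrow> real poly" where
  "taylor_minor k v c = det_fun k (\<lambda>i j. hasse (c j) (v i))"

lemma poly_taylor_minor: "poly (taylor_minor k v c) x = det_fun k (\<lambda>i j. poly (hasse (c j) (v i)) x)"
  by (simp add: taylor_minor_def poly_det_fun)

lemma taylor_minor_combination:
  assumes "\<And>i. i < k \<Longrightarrow> v i = (\<Sum>l<k. smult (C i l) (b l))"
  shows "taylor_minor k v c = smult (det_fun k C) (taylor_minor k b c)"
proof -
  have "poly (taylor_minor k v c) x = poly (smult (det_fun k C) (taylor_minor k b c)) x" for x
  proof -
    have "poly (taylor_minor k v c) x = det_fun k (\<lambda>i j. \<Sum>l<k. C i l * poly (hasse (c j) (b l)) x)"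
      unfolding poly_taylor_minor by (rule det_fun_cong) (simp add: assms hasse_sum hasse_smult poly_sum)
    also have "\<dots> = det_fun k C * poly (taylor_minor k b c) x"
      by (simp add: det_fun_mult poly_taylor_minor)
    finally show ?thesis by simp
  qed
  then show ?thesis by (intro poly_eq_poly_eq_iff[THEN iffD1] ext)
qed

lemma hasse_leading_tendsto:
  fixes p :: "real poly"
  shows "((\<lambda>x. x ^ j * poly (hasse j p) x / x ^ degree p) \<longlongrightarrow> of_nat (degree p choose j) * lead_coeff p) at_top"
proof -
  let ?e = "degree p"
  have "((\<lambda>x. \<Sum>i\<le>?e. of_nat (i choose j) * coeff p i * (x ^ i / x ^ ?e)) \<longlongrightarrow>
      (\<Sum>i\<le>?e. of_nat (i choose j) * coeff p i * (if i = ?e then 1 else 0))) at_top"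
  proof (intro tendsto_sum tendsto_mult tendsto_const)
    fix i assume i: "i \<in> {..?e}"
    show "((\<lambda>x::real. x ^ i / x ^ ?e) \<longlongrightarrow> (if i = ?e then 1 else 0)) at_top"
    proof (cases "i = ?e")
      case True
      have "\<forall>\<^sub>F x::real in at_top. x ^ i / x ^ ?e = 1"
        using eventually_gt_at_top[of 0] by eventually_elim (simp add: True)
      then show ?thesis using True by (simp add: tendsto_eventually)
    next
      case False
      with i have "i < ?e" by simp
      then have "((\<lambda>x::real. inverse (x ^ (?e - i))) \<longlongrightarrow> 0) at_top"
        by (intro tendsto_inverse_0_at_top filterlim_pow_at_top filterlim_ident) auto
      moreover have "\<forall>\<^sub>F x::real in at_top. inverse (x ^ (?e - i)) = x ^ i / x ^ ?e"
        using eventually_gt_at_top[of 0]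
        by eventually_elim (use \<open>i < ?e\<close> in \<open>simp add: field_simps power_add[symmetric]\<close>)
      ultimately have "((\<lambda>x::real. x ^ i / x ^ ?e) \<longlongrightarrow> 0) at_top"
        by (rule Lim_transform_eventually)
      then show ?thesis using False by simp
    qed
  qed
  also have "(\<Sum>i\<le>?e. of_nat (i choose j) * coeff p i * (if i = ?e then 1 else 0)) = of_nat (?e choose j) * lead_coeff p"
    by (simp add: if_distrib sum.delta cong: if_cong)
  finally have lim: "((\<lambda>x. \<Sum>i\<le>?e. of_nat (i choose j) * coeff p i * (x ^ i / x ^ ?e))
      \<longlongrightarrow> of_nat (?e choose j) * lead_coeff p) at_top" .
  have "(\<Sum>i\<le>?e. of_nat (i choose j) * coeff p i * (x ^ i / x ^ ?e)) = x ^ j * poly (hasse j p) x / x ^ ?e" for x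
  proof -
    have "of_nat (i choose j) * coeff p i * (x ^ i / x ^ ?e)
        = x ^ j * (of_nat (i choose j) * coeff p i * x ^ (i - j)) / x ^ ?e" for i
      by (cases "i < j") (auto simp: binomial_eq_0 power_add[symmetric] field_simps)
    then show ?thesis
      unfolding poly_hasse[OF order_refl] sum_distrib_left sum_divide_distrib by (rule sum.cong[OF refl])
  qed
  then show ?thesis using lim by simp
qed

text \<open>
  An element of the kernel is a linear combination of the polynomials \<open>X choose j\<close> with \<open>j < k\<close>, of
  degree less than \<open>k\<close>, that vanishes at the \<open>k\<close> points \<open>e i\<close>. It is zero, and evaluating it at
  \<open>0\<close>, \<open>1\<close>, ... successively shows that its coefficients vanish.
\<close>

lemma binomial_det_nonzero:
  fixes e :: "nat \<Rightarrow> nat"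
  assumes "inj_on e {..<k}"
  shows "det_fun k (\<lambda>i j. real (e i choose j)) \<noteq> 0"
proof
  assume "det_fun k (\<lambda>i j. real (e i choose j)) = 0"
  from det_fun_kernel[OF this] obtain v where v: "\<exists>j<k. v j \<noteq> 0"
    "\<And>i. i < k \<Longrightarrow> (\<Sum>j<k. real (e i choose j) * v j) = 0" by blast
  \<comment> \<open>The falling factorials represent the binomial coefficients as polynomials in the upper argument.\<close>
  define q where "q = (\<Sum>j<k. smult (v j / fact j) (\<Prod>l<j. [:- real l, 1:]))"
  have ev: "poly q (real m) = (\<Sum>j<k. real (m choose j) * v j)" for m
  proof -
    have "(\<Prod>l<j. real m - real l) / fact j = real (m choose j)" for j
      by (simp add: binomial_gbinomial gbinomial_prod_rev atLeast0LessThan)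
    then have "v j / fact j * (\<Prod>l<j. real m - real l) = real (m choose j) * v j" for j
      by (metis mult.commute times_divide_eq_left times_divide_eq_right)
    then show ?thesis by (simp add: q_def poly_sum poly_prod)
  qed
  have k: "k > 0" using v(1) by auto
  have "degree (\<Prod>l<j. [:- real l, 1:]) \<le> j" for j
    using degree_prod_sum_le[of "{..<j}" "\<lambda>l. [:- real l, 1:]"] by simp
  then have "degree (smult c (\<Prod>l<j. [:- real l, 1:])) \<le> j" for c j
    by (rule order_trans[OF degree_smult_le])
  then have "degree (smult c (\<Prod>l<j. [:- real l, 1:])) \<le> k - 1" if "j < k" for c j
    using order_trans[of "degree (smult c (\<Prod>l<j. [:- real l, 1:]))" j "k - 1"] that by force
  then have dq: "degree q \<le> k - 1"
    unfolding q_def by (intro degree_sum_le) auto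
  have "q = 0"
  proof (rule ccontr)
    assume "q \<noteq> 0"
    have "card ((\<lambda>i. real (e i)) ` {..<k}) \<le> card {x. poly q x = 0}"
      using \<open>q \<noteq> 0\<close> v(2) by (intro card_mono poly_roots_finite) (auto simp: ev)
    moreover have "card ((\<lambda>i. real (e i)) ` {..<k}) = k"
      using assms by (subst card_image) (auto simp: inj_on_def)
    moreover have "card {x. poly q x = 0} \<le> degree q" by (rule card_poly_roots_bound[OF \<open>q \<noteq> 0\<close>])
    ultimately show False using dq k by linarith
  qed
  have "v m = 0" if "m < k" for m using that
  proof (induction m rule: less_induct)
    case (less m)
    have "0 = (\<Sum>j<k. real (m choose j) * v j)" using ev[of m] \<open>q = 0\<close> by simp
    also have "\<dots> = (\<Sum>j\<in>{m}. real (m choose j) * v j)"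
      using less by (intro sum.mono_neutral_right) (auto simp: binomial_eq_0 nat_neq_iff)
    finally show ?case by simp
  qed
  with v(1) show False by auto
qed

lemma smult_sum_right: "smult c (\<Sum>i\<in>A. f i) = (\<Sum>i\<in>A. smult c (f i))"
  by (induction A rule: infinite_finite_induct) (auto simp: smult_add_right)

text \<open>
  Subtracting a multiple of one polynomial from another of the same degree lowers the degree and
  preserves the hypothesis, so eventually one polynomial is zero or the degrees are distinct. In the latter
  case the Wronskian, suitably scaled, tends at infinity to the product of the leading coefficients
  and a determinant of binomial coefficients, hence is nonzero.
\<close>

lemma wronskian_zero_imp_dependent:
  assumes "taylor_minor k v (\<lambda>j. j) = 0"
  shows "\<exists>u. (\<exists>i<k. u i \<noteq> 0) \<and> (\<Sum>i<k. smult (u i) (v i)) = 0"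
  using assms
proof (induction "\<Sum>i<k. degree (v i)" arbitrary: v rule: less_induct)
  case less
  consider (zero) i where "i < k" "v i = 0"
    | (eq) i j where "i < k" "j < k" "i \<noteq> j" "degree (v i) = degree (v j)" "\<forall>i<k. v i \<noteq> 0"
    | (inj) "inj_on (\<lambda>i. degree (v i)) {..<k}" "\<forall>i<k. v i \<noteq> 0"
    unfolding inj_on_def by blast
  then show ?case
  proof cases
    case zero
    have "(\<Sum>l<k. smult (if l = i then 1 else 0) (v l)) = 0"
      by (rule sum.neutral) (use zero in auto)
    then show ?thesis using zero by (intro exI[of _ "\<lambda>l. if l = i then 1 else 0"]) auto
  next
    case eq
    define c where "c = lead_coeff (v i) / lead_coeff (v j)"
    define w where "w = v(i := v i - smult c (v j))"
    have c0: "lead_coeff (v j) \<noteq> 0" using eq by auto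
    define \<delta> :: "nat \<Rightarrow> nat \<Rightarrow> real" where "\<delta> = (\<lambda>a b. if a = b then 1 else 0)"
    have \<delta>: "(\<Sum>l<k. smult (\<delta> a l) (v l)) = v a" if "a < k" for a
      using that by (simp add: \<delta>_def if_distrib[of "\<lambda>x. smult x _"] sum.delta cong: if_cong)
    \<comment> \<open>The elementary matrix of the elimination step.\<close>
    define C where "C = (\<lambda>a l. \<delta> a l - (if a = i then c * \<delta> j l else 0))"
    have "w a = (\<Sum>l<k. smult (C a l) (v l))" if a: "a < k" for a
    proof -
      have "(\<Sum>l<k. smult (C a l) (v l)) = v a - smult (if a = i then c else 0) (v j)"
      proof -
        have "smult (C a l) (v l) = smult (\<delta> a l) (v l) - smult (if a = i then c else 0) (smult (\<delta> j l) (v l))" for l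
          by (simp add: C_def smult_diff_left)
        then show ?thesis
          by (simp only: sum_subtractf smult_sum_right[symmetric] \<delta>[OF a] \<delta>[OF eq(2)])
      qed
      then show ?thesis by (auto simp: w_def)
    qed
    then have "taylor_minor k w (\<lambda>j. j) = smult (det_fun k C) (taylor_minor k v (\<lambda>j. j))"
      by (rule taylor_minor_combination)
    then have w0: "taylor_minor k w (\<lambda>j. j) = 0" using less.prems by simp
    have wi: "w i = v i - smult c (v j)" by (simp add: w_def)
    have lift_dep: "\<exists>u. (\<exists>i<k. u i \<noteq> 0) \<and> (\<Sum>i<k. smult (u i) (v i)) = 0"
      if u: "\<exists>l<k. u l \<noteq> 0" "(\<Sum>l<k. smult (u l) (w l)) = 0" for u
    proof -
      define u' where "u' = (\<lambda>l. u l - (if l = j then u i * c else 0))"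
      have "(\<Sum>l<k. smult (u l) (w l)) = (\<Sum>l<k. smult (u l) (v l)) - smult (u i * c) (v j)"
      proof -
        have "(\<Sum>l<k. smult (u l) (w l)) = (\<Sum>l<k. smult (u l) (v l) - (if l = i then smult (u i * c) (v j) else 0))"
          by (rule sum.cong) (auto simp: w_def smult_diff_right)
        then show ?thesis using eq(1) by (simp add: sum_subtractf sum.delta)
      qed
      moreover have "(\<Sum>l<k. smult (u' l) (v l)) = (\<Sum>l<k. smult (u l) (v l)) - smult (u i * c) (v j)"
      proof -
        have "(\<Sum>l<k. smult (u' l) (v l)) = (\<Sum>l<k. smult (u l) (v l) - (if l = j then smult (u i * c) (v j) else 0))"
          by (rule sum.cong) (auto simp: u'_def smult_diff_left)
        then show ?thesis using eq(2) by (simp add: sum_subtractf sum.delta)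
      qed
      moreover have "\<exists>l<k. u' l \<noteq> 0"
      proof (cases "u i = 0")
        case True
        then show ?thesis using u(1) by (auto simp: u'_def)
      next
        case False
        then show ?thesis using eq by (intro exI[of _ i]) (auto simp: u'_def)
      qed
      ultimately show ?thesis using u(2) by (intro exI[of _ u']) auto
    qed
    show ?thesis
    proof (cases "w i = 0")
      case True
      have "(\<Sum>l<k. smult (\<delta> i l) (w l)) = 0"
        by (rule sum.neutral) (use True in \<open>auto simp: \<delta>_def\<close>)
      then show ?thesis using eq(1) by (intro lift_dep[of "\<delta> i"]) (auto simp: \<delta>_def)
    next
      case False
      have "degree (w i) \<le> degree (v i)"
        unfolding wi using eq(4) by (intro degree_diff_le) (auto intro: order_trans[OF degree_smult_le])
      moreover have "coeff (w i) (degree (v i)) = 0"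
        using c0 eq(4) by (simp add: wi c_def)
      moreover have "degree (w i) \<noteq> degree (v i)"
        using False \<open>coeff (w i) (degree (v i)) = 0\<close> by (metis leading_coeff_0_iff)
      ultimately have "degree (w i) < degree (v i)" by simp
      moreover have "degree (w l) \<le> degree (v l)" if "l < k" for l
        using \<open>degree (w i) \<le> degree (v i)\<close> by (cases "l = i") (auto simp: w_def)
      ultimately have "(\<Sum>l<k. degree (w l)) < (\<Sum>l<k. degree (v l))"
        using eq(1) by (intro sum_strict_mono_ex1) auto
      from less.hyps[OF this w0] show ?thesis using lift_dep by blast
    qed
  next
    case inj
    define e where "e = (\<lambda>i. degree (v i))"
    have zero: "det_fun k (\<lambda>i j. x ^ j * poly (hasse j (v i)) x / x ^ e i) = 0" for x :: real
    proof -
      have "det_fun k (\<lambda>i j. x ^ j * poly (hasse j (v i)) x / x ^ e i)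
          = det_fun k (\<lambda>i j. (1 / x ^ e i) * x ^ j * poly (hasse j (v i)) x)"
        by (rule det_fun_cong) simp
      also have "\<dots> = (\<Prod>i<k. 1 / x ^ e i) * (\<Prod>j<k. x ^ j) * poly (taylor_minor k v (\<lambda>j. j)) x"
        by (simp only: det_fun_scale poly_taylor_minor)
      finally show ?thesis using less.prems by simp
    qed
    have "((\<lambda>x. det_fun k (\<lambda>i j. x ^ j * poly (hasse j (v i)) x / x ^ e i)) \<longlongrightarrow>
        det_fun k (\<lambda>i j. of_nat (e i choose j) * lead_coeff (v i))) at_top"
      unfolding e_def by (intro det_fun_tendsto hasse_leading_tendsto)
    then have "det_fun k (\<lambda>i j. of_nat (e i choose j) * lead_coeff (v i)) = 0"
      by (simp add: zero tendsto_const_iff)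
    also have "det_fun k (\<lambda>i j. of_nat (e i choose j) * lead_coeff (v i))
        = det_fun k (\<lambda>i j. lead_coeff (v i) * 1 * of_nat (e i choose j))"
      by (rule det_fun_cong) simp
    also have "\<dots> = (\<Prod>i<k. lead_coeff (v i)) * (\<Prod>j<k. 1) * det_fun k (\<lambda>i j. of_nat (e i choose j))"
      by (rule det_fun_scale)
    finally have "(\<Prod>i<k. lead_coeff (v i)) = 0"
      using binomial_det_nonzero[of e k] inj by (simp add: e_def)
    then show ?thesis using inj by auto
  qed
qed

text \<open>
  Expanding at \<open>x\<close> instead of at \<open>0\<close> multiplies the square matrix of coefficients by a unipotent
  triangular matrix.
\<close>

lemma full_wronskian_constant:
  assumes "\<And>i. i < Suc n \<Longrightarrow> degree (v i) \<le> n"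
  shows "poly (taylor_minor (Suc n) v (\<lambda>j. j)) x = poly (taylor_minor (Suc n) v (\<lambda>j. j)) y"
proof -
  have "poly (taylor_minor (Suc n) v (\<lambda>j. j)) x = det_fun (Suc n) (\<lambda>i l. coeff (v i) l)" for x
  proof -
    have "poly (taylor_minor (Suc n) v (\<lambda>j. j)) x
        = det_fun (Suc n) (\<lambda>i j. \<Sum>l<Suc n. coeff (v i) l * (of_nat (l choose j) * x ^ (l - j)))"
      unfolding poly_taylor_minor using assms
      by (intro det_fun_cong) (simp add: poly_hasse[OF assms] mult_ac lessThan_Suc_atMost)
    also have "\<dots> = det_fun (Suc n) (\<lambda>i l. coeff (v i) l) * det_fun (Suc n) (\<lambda>l j. of_nat (l choose j) * x ^ (l - j))"
      by (rule det_fun_mult)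
    also have "det_fun (Suc n) (\<lambda>l j. of_nat (l choose j) * x ^ (l - j)) = 1"
      by (subst det_fun_lower_triangular) (auto simp: binomial_eq_0)
    finally show ?thesis by simp
  qed
  then show ?thesis by simp
qed

lemma int_coeffs_mult:
  fixes p q :: "real poly"
  shows "\<forall>i. coeff p i \<in> \<int> \<Longrightarrow> \<forall>i. coeff q i \<in> \<int> \<Longrightarrow> \<forall>i. coeff (p * q) i \<in> \<int>"
  by (auto simp: coeff_mult intro!: Ints_mult Ints_sum)

lemma int_coeffs_prod:
  fixes f :: "'b \<Rightarrow> real poly"
  shows "(\<And>a. a \<in> A \<Longrightarrow> \<forall>i. coeff (f a) i \<in> \<int>) \<Longrightarrow> \<forall>i. coeff (prod f A) i \<in> \<int>"
proof (induction A rule: infinite_finite_induct)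
  case (insert a A)
  then show ?case using int_coeffs_mult[of "f a" "prod f A"] by simp
qed (auto simp: coeff_1)

lemma taylor_minor_int_polys:
  assumes "\<And>i. i < k \<Longrightarrow> v i \<in> int_polys n"
  shows "taylor_minor k v c \<in> int_polys (k * n)"
proof -
  have deg: "degree (\<Prod>i<k. hasse (c (p i)) (v i)) \<le> k * n" for p
  proof -
    have "degree (\<Prod>i<k. hasse (c (p i)) (v i)) \<le> (\<Sum>i<k. degree (hasse (c (p i)) (v i)))"
      using degree_prod_sum_le[of "{..<k}"] by (simp add: o_def)
    also have "\<dots> \<le> (\<Sum>i<k. n)"
      using hasse_int_polys[OF assms] by (intro sum_mono) (auto simp: int_polys_def)
    finally show ?thesis by simp
  qed
  have ints: "\<forall>l. coeff (\<Prod>i<k. hasse (c (p i)) (v i)) l \<in> \<int>" for p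
    using hasse_int_polys[OF assms] by (intro int_coeffs_prod) (auto simp: int_polys_def)
  have sg: "signof p = (1 :: real poly) \<or> signof p = (- 1 :: real poly)" for p :: "nat \<Rightarrow> nat"
    by (simp add: sign_def)
  have "degree (signof p * (\<Prod>i<k. hasse (c (p i)) (v i))) \<le> k * n \<and>
      (\<forall>l. coeff (signof p * (\<Prod>i<k. hasse (c (p i)) (v i))) l \<in> \<int>)" for p :: "nat \<Rightarrow> nat"
    using sg[of p] deg[of p] ints[of p] by auto
  then show ?thesis
    unfolding int_polys_def taylor_minor_def det_fun_leibniz
    by (auto simp: coeff_sum intro!: degree_sum_le Ints_sum finite_permutations)
qed

section \<open>Covolumes of rational subspaces\<close>

interpretation rpoly: vector_space "Polynomial.smult :: real \<Rightarrow> real poly \<Rightarrow> real poly"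
  by unfold_locales (auto simp: smult_add_right smult_add_left)

definition indep :: "nat \<Rightarrow> (nat \<Rightarrow> real poly) \<Rightarrow> bool" where
  "indep k v \<longleftrightarrow> (\<forall>u. (\<Sum>i<k. smult (u i) (v i)) = 0 \<longrightarrow> (\<forall>i<k. u i = 0))"

lemma span_tuple:
  fixes k :: nat
  shows "rpoly.span (v ` {..<k}) = {(\<Sum>i<k. smult (u i) (v i)) | u. True}"
proof
  show "{(\<Sum>i<k. smult (u i) (v i)) | u. True} \<subseteq> rpoly.span (v ` {..<k})"
  proof safe
    fix u
    show "(\<Sum>i<k. smult (u i) (v i)) \<in> rpoly.span (v ` {..<k})"
      by (intro rpoly.span_sum rpoly.span_scale rpoly.span_base) auto
  qed
  show "rpoly.span (v ` {..<k}) \<subseteq> {(\<Sum>i<k. smult (u i) (v i)) | u. True}"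
  proof (rule rpoly.span_minimal)
    show "v ` {..<k} \<subseteq> {(\<Sum>i<k. smult (u i) (v i)) | u. True}"
    proof safe
      fix j assume j: "j < k"
      have "(\<Sum>i<k. smult (if i = j then 1 else 0) (v i)) = (\<Sum>i<k. if i = j then v i else 0)"
        by (rule sum.cong) auto
      also have "\<dots> = v j" using j by (simp add: sum.delta)
      finally show "\<exists>u. v j = (\<Sum>i<k. smult (u i) (v i)) \<and> True" by metis
    qed
    show "rpoly.subspace {(\<Sum>i<k. smult (u i) (v i)) | u. True}"
    proof (rule rpoly.subspaceI)
      show "0 \<in> {(\<Sum>i<k. smult (u i) (v i)) | u. True}"
        by (intro CollectI exI[of _ "\<lambda>_. 0"]) simp
    next
      fix p q assume "p \<in> {(\<Sum>i<k. smult (u i) (v i)) | u. True}" "q \<in> {(\<Sum>i<k. smult (u i) (v i)) | u. True}"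
      then obtain u w where "p = (\<Sum>i<k. smult (u i) (v i))" "q = (\<Sum>i<k. smult (w i) (v i))" by blast
      then have "p + q = (\<Sum>i<k. smult (u i + w i) (v i))" by (simp add: smult_add_left sum.distrib)
      then show "p + q \<in> {(\<Sum>i<k. smult (u i) (v i)) | u. True}"
        by (intro CollectI exI[of _ "\<lambda>i. u i + w i"]) simp
    next
      fix c p assume "p \<in> {(\<Sum>i<k. smult (u i) (v i)) | u. True}"
      then obtain u where "p = (\<Sum>i<k. smult (u i) (v i))" by blast
      then have "smult c p = (\<Sum>i<k. smult (c * u i) (v i))" by (simp add: smult_sum_right)
      then show "smult c p \<in> {(\<Sum>i<k. smult (u i) (v i)) | u. True}"
        by (intro CollectI exI[of _ "\<lambda>i. c * u i"]) simp
    qed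
  qed
qed

lemma indep_inj: assumes "indep k v" shows "inj_on v {..<k}"
proof (rule inj_onI)
  fix i j assume ij: "i \<in> {..<k}" "j \<in> {..<k}" "v i = v j"
  show "i = j"
  proof (rule ccontr)
    assume "i \<noteq> j"
    define u :: "nat \<Rightarrow> real" where "u = (\<lambda>l. (if l = i then 1 else 0) - (if l = j then 1 else 0))"
    have "(\<Sum>l<k. smult (u l) (v l)) = (\<Sum>l<k. (if l = i then v l else 0) - (if l = j then v l else 0))"
      by (rule sum.cong) (auto simp: u_def)
    also have "\<dots> = 0" using ij by (simp add: sum_subtractf sum.delta)
    finally have "u i = 0" using assms ij unfolding indep_def by blast
    with \<open>i \<noteq> j\<close> show False by (simp add: u_def)
  qed
qed

lemma indep_iff: "indep k v \<longleftrightarrow> inj_on v {..<k} \<and> rpoly.independent (v ` {..<k})"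
proof
  assume ind: "indep k v"
  have inj: "inj_on v {..<k}" by (rule indep_inj[OF ind])
  have "rpoly.independent (v ` {..<k})"
  proof
    assume "rpoly.dependent (v ` {..<k})"
    then obtain u where u: "\<exists>p\<in>v ` {..<k}. u p \<noteq> 0" "(\<Sum>p\<in>v ` {..<k}. smult (u p) p) = 0"
      by (subst (asm) rpoly.dependent_finite) auto
    have "(\<Sum>i<k. smult (u (v i)) (v i)) = 0" using u(2) inj by (simp add: sum.reindex)
    then show False using ind u(1) unfolding indep_def by fastforce
  qed
  with inj show "inj_on v {..<k} \<and> rpoly.independent (v ` {..<k})" by simp
next
  assume r: "inj_on v {..<k} \<and> rpoly.independent (v ` {..<k})"
  show "indep k v" unfolding indep_def
  proof (intro allI impI)
    fix u i assume u: "(\<Sum>i<k. smult (u i) (v i)) = 0" and i: "i < k"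
    define w where "w = (\<lambda>p. u (the_inv_into {..<k} v p))"
    have wv: "w (v i) = u i" if "i < k" for i
      using that r by (simp add: w_def the_inv_into_f_f)
    have "(\<Sum>p\<in>v ` {..<k}. smult (w p) p) = (\<Sum>i<k. smult (u i) (v i))"
      using r by (simp add: sum.reindex wv)
    then have "\<forall>p\<in>v ` {..<k}. w p = 0"
      using r u rpoly.dependent_finite[of "v ` {..<k}"] by auto
    then show "u i = 0" using wv i by auto
  qed
qed

lemma indep_wronskian: "indep k v \<Longrightarrow> taylor_minor k v (\<lambda>j. j) \<noteq> 0"
  using wronskian_zero_imp_dependent[of k v] unfolding indep_def by blast

text \<open>
  A basis of the subspace \<open>V\<close> that consists of integer polynomials. It need not generate all integer
  points of \<open>V\<close>.
\<close>

definition integral_basis :: "nat \<Rightarrow> real poly set \<Rightarrow> nat \<Rightarrow> (nat \<Rightarrow> real poly) \<Rightarrow> bool" where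
  "integral_basis n V k v \<longleftrightarrow> (\<forall>i<k. v i \<in> int_polys n) \<and> indep k v \<and> V = rpoly.span (v ` {..<k})"

lemma integral_basis_dim: "integral_basis n V k v \<Longrightarrow> rpoly.dim V = k"
  unfolding integral_basis_def indep_iff
  by (auto simp: rpoly.dim_eq_card_independent card_image)

lemma integral_basis_exists:
  assumes "finite A" "A \<subseteq> int_polys n"
  shows "\<exists>v. integral_basis n (rpoly.span A) (rpoly.dim (rpoly.span A)) v"
proof -
  obtain B where B: "B \<subseteq> A" "rpoly.independent B" "A \<subseteq> rpoly.span B"
    using rpoly.maximal_independent_subset by blast
  have fB: "finite B" using B(1) assms(1) finite_subset by blast
  then obtain v where v: "bij_betw v {..<card B} B"
    using ex_bij_betw_nat_finite[of B] by (auto simp: atLeast0LessThan)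
  have "rpoly.span A = rpoly.span B"
  proof
    show "rpoly.span A \<subseteq> rpoly.span B" by (intro rpoly.span_minimal B rpoly.subspace_span)
    show "rpoly.span B \<subseteq> rpoly.span A" by (intro rpoly.span_mono B)
  qed
  moreover have "v ` {..<card B} = B" "inj_on v {..<card B}" using v by (auto simp: bij_betw_def)
  ultimately have "integral_basis n (rpoly.span A) (card B) v"
    using B(1,2) assms(2) unfolding integral_basis_def indep_iff by auto
  with integral_basis_dim show ?thesis by metis
qed

lemma independent_card_le_degree:
  assumes "rpoly.independent B" "\<And>p. p \<in> B \<Longrightarrow> degree p \<le> n"
  shows "card B \<le> Suc n"
proof -
  have "B \<subseteq> rpoly.span ((\<lambda>i. monom 1 i) ` {..n})"
  proof
    fix p assume "p \<in> B"
    then have "p = (\<Sum>j\<le>n. smult (coeff p j) (monom 1 j))"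
      using poly_as_sum_of_monoms'[of p n] assms(2) by (simp add: smult_monom)
    also have "\<dots> \<in> rpoly.span ((\<lambda>i. monom 1 i) ` {..n})"
      by (intro rpoly.span_sum rpoly.span_scale rpoly.span_base) auto
    finally show "p \<in> rpoly.span ((\<lambda>i. monom 1 i) ` {..n})" .
  qed
  then have "card B \<le> card ((\<lambda>i. monom (1::real) i) ` {..n})"
    using assms(1) by (intro rpoly.independent_span_bound[THEN conjunct2]) auto
  also have "\<dots> \<le> Suc n" using card_image_le[of "{..n}"] by simp
  finally show ?thesis .
qed

lemma integral_basis_le:
  assumes "integral_basis n V k v"
  shows "k \<le> Suc n"
proof -
  have "card (v ` {..<k}) \<le> Suc n"
    using assms by (intro independent_card_le_degree) (auto simp: integral_basis_def indep_iff int_polys_def)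
  then show ?thesis using assms by (auto simp: integral_basis_def indep_iff card_image)
qed

lemma integral_basis_extend:
  assumes "integral_basis n V k v" "p \<in> int_polys n" "p \<notin> V"
  shows "integral_basis n (rpoly.span (insert p V)) (Suc k) (v(k := p))"
proof -
  let ?v = "v(k := p)"
  have im: "?v ` {..<Suc k} = insert p (v ` {..<k})" by (auto simp: lessThan_Suc)
  have V: "V = rpoly.span (v ` {..<k})" and ind: "inj_on v {..<k}" "rpoly.independent (v ` {..<k})"
    using assms(1) by (auto simp: integral_basis_def indep_iff)
  have "p \<notin> v ` {..<k}" using assms(3) V rpoly.span_superset[of "v ` {..<k}"] by blast
  then have "inj_on ?v {..<Suc k}" using ind(1) by (auto simp: inj_on_def lessThan_Suc)
  moreover have "rpoly.independent (?v ` {..<Suc k})"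
    unfolding im using assms(3) V ind(2) by (intro rpoly.independent_insertI) auto
  moreover have "rpoly.span (insert p V) = rpoly.span (?v ` {..<Suc k})"
  proof
    show "rpoly.span (insert p V) \<subseteq> rpoly.span (?v ` {..<Suc k})"
      unfolding im V
    proof (rule rpoly.span_minimal[OF _ rpoly.subspace_span])
      show "insert p (rpoly.span (v ` {..<k})) \<subseteq> rpoly.span (insert p (v ` {..<k}))"
        using rpoly.span_mono[of "v ` {..<k}" "insert p (v ` {..<k})"] rpoly.span_base[of p "insert p (v ` {..<k})"]
        by blast
    qed
    show "rpoly.span (?v ` {..<Suc k}) \<subseteq> rpoly.span (insert p V)"
      unfolding im V by (intro rpoly.span_mono insert_mono) (auto intro: rpoly.span_base)
  qed
  ultimately show ?thesis
    using assms(1,2) unfolding integral_basis_def indep_iff by (auto simp: less_Suc_eq)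
qed

text \<open>
  By the Cauchy-Binet formula this is \<open>k!\<close> times the square of the covolume of the lattice that \<open>v\<close>
  generates, taken with respect to weighted Taylor coefficients, as a polynomial in the point of
  expansion: each set of \<open>k\<close> columns is counted \<open>k!\<close> times, and repeated columns contribute nothing.
\<close>

definition covol :: "(nat \<Rightarrow> real) \<Rightarrow> nat \<Rightarrow> nat \<Rightarrow> (nat \<Rightarrow> real poly) \<Rightarrow> real poly" where
  "covol d n k v = (\<Sum>c\<in>PiE {..<k} (\<lambda>_. {..n}). smult ((\<Prod>j<k. d (c j))\<^sup>2) ((taylor_minor k v c)\<^sup>2))"

lemma poly_covol:
  "poly (covol d n k v) x = (\<Sum>c\<in>PiE {..<k} (\<lambda>_. {..n}).
     (det_fun k (\<lambda>i j. d (c j) * poly (hasse (c j) (v i)) x))\<^sup>2)"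
proof -
  have "det_fun k (\<lambda>i j. d (c j) * poly (hasse (c j) (v i)) x) = (\<Prod>j<k. d (c j)) * poly (taylor_minor k v c) x" for c
    using det_fun_scale[of k "\<lambda>_. 1" "\<lambda>j. d (c j)" "\<lambda>i j. poly (hasse (c j) (v i)) x"]
    by (simp add: poly_taylor_minor)
  then show ?thesis by (simp add: covol_def poly_sum power_mult_distrib)
qed

lemma covol_nonneg: "0 \<le> poly (covol d n k v) x"
  unfolding poly_covol by (intro sum_nonneg) auto

lemma covol_0: "covol d n 0 v = 1"
  by (simp add: covol_def taylor_minor_def)

lemma degree_covol:
  assumes "\<And>i. i < k \<Longrightarrow> v i \<in> int_polys n"
  shows "degree (covol d n k v) \<le> 2 * (k * n)"
  unfolding covol_def
proof (intro degree_sum_le finite_PiE order_trans[OF degree_smult_le])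
  fix c
  have "degree (taylor_minor k v c) \<le> k * n" using taylor_minor_int_polys[OF assms] by (auto simp: int_polys_def)
  moreover have "degree ((taylor_minor k v c)\<^sup>2) \<le> degree (taylor_minor k v c) * 2" by (rule degree_power_le)
  ultimately show "degree ((taylor_minor k v c)\<^sup>2) \<le> 2 * (k * n)" by linarith
qed auto

lemma covol_combination:
  assumes "\<And>i. i < k \<Longrightarrow> v i = (\<Sum>l<k. smult (C i l) (b l))"
  shows "covol d n k v = smult ((det_fun k C)\<^sup>2) (covol d n k b)"
proof -
  have "taylor_minor k v c = smult (det_fun k C) (taylor_minor k b c)" for c
    by (rule taylor_minor_combination) (rule assms)
  then show ?thesis
    unfolding covol_def smult_sum_right
    by (intro sum.cong refl) (simp add: power2_eq_square mult_ac)
qed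

text \<open>
  Expansion of each minor along the row of \<open>p\<close>, whose entries are at most \<open>t\<close>.
\<close>

lemma covol_extend:
  assumes "\<And>j. j \<le> n \<Longrightarrow> \<bar>d j * poly (hasse j p) x\<bar> \<le> t"
  shows "poly (covol d n (Suc k) (v(k := p))) x \<le> (real (Suc k))\<^sup>2 * real (Suc n) ^ Suc k * t\<^sup>2 * poly (covol d n k v) x"
proof -
  have t: "0 \<le> t" using assms[of 0] by linarith
  define s where "s = sqrt (poly (covol d n k v) x)"
  have s2: "s\<^sup>2 = poly (covol d n k v) x" by (simp add: s_def covol_nonneg)
  have s0: "0 \<le> s" by (simp add: s_def covol_nonneg)
  have sub: "\<bar>det_fun k (\<lambda>i j. d (c j) * poly (hasse (c j) (v i)) x)\<bar> \<le> s" if c: "\<And>j. j < k \<Longrightarrow> c j \<le> n" for c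
  proof -
    have "det_fun k (\<lambda>i j. d (c j) * poly (hasse (c j) (v i)) x)
        = det_fun k (\<lambda>i j. d (restrict c {..<k} j) * poly (hasse (restrict c {..<k} j) (v i)) x)"
      by (rule det_fun_cong) auto
    also have "\<dots>\<^sup>2 \<le> poly (covol d n k v) x"
      unfolding poly_covol using c
      by (intro member_le_sum[where i = "restrict c {..<k}" and f = "\<lambda>c. (det_fun k (\<lambda>i j. d (c j) * poly (hasse (c j) (v i)) x))\<^sup>2"]
        finite_PiE) auto
    finally have "sqrt ((det_fun k (\<lambda>i j. d (c j) * poly (hasse (c j) (v i)) x))\<^sup>2) \<le> s"
      unfolding s_def by (rule real_sqrt_le_mono)
    then show ?thesis by (simp only: real_sqrt_abs)
  qed
  have "(det_fun (Suc k) (\<lambda>i j. d (c j) * poly (hasse (c j) ((v(k := p)) i)) x))\<^sup>2 \<le> (real (Suc k) * (t * s))\<^sup>2"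
    if c: "c \<in> PiE {..<Suc k} (\<lambda>_. {..n})" for c
  proof -
    let ?f = "\<lambda>i j. d (c j) * poly (hasse (c j) ((v(k := p)) i)) x"
    have summand: "\<bar>?f k j * ((-1) ^ (k + j) * det_fun k (\<lambda>i l. ?f i (insert_index j l)))\<bar> \<le> t * s" if j: "j < Suc k" for j
    proof -
      have eq: "det_fun k (\<lambda>i l. ?f i (insert_index j l))
          = det_fun k (\<lambda>i l. d ((c \<circ> insert_index j) l) * poly (hasse ((c \<circ> insert_index j) l) (v i)) x)"
        by (rule det_fun_cong) auto
      have "(c \<circ> insert_index j) l \<le> n" if "l < k" for l
        using c that j by (auto simp: insert_index_def PiE_iff)
      then have "\<bar>det_fun k (\<lambda>i l. ?f i (insert_index j l))\<bar> \<le> s"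
        unfolding eq by (rule sub)
      moreover have "\<bar>?f k j\<bar> \<le> t" using c j assms[of "c j"] by (auto simp: PiE_iff)
      ultimately show ?thesis using t by (simp add: abs_mult power_abs mult_mono)
    qed
    have "\<bar>det_fun (Suc k) ?f\<bar> \<le> (\<Sum>j<Suc k. \<bar>?f k j * ((-1) ^ (k + j) * det_fun k (\<lambda>i l. ?f i (insert_index j l)))\<bar>)"
      unfolding det_fun_laplace_last[of k ?f] by (rule sum_abs)
    also have "\<dots> \<le> (\<Sum>j<Suc k. t * s)" by (intro sum_mono summand) auto
    finally have "\<bar>det_fun (Suc k) ?f\<bar> \<le> real (Suc k) * (t * s)" by simp
    then have "\<bar>det_fun (Suc k) ?f\<bar>\<^sup>2 \<le> (real (Suc k) * (t * s))\<^sup>2" by (intro power_mono) auto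
    then show ?thesis by (simp only: power2_abs)
  qed
  then have "poly (covol d n (Suc k) (v(k := p))) x \<le> (\<Sum>c\<in>PiE {..<Suc k} (\<lambda>_. {..n}). (real (Suc k) * (t * s))\<^sup>2)"
    unfolding poly_covol by (intro sum_mono)
  also have "\<dots> = real (Suc n) ^ Suc k * (real (Suc k) * (t * s))\<^sup>2"
    by (simp add: card_PiE algebra_simps)
  finally show ?thesis by (simp add: power_mult_distrib s2 mult_ac)
qed

lemma covol_ge_wronskian:
  assumes "k \<le> Suc n"
  shows "((\<Prod>j<k. d j) * poly (taylor_minor k v (\<lambda>j. j)) x)\<^sup>2 \<le> poly (covol d n k v) x"
proof -
  let ?c = "restrict (\<lambda>j. j) {..<k}"
  have "(\<Prod>j<k. d j) * poly (taylor_minor k v (\<lambda>j. j)) x = det_fun k (\<lambda>i j. d j * poly (hasse j (v i)) x)"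
    using det_fun_scale[of k "\<lambda>_. 1" d "\<lambda>i j. poly (hasse j (v i)) x"]
    by (simp add: poly_taylor_minor)
  also have "\<dots> = det_fun k (\<lambda>i j. d (?c j) * poly (hasse (?c j) (v i)) x)"
    by (rule det_fun_cong) auto
  also have "\<dots>\<^sup>2 \<le> poly (covol d n k v) x"
    unfolding poly_covol using assms
    by (intro member_le_sum[where i = ?c and f = "\<lambda>c. (det_fun k (\<lambda>i j. d (c j) * poly (hasse (c j) (v i)) x))\<^sup>2"]
        finite_PiE) auto
  finally show ?thesis .
qed

text \<open>
  Two integral bases of \<open>V\<close> differ by a matrix whose determinant is the ratio of the leading
  coefficients of their Wronskians, which are integers. Minimizing this one integer therefore minimizes
  the covolume at all points of expansion and for all weights simultaneously.
\<close>

definition minimal_basis :: "nat \<Rightarrow> real poly set \<Rightarrow> nat \<Rightarrow> real poly" where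
  "minimal_basis n V = (ARG_MIN (\<lambda>v. nat \<lfloor>\<bar>lead_coeff (taylor_minor (rpoly.dim V) v (\<lambda>j. j))\<bar>\<rfloor>) v.
      integral_basis n V (rpoly.dim V) v)"

lemma minimal_basis:
  assumes "integral_basis n V k v"
  shows "integral_basis n V k (minimal_basis n V)"
    and "poly (covol d n k (minimal_basis n V)) x \<le> poly (covol d n k v) x"
proof -
  have k: "rpoly.dim V = k" using assms by (rule integral_basis_dim)
  define b where "b = minimal_basis n V"
  let ?W = "\<lambda>v. taylor_minor k v (\<lambda>j. j)"
  have "is_arg_min (\<lambda>v. nat \<lfloor>\<bar>lead_coeff (?W v)\<bar>\<rfloor>) (integral_basis n V k) b"
    unfolding b_def minimal_basis_def k using assms by (intro is_arg_min_arg_min_nat)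
  then have b: "integral_basis n V k b" and min: "nat \<lfloor>\<bar>lead_coeff (?W b)\<bar>\<rfloor> \<le> nat \<lfloor>\<bar>lead_coeff (?W v)\<bar>\<rfloor>"
    using assms by (auto simp: is_arg_min_linorder)
  show "integral_basis n V k (minimal_basis n V)" using b by (simp add: b_def)
  have ints: "\<bar>lead_coeff (?W w)\<bar> = real (nat \<lfloor>\<bar>lead_coeff (?W w)\<bar>\<rfloor>)" if "integral_basis n V k w" for w
  proof -
    have "?W w \<in> int_polys (k * n)" using that by (intro taylor_minor_int_polys) (auto simp: integral_basis_def)
    then have "lead_coeff (?W w) \<in> \<int>" by (auto simp: int_polys_def)
    then have "\<bar>lead_coeff (?W w)\<bar> \<in> \<int>" by (rule Ints_abs)
    then show ?thesis by (auto elim!: Ints_cases)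
  qed
  have le: "\<bar>lead_coeff (?W b)\<bar> \<le> \<bar>lead_coeff (?W v)\<bar>"
    using min ints[OF b] ints[OF assms] by (metis of_nat_mono)
  have "\<exists>u. v i = (\<Sum>l<k. smult (u l) (b l))" if "i < k" for i
  proof -
    have "v i \<in> V" using assms that by (auto simp: integral_basis_def intro: rpoly.span_base)
    also have "V = {(\<Sum>l<k. smult (u l) (b l)) | u. True}"
      using b by (simp add: integral_basis_def span_tuple)
    finally show ?thesis by blast
  qed
  then obtain C where C: "\<And>i. i < k \<Longrightarrow> v i = (\<Sum>l<k. smult (C i l) (b l))" by metis
  have "?W b \<noteq> 0" using b by (intro indep_wronskian) (auto simp: integral_basis_def)
  moreover have "?W v = smult (det_fun k C) (?W b)" by (rule taylor_minor_combination) (rule C)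
  then have "\<bar>lead_coeff (?W v)\<bar> = \<bar>det_fun k C\<bar> * \<bar>lead_coeff (?W b)\<bar>"
    by (simp only: lead_coeff_smult abs_mult)
  ultimately have "1 \<le> \<bar>det_fun k C\<bar>" using le
    by (metis leading_coeff_0_iff mult_le_cancel_right1 zero_less_abs_iff not_less)
  then have "1 \<le> (det_fun k C)\<^sup>2" by (metis one_le_power power2_abs)
  then have "1 * poly (covol d n k b) x \<le> (det_fun k C)\<^sup>2 * poly (covol d n k b) x"
    by (intro mult_right_mono covol_nonneg)
  also have "\<dots> = poly (covol d n k v) x"
    by (subst covol_combination[of k v C b]) (auto simp: C)
  finally show "poly (covol d n k (minimal_basis n V)) x \<le> poly (covol d n k v) x" by (simp add: b_def)
qed

text \<open>
  A substitute for the squared covolume of the lattice of all integer points of \<open>V\<close>.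
\<close>

definition subspace_covol :: "(nat \<Rightarrow> real) \<Rightarrow> nat \<Rightarrow> real poly set \<Rightarrow> real poly" where
  "subspace_covol d n V = covol d n (rpoly.dim V) (minimal_basis n V)"

lemma subspace_covol_le: "integral_basis n V k v \<Longrightarrow> poly (subspace_covol d n V) x \<le> poly (covol d n k v) x"
  using minimal_basis(2)[of n V k v d x] integral_basis_dim[of n V k v] by (simp add: subspace_covol_def)

section \<open>Short vectors are rare\<close>

text \<open>
  Let \<open>\<Gamma>\<close> be the largest member of the flag that does not contain \<open>p\<close>, or zero. The span \<open>\<Delta>\<close> of \<open>\<Gamma>\<close>
  and \<open>p\<close> is comparable with the whole flag, so its covolume is at least \<open>\<epsilon>\<close>; on the other hand it is at most
  a constant times the product of the covolume of \<open>\<Gamma>\<close>, which is at most \<open>1\<close>, and the squared size of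
  \<open>p\<close>. Only spans of subsets of \<open>T\<close> occur, which keeps the family of subspaces finite.
\<close>

lemma marked_no_short_vector:
  assumes T: "finite T" "T \<subseteq> int_polys n"
    and S: "S = rpoly.span ` Pow T - {{0}}"
    and mk: "marked (subspace_covol d n) \<epsilon> 1 S x" and \<epsilon>: "\<epsilon> \<le> 1"
    and p: "p \<in> T" "p \<noteq> 0" and t: "\<And>j. j \<le> n \<Longrightarrow> \<bar>d j * poly (hasse j p) x\<bar> \<le> t"
  shows "\<epsilon> \<le> real (Suc n) ^ (n + 3) * t\<^sup>2"
proof -
  obtain F where F: "F \<subseteq> S" "\<forall>V\<in>F. \<forall>W\<in>F. V \<subseteq> W \<or> W \<subseteq> V"
    "\<forall>V\<in>F. \<epsilon> * 1 \<le> poly (subspace_covol d n V) x \<and> poly (subspace_covol d n V) x \<le> 1"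
    "\<forall>V\<in>S - F. (\<forall>W\<in>F. V \<subseteq> W \<or> W \<subseteq> V) \<longrightarrow> 1 \<le> poly (subspace_covol d n V) x"
    using mk unfolding marked_def by (elim exE conjE) (rule that)
  have sp: "\<exists>A\<subseteq>T. V = rpoly.span A" if "V \<in> F" for V using that F(1) S by auto
  have fF: "finite F" using F(1) S T(1) by (meson finite_Diff finite_imageI finite_Pow_iff finite_subset)
  define F0 where "F0 = {V \<in> F. p \<notin> V}"
  have "\<exists>\<Gamma> A. A \<subseteq> T \<and> \<Gamma> = rpoly.span A \<and> p \<notin> \<Gamma> \<and> (\<forall>V\<in>F0. V \<subseteq> \<Gamma>) \<and> (\<Gamma> = {0} \<or> \<Gamma> \<in> F)"
  proof (cases "F0 = {}")
    case True
    then show ?thesis using p by (intro exI[of _ "{0}"] exI[of _ "{}"]) auto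
  next
    case False
    have "finite F0" using fF by (simp add: F0_def)
    from finite_has_maximal[OF this False]
    obtain \<Gamma> where \<Gamma>: "\<Gamma> \<in> F0" "\<forall>V\<in>F0. \<Gamma> \<subseteq> V \<longrightarrow> \<Gamma> = V" by (elim bexE) (rule that)
    have "V \<subseteq> \<Gamma>" if "V \<in> F0" for V
      using \<Gamma>(1) bspec[OF \<Gamma>(2) that] F(2) that unfolding F0_def by blast
    moreover have "\<Gamma> \<in> F" "p \<notin> \<Gamma>" using \<Gamma>(1) by (auto simp: F0_def)
    moreover obtain A where "A \<subseteq> T" "\<Gamma> = rpoly.span A" using sp[OF \<open>\<Gamma> \<in> F\<close>] by blast
    ultimately show ?thesis by (intro exI[of _ \<Gamma>] exI[of _ A]) blast
  qed
  then obtain \<Gamma> A where \<Gamma>: "A \<subseteq> T" "\<Gamma> = rpoly.span A" "p \<notin> \<Gamma>" "\<And>V. V \<in> F0 \<Longrightarrow> V \<subseteq> \<Gamma>" "\<Gamma> = {0} \<or> \<Gamma> \<in> F"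
    by (elim exE conjE) (rule that, blast+)
  define k where "k = rpoly.dim \<Gamma>"
  have "finite A" "A \<subseteq> int_polys n" using \<Gamma>(1) T by (auto intro: finite_subset)
  then obtain v where "integral_basis n \<Gamma> k v"
    using integral_basis_exists[of A n] unfolding k_def \<Gamma>(2) by blast
  then have v: "integral_basis n \<Gamma> k (minimal_basis n \<Gamma>)" by (rule minimal_basis)
  define \<Delta> where "\<Delta> = rpoly.span (insert p \<Gamma>)"
  have pI: "p \<in> int_polys n" using p T by auto
  have \<Delta>b: "integral_basis n \<Delta> (Suc k) ((minimal_basis n \<Gamma>)(k := p))"
    unfolding \<Delta>_def by (rule integral_basis_extend[OF v pI \<Gamma>(3)])
  have \<Gamma>1: "poly (covol d n k (minimal_basis n \<Gamma>)) x \<le> 1"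
    using \<Gamma>(5)
  proof
    assume "\<Gamma> = {0}"
    then have "k = 0" by (metis k_def rpoly.dim_span rpoly.span_empty rpoly.dim_eq_card_independent rpoly.independent_empty card.empty)
    then show ?thesis by (simp add: covol_0)
  next
    assume "\<Gamma> \<in> F"
    then show ?thesis using F(3) by (auto simp: subspace_covol_def k_def)
  qed
  have \<Delta>sp: "\<Delta> = rpoly.span (insert p A)"
  proof
    show "\<Delta> \<subseteq> rpoly.span (insert p A)" unfolding \<Delta>_def \<Gamma>(2)
      using rpoly.span_mono[of A "insert p A"] rpoly.span_base[of p "insert p A"]
      by (intro rpoly.span_minimal rpoly.subspace_span) auto
    show "rpoly.span (insert p A) \<subseteq> \<Delta>"
      unfolding \<Delta>_def \<Gamma>(2) by (intro rpoly.span_mono insert_mono) (auto intro: rpoly.span_base)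
  qed
  have "p \<in> \<Delta>" unfolding \<Delta>_def by (auto intro: rpoly.span_base)
  then have "\<Delta> \<noteq> {0}" using p(2) by auto
  then have \<Delta>S: "\<Delta> \<in> S" using \<Delta>sp \<Gamma>(1) p(1) S by auto
  have "\<epsilon> \<le> poly (subspace_covol d n \<Delta>) x"
  proof (cases "\<Delta> \<in> F")
    case True
    then show ?thesis using F(3) by auto
  next
    case False
    have "\<Delta> \<subseteq> W \<or> W \<subseteq> \<Delta>" if W: "W \<in> F" for W
    proof (cases "p \<in> W")
      case True
      obtain A' where A': "W = rpoly.span A'" using sp[OF W] by auto
      have "\<Gamma> \<subseteq> W"
        using \<Gamma>(5)
      proof
        assume "\<Gamma> = {0}" then show ?thesis using A' rpoly.span_zero by auto
      next
        assume "\<Gamma> \<in> F" then show ?thesis using F(2) W True \<Gamma>(3) by blast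
      qed
      then have "\<Delta> \<subseteq> W" unfolding \<Delta>_def using True A'
        by (intro rpoly.span_minimal) (auto simp: rpoly.subspace_span)
      then show ?thesis by simp
    next
      case False
      then have "W \<subseteq> \<Gamma>" using W by (intro \<Gamma>(4)) (auto simp: F0_def)
      also have "\<Gamma> \<subseteq> \<Delta>" unfolding \<Delta>_def by (auto intro: rpoly.span_base)
      finally show ?thesis by simp
    qed
    then have "1 \<le> poly (subspace_covol d n \<Delta>) x" using F(4) \<Delta>S False by blast
    then show ?thesis using \<epsilon> by simp
  qed
  also have "\<dots> \<le> poly (covol d n (Suc k) ((minimal_basis n \<Gamma>)(k := p))) x"
    by (rule subspace_covol_le[OF \<Delta>b])
  also have "\<dots> \<le> (real (Suc k))\<^sup>2 * real (Suc n) ^ Suc k * t\<^sup>2 * poly (covol d n k (minimal_basis n \<Gamma>)) x"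
    by (rule covol_extend) (rule t)
  also have "\<dots> \<le> (real (Suc k))\<^sup>2 * real (Suc n) ^ Suc k * t\<^sup>2 * 1"
    by (intro mult_left_mono \<Gamma>1) auto
  also have "\<dots> \<le> (real (Suc n))\<^sup>2 * real (Suc n) ^ Suc n * t\<^sup>2 * 1"
  proof -
    have "Suc k \<le> Suc n" using integral_basis_le[OF \<Delta>b] .
    moreover have "0 \<le> t" using t[of 0] by linarith
    ultimately show ?thesis by (intro mult_mono power_mono power_increasing) auto
  qed
  also have "\<dots> = real (Suc n) ^ (n + 3) * t\<^sup>2" 
    by (simp add: power_add[symmetric] del: of_nat_Suc power_Suc) (simp add: numeral_3_eq_3)
  finally show ?thesis .
qed

lemma rational_subspace_dim_less:
  assumes "A \<subseteq> int_polys n" "finite A" "B \<subseteq> int_polys n" "finite B"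
    and VW: "V = rpoly.span A" "W = rpoly.span B" "V \<subset> W"
  shows "rpoly.dim V < rpoly.dim W"
proof -
  obtain v where v: "integral_basis n V (rpoly.dim V) v" using integral_basis_exists assms by blast
  obtain w where w: "integral_basis n W (rpoly.dim W) w" using integral_basis_exists assms by blast
  have "\<not> B \<subseteq> V" using VW rpoly.span_minimal[of B V] rpoly.subspace_span by auto
  then obtain p where p: "p \<in> B" "p \<notin> V" by blast
  have "integral_basis n (rpoly.span (insert p V)) (Suc (rpoly.dim V)) (v(rpoly.dim V := p))"
    using p assms by (intro integral_basis_extend[OF v]) auto
  then have i: "inj_on (v(rpoly.dim V := p)) {..<Suc (rpoly.dim V)}"
      "rpoly.independent ((v(rpoly.dim V := p)) ` {..<Suc (rpoly.dim V)})"
      "rpoly.span (insert p V) = rpoly.span ((v(rpoly.dim V := p)) ` {..<Suc (rpoly.dim V)})"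
    by (auto simp: integral_basis_def indep_iff)
  have "rpoly.span (insert p V) \<subseteq> W"
    using p VW rpoly.span_base[of p B] by (intro rpoly.span_minimal) (auto simp: rpoly.subspace_span)
  moreover have "W = rpoly.span (w ` {..<rpoly.dim W})" using w by (simp only: integral_basis_def)
  ultimately have "rpoly.span ((v(rpoly.dim V := p)) ` {..<Suc (rpoly.dim V)}) \<subseteq> rpoly.span (w ` {..<rpoly.dim W})"
    using i(3) by simp
  with rpoly.span_superset
  have "(v(rpoly.dim V := p)) ` {..<Suc (rpoly.dim V)} \<subseteq> rpoly.span (w ` {..<rpoly.dim W})"
    by (rule order_trans)
  then have "card ((v(rpoly.dim V := p)) ` {..<Suc (rpoly.dim V)}) \<le> card (w ` {..<rpoly.dim W})"
    using i(2) by (intro rpoly.independent_span_bound[THEN conjunct2]) auto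
  also have "\<dots> \<le> rpoly.dim W" using card_image_le[of "{..<rpoly.dim W}" w] by simp
  finally show ?thesis using card_image[OF i(1)] by simp
qed

text \<open>
  The Wronskian is one of the minors in the covolume, a nonzero integer polynomial with weight equal
  to the product of the first \<open>k\<close> weights. In dimension \<open>n + 1\<close> this product is only \<open>1\<close>, but then the
  Wronskian is a nonzero integer constant.
\<close>

lemma subspace_covol_large_somewhere:
  assumes v: "integral_basis n V k v" and k: "0 < k" and ab: "a \<le> b"
    and c: "0 < c" "\<And>p. p \<in> int_polys (Suc n * n) \<Longrightarrow> p \<noteq> 0 \<Longrightarrow> \<exists>y\<in>{a..b}. c \<le> \<bar>poly p y\<bar>"
    and d: "(\<Prod>j\<le>n. d j) = 1" "\<And>k. 1 \<le> k \<Longrightarrow> k \<le> n \<Longrightarrow> 1 / c \<le> (\<Prod>j<k. d j)"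
  shows "\<exists>y\<in>{a..b}. 1 \<le> poly (subspace_covol d n V) y"
proof -
  define b' where "b' = minimal_basis n V"
  have b': "integral_basis n V k b'" unfolding b'_def by (rule minimal_basis[OF v])
  have kn: "k \<le> Suc n" by (rule integral_basis_le[OF v])
  let ?W = "taylor_minor k b' (\<lambda>j. j)"
  have Wk: "?W \<in> int_polys (k * n)" using b' by (intro taylor_minor_int_polys) (auto simp: integral_basis_def)
  have "k * n \<le> Suc n * n" using kn by (intro mult_right_mono) auto
  then have W: "?W \<in> int_polys (Suc n * n)" using Wk by (auto simp: int_polys_def)
  have W0: "?W \<noteq> 0" using b' by (intro indep_wronskian) (auto simp: integral_basis_def)
  have "\<exists>y\<in>{a..b}. 1 \<le> \<bar>(\<Prod>j<k. d j) * poly ?W y\<bar>"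
  proof (cases "k \<le> n")
    case True
    from c(2)[OF W W0] obtain y where y: "y \<in> {a..b}" "c \<le> \<bar>poly ?W y\<bar>" by blast
    have P: "1 / c \<le> (\<Prod>j<k. d j)" using d(2) True k by simp
    have "1 = 1 / c * c" using c by simp
    also have "\<dots> \<le> (\<Prod>j<k. d j) * \<bar>poly ?W y\<bar>"
      using P y(2) c(1) by (intro mult_mono) (auto intro: order_trans[OF _ P])
    also have "\<dots> = \<bar>(\<Prod>j<k. d j) * poly ?W y\<bar>"
      using order_trans[OF _ P, of 0] c(1) by (simp add: abs_mult)
    finally show ?thesis using y(1) by blast
  next
    case False
    with kn have kS: "k = Suc n" by simp
    have con: "poly ?W x = poly ?W 0" for x
      using full_wronskian_constant[of n b' x 0] b' unfolding kS
      by (auto simp: integral_basis_def int_polys_def)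
    have "poly ?W 0 \<noteq> 0" using W0 con by (metis poly_all_0_iff_0)
    moreover have "poly ?W 0 \<in> \<int>" using W by (simp add: poly_0_coeff_0 int_polys_def)
    ultimately have "1 \<le> \<bar>poly ?W 0\<bar>" by (metis Ints_nonzero_abs_ge1)
    moreover have "(\<Prod>j<k. d j) = 1" using d(1) by (simp add: kS lessThan_Suc_atMost)
    ultimately show ?thesis using con[of a] ab by (intro bexI[of _ a]) auto
  qed
  then obtain y where y: "y \<in> {a..b}" "1 \<le> \<bar>(\<Prod>j<k. d j) * poly ?W y\<bar>" by blast
  have "1 \<le> \<bar>(\<Prod>j<k. d j) * poly ?W y\<bar>\<^sup>2" using y(2) by (rule one_le_power)
  also have "\<dots> \<le> poly (covol d n k b') y"
    using covol_ge_wronskian[OF kn, of d b' y] by (simp only: power2_abs)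
  also have "\<dots> = poly (subspace_covol d n V) y"
    using integral_basis_dim[OF v] by (simp add: subspace_covol_def b'_def)
  finally show ?thesis using y(1) by blast
qed

text \<open>
  The constant \<open>\<delta>\<close> is uniform in the interval and the weights; only the threshold \<open>M\<close> for the products
  of the first weights depends on the interval.
\<close>

theorem short_vectors_rare:
  "\<exists>\<delta>>0. \<forall>a b. -1 \<le> a \<longrightarrow> a < b \<longrightarrow> b \<le> 1 \<longrightarrow> (\<exists>M>0. \<forall>d. (\<forall>j. 0 < d j) \<longrightarrow> (\<Prod>j\<le>n. d j) = 1 \<longrightarrow>
     (\<forall>k. 1 \<le> k \<longrightarrow> k \<le> n \<longrightarrow> M \<le> (\<Prod>j<k. d j)) \<longrightarrow>
     (\<exists>X\<in>sets lborel. emeasure lborel X \<le> ennreal ((b - a) / 2) \<and>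
       (\<forall>x\<in>{a<..<b} - X. \<forall>p\<in>int_polys n. p \<noteq> 0 \<longrightarrow> (\<exists>j\<le>n. \<delta> \<le> d j * \<bar>poly (hasse j p) x\<bar>))))"
proof -
  define D where "D = 2 * (Suc n * n)"
  \<comment> \<open>Chosen so that the exceptional set given by the flags has measure at most \<open>(b - a) / 2\<close>.\<close>
  define \<tau> where "\<tau> = 1 / (real (Suc n) * 2 ^ Suc n * (2 * real D + 2) * 2)"
  have \<tau>: "0 < \<tau>" by (simp add: \<tau>_def add_pos_pos)
  define \<epsilon> where "\<epsilon> = (\<tau> / (1 + \<tau>)) ^ D"
  have \<epsilon>: "0 < \<epsilon>" "\<epsilon> \<le> 1" using \<tau> by (auto simp: \<epsilon>_def intro!: power_le_one)
  define K where "K = real (Suc n) ^ (n + 3)"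
  have K: "0 < K" by (simp add: K_def)
  \<comment> \<open>A vector of size \<open>\<delta>\<close> violates the bound on the squared size of vectors at marked points.\<close>
  define \<delta> where "\<delta> = sqrt (\<epsilon> / (2 * K))"
  have \<delta>: "0 < \<delta>" using \<epsilon> K by (simp add: \<delta>_def)
  have \<delta>2: "K * \<delta>\<^sup>2 < \<epsilon>" using \<epsilon> K by (simp add: \<delta>_def field_simps)
  have main: "\<exists>X\<in>sets lborel. emeasure lborel X \<le> ennreal ((b - a) / 2) \<and>
       (\<forall>x\<in>{a<..<b} - X. \<forall>p\<in>int_polys n. p \<noteq> 0 \<longrightarrow> (\<exists>j\<le>n. \<delta> \<le> d j * \<bar>poly (hasse j p) x\<bar>))"
    if ab: "-1 \<le> a" "a < b" "b \<le> 1"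
      and c: "0 < c" "\<And>p. p \<in> int_polys (Suc n * n) \<Longrightarrow> p \<noteq> 0 \<Longrightarrow> \<exists>y\<in>{a..b}. c \<le> \<bar>poly p y\<bar>"
      and d: "\<And>j. 0 < d j" "(\<Prod>j\<le>n. d j) = 1" "\<And>k. 1 \<le> k \<Longrightarrow> k \<le> n \<Longrightarrow> 1 / c \<le> (\<Prod>j<k. d j)"
    for a b c d
  proof -
    \<comment> \<open>Bounds the coefficients of every polynomial that is short at some point of the interval.\<close>
    define H where "H = real (n + 1) * 2 ^ n * (\<Sum>j\<le>n. \<delta> / d j)"
    define T where "T = {p \<in> int_polys n. \<forall>i\<le>n. \<bar>coeff p i\<bar> \<le> H}"
    have T: "finite T" "T \<subseteq> int_polys n" by (auto simp: T_def finite_int_polys_bounded)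
    define S where "S = rpoly.span ` Pow T - {{0}}"
    have fS: "finite S" using T by (simp add: S_def)
    have SA: "\<exists>A. A \<subseteq> int_polys n \<and> finite A \<and> V = rpoly.span A" if "V \<in> S" for V
    proof -
      from that obtain A where A: "A \<subseteq> T" "V = rpoly.span A" by (auto simp: S_def)
      with T have "A \<subseteq> int_polys n" "finite A" by (auto intro: finite_subset)
      with A show ?thesis by blast
    qed
    have SB: "\<exists>v. integral_basis n V (rpoly.dim V) v" if V: "V \<in> S" for V
      using SA[OF V] integral_basis_exists by blast
    have pos: "0 < rpoly.dim V" if V: "V \<in> S" for V
    proof (rule ccontr)
      assume "\<not> 0 < rpoly.dim V"
      then obtain v where "integral_basis n V 0 v" using SB[OF V] by auto
      then have "V = {0}" by (simp add: integral_basis_def)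
      with V show False by (simp add: S_def)
    qed
    have "rpoly.dim ` S \<subseteq> {1..Suc n}" using SB integral_basis_le pos by fastforce
    then have cardS: "card (rpoly.dim ` S) \<le> Suc n" using card_mono[of "{1..Suc n}"] by fastforce
    have deg: "degree (subspace_covol d n V) \<le> D" if V: "V \<in> S" for V
    proof -
      obtain v where v: "integral_basis n V (rpoly.dim V) v" using SB[OF V] by blast
      then have b: "integral_basis n V (rpoly.dim V) (minimal_basis n V)" by (rule minimal_basis)
      have "degree (subspace_covol d n V) \<le> 2 * (rpoly.dim V * n)"
        unfolding subspace_covol_def using b by (intro degree_covol) (auto simp: integral_basis_def)
      also have "\<dots> \<le> D"
        unfolding D_def using integral_basis_le[OF v] by (intro mult_left_mono mult_right_mono) auto
      finally show ?thesis .
    qed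
    have big: "\<exists>y\<in>{a..b}. 1 \<le> poly (subspace_covol d n V) y" if V: "V \<in> S" for V
    proof -
      obtain v where v: "integral_basis n V (rpoly.dim V) v" using SB[OF V] by blast
      show ?thesis
        by (rule subspace_covol_large_somewhere[OF v pos[OF V] less_imp_le[OF ab(2)] c d(2,3)])
    qed
    have mono: "rpoly.dim V < rpoly.dim W" if "V \<in> S" "W \<in> S" "V \<subset> W" for V W
      using SA[OF that(1)] SA[OF that(2)] that(3) rational_subspace_dim_less by metis
    have nn: "0 \<le> poly (subspace_covol d n V) x" for V x
      by (simp add: subspace_covol_def covol_nonneg)
    have "\<exists>X\<in>sets lborel. emeasure lborel X \<le> ennreal (real (Suc n) * 2 ^ Suc n * (2 * real D * \<tau>) * (b - a)) \<and>
      (\<forall>x\<in>{a<..<b} - X. marked (subspace_covol d n) \<epsilon> 1 S x)"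
      unfolding \<epsilon>_def
      by (rule most_points_marked[where rk = rpoly.dim, OF fS mono cardS ab(2) deg big nn _ \<tau>]) auto
    then obtain X where X: "X \<in> sets lborel"
      "emeasure lborel X \<le> ennreal (real (Suc n) * 2 ^ Suc n * (2 * real D * \<tau>) * (b - a))"
      "\<forall>x\<in>{a<..<b} - X. marked (subspace_covol d n) \<epsilon> 1 S x"
      by blast
    have "real (Suc n) * 2 ^ Suc n * (2 * real D * \<tau>) \<le> 1 / 2"
    proof -
      have "real (Suc n) * 2 ^ Suc n * (2 * real D * \<tau>) \<le> real (Suc n) * 2 ^ Suc n * ((2 * real D + 2) * \<tau>)"
        using \<tau> by (intro mult_left_mono mult_right_mono) auto
      also have "\<dots> = 1 / 2"
      proof -
        define A where "A = real (Suc n) * 2 ^ Suc n"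
        define B where "B = 2 * real D + 2"
        have "0 < A" "0 < B" by (auto simp: A_def B_def add_pos_pos)
        then have "A * (B * (1 / (A * B * 2))) = 1 / 2" by (simp add: field_simps)
        then show ?thesis unfolding \<tau>_def A_def B_def .
      qed
      finally show ?thesis .
    qed
    then have "real (Suc n) * 2 ^ Suc n * (2 * real D * \<tau>) * (b - a) \<le> 1 / 2 * (b - a)"
      using ab by (intro mult_right_mono) auto
    then have "ennreal (real (Suc n) * 2 ^ Suc n * (2 * real D * \<tau>) * (b - a)) \<le> ennreal ((b - a) / 2)"
      by (intro ennreal_leI) simp
    with X(2) have em: "emeasure lborel X \<le> ennreal ((b - a) / 2)" by (rule order_trans)
    have "\<exists>j\<le>n. \<delta> \<le> d j * \<bar>poly (hasse j p) x\<bar>"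
      if x: "x \<in> {a<..<b} - X" and p: "p \<in> int_polys n" "p \<noteq> 0" for x p
    proof (rule ccontr)
      assume "\<not> ?thesis"
      then have small: "d j * \<bar>poly (hasse j p) x\<bar> < \<delta>" if "j \<le> n" for j using that by force
      have s1: "\<bar>poly (hasse j p) x\<bar> \<le> (\<Sum>j\<le>n. \<delta> / d j)" if j: "j \<le> n" for j
      proof -
        have "\<bar>poly (hasse j p) x\<bar> \<le> \<delta> / d j"
          using small[OF j] d(1)[of j] by (simp add: field_simps)
        also have "\<dots> \<le> (\<Sum>j\<le>n. \<delta> / d j)"
          using j \<delta> d(1) by (intro member_le_sum) (auto simp: less_imp_le)
        finally show ?thesis .
      qed
      have "\<bar>coeff p i\<bar> \<le> H" for i
        unfolding H_def by (rule coeff_bound[where x = x]) (use p s1 x ab in \<open>auto simp: int_polys_def\<close>)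
      then have pT: "p \<in> T" using p by (simp add: T_def)
      have sm: "\<bar>d j * poly (hasse j p) x\<bar> \<le> \<delta>" if "j \<le> n" for j
        using small[OF that] d(1)[of j] by (simp add: abs_mult)
      have "\<epsilon> \<le> K * \<delta>\<^sup>2" unfolding K_def
        by (rule marked_no_short_vector[OF T S_def bspec[OF X(3) x] \<epsilon>(2) pT p(2) sm])
      with \<delta>2 show False by simp
    qed
    with X(1) em show ?thesis by blast
  qed
  show ?thesis
  proof (rule exI[of _ \<delta>], intro conjI allI impI \<delta>)
    fix a b :: real assume ab: "-1 \<le> a" "a < b" "b \<le> 1"
    obtain c where c: "0 < c" "\<And>p. p \<in> int_polys (Suc n * n) \<Longrightarrow> p \<noteq> 0 \<Longrightarrow> \<exists>y\<in>{a..b}. c \<le> \<bar>poly p y\<bar>"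
      using int_poly_large_somewhere[OF ab(2), of "Suc n * n"] by metis
    show "\<exists>M>0. \<forall>d. (\<forall>j. 0 < d j) \<longrightarrow> (\<Prod>j\<le>n. d j) = 1 \<longrightarrow>
     (\<forall>k. 1 \<le> k \<longrightarrow> k \<le> n \<longrightarrow> M \<le> (\<Prod>j<k. d j)) \<longrightarrow>
     (\<exists>X\<in>sets lborel. emeasure lborel X \<le> ennreal ((b - a) / 2) \<and>
       (\<forall>x\<in>{a<..<b} - X. \<forall>p\<in>int_polys n. p \<noteq> 0 \<longrightarrow> (\<exists>j\<le>n. \<delta> \<le> d j * \<bar>poly (hasse j p) x\<bar>)))"
    proof (rule exI[of _ "1 / c"], intro conjI allI impI)
      show "0 < 1 / c" using c(1) by simp
    next
      fix d :: "nat \<Rightarrow> real" assume d: "\<forall>j. 0 < d j" "(\<Prod>j\<le>n. d j) = 1"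
        "\<forall>k. 1 \<le> k \<longrightarrow> k \<le> n \<longrightarrow> 1 / c \<le> (\<Prod>j<k. d j)"
      show "\<exists>X\<in>sets lborel. emeasure lborel X \<le> ennreal ((b - a) / 2) \<and>
       (\<forall>x\<in>{a<..<b} - X. \<forall>p\<in>int_polys n. p \<noteq> 0 \<longrightarrow> (\<exists>j\<le>n. \<delta> \<le> d j * \<bar>poly (hasse j p) x\<bar>))"
        by (rule main[OF ab c]) (use d in auto)
    qed
  qed
qed

section \<open>Covering radius\<close>

lemma card_floor_range:
  assumes "0 \<le> a"
  shows "real (card {\<lfloor>- a\<rfloor>..\<lfloor>a :: real\<rfloor>}) \<le> 2 * a + 2"
proof -
  have "\<lfloor>- a\<rfloor> \<le> \<lfloor>a\<rfloor> + 1" using assms by linarith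
  then have "real (card {\<lfloor>- a\<rfloor>..\<lfloor>a\<rfloor>}) = real_of_int (\<lfloor>a\<rfloor> - \<lfloor>- a\<rfloor> + 1)" by simp
  also have "\<dots> \<le> 2 * a + 2" by linarith
  finally show ?thesis .
qed

lemma pigeonhole_fibre:
  fixes g :: "'a \<Rightarrow> 'b"
  assumes "finite Y" "g ` A \<subseteq> Y" "finite A" "A \<noteq> {}"
  shows "\<exists>y\<in>g ` A. real (card A) \<le> real (card Y) * real (card {p \<in> A. g p = y})"
proof (rule ccontr)
  assume neg: "\<not> ?thesis"
  have fim: "finite (g ` A)" using assms by simp
  have eqA: "(\<Union>y\<in>g ` A. {p \<in> A. g p = y}) = A" by auto
  have "card A \<le> (\<Sum>y\<in>g ` A. card {p \<in> A. g p = y})"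
    using card_UN_le[OF fim, of "\<lambda>y. {p \<in> A. g p = y}"] unfolding eqA .
  then have "real (card A) \<le> real (\<Sum>y\<in>g ` A. card {p \<in> A. g p = y})" by (rule of_nat_mono)
  then have "real (card A) \<le> (\<Sum>y\<in>g ` A. real (card {p \<in> A. g p = y}))" by simp
  then have "real (card Y) * real (card A) \<le> real (card Y) * (\<Sum>y\<in>g ` A. real (card {p \<in> A. g p = y}))"
    by (intro mult_left_mono) auto
  also have "\<dots> = (\<Sum>y\<in>g ` A. real (card Y) * real (card {p \<in> A. g p = y}))" by (rule sum_distrib_left)
  also have "\<dots> < (\<Sum>y\<in>g ` A. real (card A))"
    using neg fim assms(4) by (intro sum_strict_mono) auto
  also have "\<dots> = real (card (g ` A)) * real (card A)" by simp
  also have "\<dots> \<le> real (card Y) * real (card A)"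
    using assms by (intro mult_right_mono) (auto intro: card_mono)
  finally show False by simp
qed

definition short_vectors :: "nat \<Rightarrow> (nat \<Rightarrow> real) \<Rightarrow> real \<Rightarrow> real \<Rightarrow> real poly set" where
  "short_vectors n d x r = {p \<in> int_polys n. \<forall>j\<le>n. d j * \<bar>poly (hasse j p) x\<bar> \<le> r}"

lemma finite_short_vectors:
  assumes "\<And>j. 0 < d j" "\<bar>x\<bar> \<le> 1" "0 \<le> r"
  shows "finite (short_vectors n d x r)"
proof (rule finite_subset[OF _ finite_int_polys_bounded])
  let ?M = "\<Sum>j\<le>n. r / d j"
  show "short_vectors n d x r \<subseteq> {p \<in> int_polys n. \<forall>i\<le>n. \<bar>coeff p i\<bar> \<le> real (n + 1) * 2 ^ n * ?M}"
  proof safe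
    fix p i assume p: "p \<in> short_vectors n d x r"
    then show "p \<in> int_polys n" by (simp add: short_vectors_def)
    then show "\<bar>coeff p i\<bar> \<le> real (n + 1) * 2 ^ n * ?M"
    proof (intro coeff_bound[where x = x])
      fix j assume j: "j \<le> n"
      then have "\<bar>poly (hasse j p) x\<bar> \<le> r / d j"
        using p assms(1)[of j] by (simp add: short_vectors_def field_simps)
      also have "\<dots> \<le> ?M"
        using j assms by (intro member_le_sum) (auto simp: less_imp_le)
      finally show "\<bar>poly (hasse j p) x\<bar> \<le> ?M" .
    qed (use assms in \<open>auto simp: int_polys_def\<close>)
  qed
qed

text \<open>
  Minkowski's theorem on linear forms, by the pigeonhole principle: the polynomials with coefficients
  in \<open>{0..H}\<close> are distributed to boxes of side \<open>r\<close>, and the differences within the fullest box are short. As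
  the weights have product \<open>1\<close>, the number \<open>H\<close> cancels from the estimate once it is large.
\<close>

lemma many_short_vectors:
  assumes d: "\<And>j. 0 < d j" "(\<Prod>j\<le>n. d j) = 1" and x: "\<bar>x\<bar> \<le> 1" and r: "0 < r"
  shows "(r / (4 * (real (n + 1) * 2 ^ n))) ^ (n + 1) \<le> real (card (short_vectors n d x r))"
proof -
  define C where "C = real (n + 1) * 2 ^ n"
  have C: "0 < C" by (simp add: C_def)
  obtain H :: nat where H: "max 1 (\<Sum>j\<le>n. r / (C * d j)) \<le> real H" using real_arch_simple by blast
  have H1: "1 \<le> real H" using H by simp
  \<comment> \<open>In units of \<open>r\<close>, the weighted \<open>j\<close>-th coordinate of a polynomial with coefficients up to \<open>H\<close> is at most \<open>a j\<close>.\<close>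
  define a where "a = (\<lambda>j. d j * (C * real H) / r)"
  have a1: "1 \<le> a j" if "j \<le> n" for j
  proof -
    have "r / (C * d j) \<le> (\<Sum>j\<le>n. r / (C * d j))"
      using that r C d by (intro member_le_sum) (auto simp: less_imp_le)
    also have "\<dots> \<le> real H" using H by simp
    finally show ?thesis using C r d(1)[of j] by (simp add: a_def field_simps)
  qed
  define A where "A = (\<lambda>f. \<Sum>i\<le>n. monom (real (f i)) i) ` (PiE {..n} (\<lambda>_. {..H}))"
  have cf: "coeff (\<Sum>i\<le>n. monom (real (f i)) i) j = (if j \<le> n then real (f j) else 0)" for f j
    by (simp add: coeff_sum sum.delta)
  have A: "p \<in> int_polys n \<and> (\<forall>i\<le>n. 0 \<le> coeff p i \<and> coeff p i \<le> real H)" if p: "p \<in> A" for p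
  proof -
    from p obtain f where f: "f \<in> PiE {..n} (\<lambda>_. {..H})" "p = (\<Sum>i\<le>n. monom (real (f i)) i)"
      by (auto simp: A_def)
    have "degree p \<le> n" by (rule degree_le) (simp add: f(2) cf)
    then show ?thesis using f by (auto simp: int_polys_def cf PiE_iff)
  qed
  have fA: "finite A" unfolding A_def by (intro finite_imageI finite_PiE) auto
  have "inj_on (\<lambda>f. \<Sum>i\<le>n. monom (real (f i)) i) (PiE {..n} (\<lambda>_. {..H}))"
  proof (rule inj_onI)
    fix f g assume fg: "f \<in> PiE {..n} (\<lambda>_. {..H})" "g \<in> PiE {..n} (\<lambda>_. {..H})"
      "(\<Sum>i\<le>n. monom (real (f i)) i) = (\<Sum>i\<le>n. monom (real (g i)) i)"
    show "f = g"
    proof (rule PiE_ext[OF fg(1,2)])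
      fix i assume "i \<in> {..n}"
      then show "f i = g i" using cf[of f i] cf[of g i] fg(3) by simp
    qed
  qed
  then have "card A = card (PiE {..n} (\<lambda>_. {..H}))" unfolding A_def by (rule card_image)
  also have "\<dots> = Suc H ^ (n + 1)" by (subst card_PiE) auto
  finally have cA: "real H ^ (n + 1) \<le> real (card A)"
    by (simp add: power_mono del: power_Suc)
  then have "1 \<le> real (card A)" using one_le_power[OF H1, of "n + 1"] by linarith
  then have A0: "A \<noteq> {}" by auto
  define g where "g = (\<lambda>p. restrict (\<lambda>j. \<lfloor>d j * poly (hasse j p) x / r\<rfloor>) {..n})"
  define Y where "Y = PiE {..n} (\<lambda>j. {\<lfloor>- a j\<rfloor>..\<lfloor>a j\<rfloor>})"
  have fY: "finite Y" unfolding Y_def by (intro finite_PiE) auto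
  have "g ` A \<subseteq> Y"
  proof safe
    fix p assume p: "p \<in> A"
    have bnd: "\<bar>d j * poly (hasse j p) x / r\<bar> \<le> a j" if "j \<le> n" for j
    proof -
      have "\<bar>poly (hasse j p) x\<bar> \<le> C * real H"
        unfolding C_def using A[OF p] x by (intro hasse_bound) (auto simp: int_polys_def)
      then have "d j * \<bar>poly (hasse j p) x\<bar> / r \<le> d j * (C * real H) / r"
        using d(1)[of j] r by (intro divide_right_mono mult_left_mono) auto
      then show ?thesis using d(1)[of j] r by (simp add: a_def abs_mult)
    qed
    then have "- a j \<le> d j * poly (hasse j p) x / r \<and> d j * poly (hasse j p) x / r \<le> a j" if "j \<le> n" for j
      using bnd[OF that] by linarith
    then show "g p \<in> Y" unfolding g_def Y_def by (auto intro!: floor_mono)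
  qed
  from pigeonhole_fibre[OF fY this fA A0] obtain y where y: "y \<in> g ` A"
    "real (card A) \<le> real (card Y) * real (card {p \<in> A. g p = y})" by blast
  then obtain p0 where p0: "p0 \<in> A" "g p0 = y" by auto
  have "real (card Y) = (\<Prod>j\<le>n. real (card {\<lfloor>- a j\<rfloor>..\<lfloor>a j\<rfloor>}))"
    unfolding Y_def by (subst card_PiE) auto
  also have "\<dots> \<le> (\<Prod>j\<le>n. 4 * a j)"
  proof (rule prod_mono)
    fix j assume "j \<in> {..n}"
    then have "1 \<le> a j" using a1 by simp
    then have "real (card {\<lfloor>- a j\<rfloor>..\<lfloor>a j\<rfloor>}) \<le> 2 * a j + 2" by (intro card_floor_range) simp
    with \<open>1 \<le> a j\<close> show "0 \<le> real (card {\<lfloor>- a j\<rfloor>..\<lfloor>a j\<rfloor>}) \<and> real (card {\<lfloor>- a j\<rfloor>..\<lfloor>a j\<rfloor>}) \<le> 4 * a j" by simp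
  qed
  also have "\<dots> = (\<Prod>j\<le>n. d j * (4 * C * real H / r))"
    by (rule prod.cong) (auto simp: a_def)
  also have "\<dots> = (4 * C * real H / r) ^ (n + 1)"
    by (simp only: prod.distrib d(2) prod_constant card_atMost mult_1 Suc_eq_plus1)
  finally have cY: "real (card Y) \<le> (4 * C * real H / r) ^ (n + 1)" .
  have "real H ^ (n + 1) \<le> (4 * C * real H / r) ^ (n + 1) * real (card {p \<in> A. g p = y})"
    using cA y(2) mult_right_mono[OF cY, of "real (card {p \<in> A. g p = y})"] by linarith
  also have "(4 * C * real H / r) ^ (n + 1) = real H ^ (n + 1) * (4 * C / r) ^ (n + 1)"
    by (simp only: power_mult_distrib[symmetric]) (simp add: mult_ac)
  finally have "1 \<le> (4 * C / r) ^ (n + 1) * real (card {p \<in> A. g p = y})"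
    using H1 by (simp add: mult.assoc del: power_Suc)
  then have "(r / (4 * C)) ^ (n + 1) * 1 \<le> (r / (4 * C)) ^ (n + 1) * ((4 * C / r) ^ (n + 1) * real (card {p \<in> A. g p = y}))"
    using r C by (intro mult_left_mono) auto
  also have "\<dots> = (r / (4 * C) * (4 * C / r)) ^ (n + 1) * real (card {p \<in> A. g p = y})"
    by (simp only: power_mult_distrib mult.assoc)
  also have "r / (4 * C) * (4 * C / r) = 1" using r C by simp
  finally have low: "(r / (4 * C)) ^ (n + 1) \<le> real (card {p \<in> A. g p = y})" by simp
  have "(\<lambda>p. p - p0) ` {p \<in> A. g p = y} \<subseteq> short_vectors n d x r"
  proof safe
    fix p assume p: "p \<in> A" "y = g p"
    have "d j * \<bar>poly (hasse j (p - p0)) x\<bar> \<le> r" if j: "j \<le> n" for j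
    proof -
      have "g p j = g p0 j" using p p0 by simp
      then have "\<lfloor>d j * poly (hasse j p) x / r\<rfloor> = \<lfloor>d j * poly (hasse j p0) x / r\<rfloor>"
        using j by (simp add: g_def)
      then have "\<bar>d j * poly (hasse j p) x / r - d j * poly (hasse j p0) x / r\<bar> \<le> 1" by linarith
      also have "d j * poly (hasse j p) x / r - d j * poly (hasse j p0) x / r = d j * poly (hasse j (p - p0)) x / r"
        by (simp add: hasse_diff right_diff_distrib diff_divide_distrib)
      finally show ?thesis using d(1)[of j] r by (simp add: abs_mult field_simps)
    qed
    then show "p - p0 \<in> short_vectors n d x r"
      using A[OF p(1)] A[OF p0(1)] by (simp add: short_vectors_def int_polys_diff)
  qed
  then have "card ((\<lambda>p. p - p0) ` {p \<in> A. g p = y}) \<le> card (short_vectors n d x r)"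
    using r by (intro card_mono finite_short_vectors d x) auto
  moreover have "card ((\<lambda>p. p - p0) ` {p \<in> A. g p = y}) = card {p \<in> A. g p = y}"
    by (rule card_image) (auto simp: inj_on_def)
  ultimately have "real (card {p \<in> A. g p = y}) \<le> real (card (short_vectors n d x r))" by simp
  with low show ?thesis unfolding C_def by linarith
qed

text \<open>
  On a hyperplane, the coordinate with the largest coefficient in the equation is at most the sum of the
  others. So short vectors are separated already by their other \<open>n\<close> coordinates, in cells of side
  \<open>\<delta> / (n + 1)\<close>.
\<close>

lemma few_short_vectors_on_hyperplane:
  assumes d: "\<And>j. 0 < d j" and x: "\<bar>x\<bar> \<le> 1" and r: "1 \<le> r" and \<delta>: "0 < \<delta>"
    and sep: "\<And>p. p \<in> int_polys n \<Longrightarrow> p \<noteq> 0 \<Longrightarrow> \<exists>j\<le>n. \<delta> \<le> d j * \<bar>poly (hasse j p) x\<bar>"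
    and a: "j1 \<le> n" "a j1 \<noteq> 0"
      "\<And>p. p \<in> short_vectors n d x r \<Longrightarrow> (\<Sum>j\<le>n. a j * poly (hasse j p) x) = 0"
  shows "real (card (short_vectors n d x r)) \<le> (r * (2 * (real (n + 1) / \<delta>) + 2)) ^ n"
proof -
  define L where "L = short_vectors n d x r"
  have LI: "p \<in> int_polys n" if "p \<in> L" for p using that by (simp add: L_def short_vectors_def)
  have fin: "finite {..n}" "{..n} \<noteq> {}" by auto
  \<comment> \<open>The dominant coefficient of the equation in weighted coordinates.\<close>
  from ex_is_arg_min_if_finite[OF fin, of "\<lambda>j. - (\<bar>a j\<bar> / d j)"]
  obtain j0 where j0: "j0 \<le> n" "\<And>j. j \<le> n \<Longrightarrow> \<bar>a j\<bar> / d j \<le> \<bar>a j0\<bar> / d j0"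
    unfolding is_arg_min_linorder neg_le_iff_le by (metis atMost_iff)
  have "0 < \<bar>a j1\<bar> / d j1" using a(2) d by simp
  also have "\<dots> \<le> \<bar>a j0\<bar> / d j0" by (rule j0(2)[OF a(1)])
  finally have a0: "0 < \<bar>a j0\<bar> / d j0" .
  define \<theta> where "\<theta> = \<delta> / real (n + 1)"
  have \<theta>: "0 < \<theta>" using \<delta> by (simp add: \<theta>_def)
  define h where "h = (\<lambda>p. restrict (\<lambda>j. \<lfloor>d j * poly (hasse j p) x / \<theta>\<rfloor>) ({..n} - {j0}))"
  define Y where "Y = PiE ({..n} - {j0}) (\<lambda>j. {\<lfloor>- (r / \<theta>)\<rfloor>..\<lfloor>r / \<theta>\<rfloor>})"
  have fY: "finite Y" unfolding Y_def by (intro finite_PiE) auto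
  have "h ` L \<subseteq> Y"
  proof safe
    fix p assume p: "p \<in> L"
    have "- (r / \<theta>) \<le> d j * poly (hasse j p) x / \<theta> \<and> d j * poly (hasse j p) x / \<theta> \<le> r / \<theta>" if "j \<le> n" for j
    proof -
      have "\<bar>d j * poly (hasse j p) x\<bar> \<le> r" using p that d[of j] by (simp add: L_def short_vectors_def abs_mult)
      then have "- r \<le> d j * poly (hasse j p) x" "d j * poly (hasse j p) x \<le> r" by linarith+
      then show ?thesis using \<theta> by (simp add: field_simps)
    qed
    then show "h p \<in> Y" unfolding h_def Y_def by (auto intro!: floor_mono)
  qed
  moreover have "inj_on h L"
  proof (rule inj_onI)
    fix p q assume pq: "p \<in> L" "q \<in> L" "h p = h q"
    define w where "w = (\<lambda>j. d j * poly (hasse j (p - q)) x)"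
    have small: "\<bar>w j\<bar> \<le> \<theta>" if j: "j \<in> {..n} - {j0}" for j
    proof -
      have "h p j = h q j" using pq by simp
      then have "\<lfloor>d j * poly (hasse j p) x / \<theta>\<rfloor> = \<lfloor>d j * poly (hasse j q) x / \<theta>\<rfloor>"
        using j by (simp add: h_def)
      then have "\<bar>d j * poly (hasse j p) x / \<theta> - d j * poly (hasse j q) x / \<theta>\<bar> \<le> 1" by linarith
      also have "d j * poly (hasse j p) x / \<theta> - d j * poly (hasse j q) x / \<theta> = w j / \<theta>"
        by (simp add: w_def hasse_diff right_diff_distrib diff_divide_distrib)
      finally show ?thesis using \<theta> by (simp add: field_simps)
    qed
    have "(\<Sum>j\<le>n. a j / d j * w j) = 0"
    proof -
      have "(\<Sum>j\<le>n. a j / d j * w j) = (\<Sum>j\<le>n. a j * poly (hasse j p) x) - (\<Sum>j\<le>n. a j * poly (hasse j q) x)"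
        unfolding sum_subtractf[symmetric]
        by (rule sum.cong) (use d in \<open>auto simp: w_def hasse_diff right_diff_distrib less_imp_neq[symmetric]\<close>)
      then show ?thesis using a(3) pq by (simp add: L_def)
    qed
    then have "a j0 / d j0 * w j0 = - (\<Sum>j\<in>{..n} - {j0}. a j / d j * w j)"
      using j0(1) by (simp add: sum.remove[of _ j0])
    then have "\<bar>a j0 / d j0 * w j0\<bar> = \<bar>\<Sum>j\<in>{..n} - {j0}. a j / d j * w j\<bar>" by simp
    also have "\<dots> \<le> (\<Sum>j\<in>{..n} - {j0}. \<bar>a j / d j * w j\<bar>)" by (rule sum_abs)
    also have "\<dots> \<le> (\<Sum>j\<in>{..n} - {j0}. \<bar>a j0\<bar> / d j0 * \<theta>)"
    proof (rule sum_mono)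
      fix j assume j: "j \<in> {..n} - {j0}"
      have "\<bar>a j / d j * w j\<bar> = \<bar>a j\<bar> / d j * \<bar>w j\<bar>" using d[of j] by (simp add: abs_mult)
      also have "\<dots> \<le> \<bar>a j0\<bar> / d j0 * \<theta>" using j j0 small[OF j] a0 d[of j] by (intro mult_mono) auto
      finally show "\<bar>a j / d j * w j\<bar> \<le> \<bar>a j0\<bar> / d j0 * \<theta>" .
    qed
    also have "\<dots> = \<bar>a j0\<bar> / d j0 * (real n * \<theta>)" using j0(1) by simp
    finally have "\<bar>a j0\<bar> / d j0 * \<bar>w j0\<bar> \<le> \<bar>a j0\<bar> / d j0 * (real n * \<theta>)"
      using d[of j0] by (simp add: abs_mult)
    then have w0: "\<bar>w j0\<bar> \<le> real n * \<theta>" using a0 by (simp only: mult_le_cancel_left_pos)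
    have n\<theta>: "real n * \<theta> < \<delta>" using \<delta> by (simp add: \<theta>_def field_simps)
    have all: "\<bar>w j\<bar> < \<delta>" if j: "j \<le> n" for j
    proof (cases "j = j0")
      case True
      then show ?thesis using w0 n\<theta> by simp
    next
      case False
      with j j0(1) have "1 \<le> n" by linarith
      then have "1 * \<theta> \<le> real n * \<theta>" using \<theta> by (intro mult_right_mono) auto
      moreover have "\<bar>w j\<bar> \<le> \<theta>" using False j by (intro small) auto
      ultimately show ?thesis using n\<theta> by linarith
    qed
    show "p = q"
    proof (rule ccontr)
      assume "p \<noteq> q"
      then obtain j where "j \<le> n" "\<delta> \<le> d j * \<bar>poly (hasse j (p - q)) x\<bar>"
        using sep[of "p - q"] LI[OF pq(1)] LI[OF pq(2)] by (auto simp: int_polys_diff)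
      then show False using all[of j] d[of j] by (simp add: w_def abs_mult)
    qed
  qed
  ultimately have "card L \<le> card Y" using fY by (metis card_inj_on_le)
  then have "real (card L) \<le> real (card Y)" by simp
  also have "real (card Y) = real (card {\<lfloor>- (r / \<theta>)\<rfloor>..\<lfloor>r / \<theta>\<rfloor>}) ^ n"
    unfolding Y_def using j0(1) by (subst card_PiE) auto
  also have "\<dots> \<le> (2 * (r / \<theta>) + 2) ^ n"
    using r \<theta> by (intro power_mono card_floor_range) auto
  also have "\<dots> \<le> (r * (2 * (real (n + 1) / \<delta>) + 2)) ^ n"
  proof -
    define z where "z = real (n + 1) / \<delta>"
    have z: "0 \<le> z" using \<delta> by (simp add: z_def)
    have rz: "r / \<theta> = r * z" by (simp add: \<theta>_def z_def)
    have "2 * (r * z) + 2 \<le> r * (2 * z + 2)" using r by (simp add: algebra_simps)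
    moreover have "0 \<le> 2 * (r * z) + 2" using r z by simp
    ultimately show ?thesis unfolding rz z_def[symmetric] by (rule power_mono)
  qed
  finally show ?thesis by (simp add: L_def)
qed

text \<open>
  For \<open>r\<close> large in terms of \<open>n\<close> and \<open>\<delta>\<close>, the two preceding counts contradict each other unless the
  vectors of size at most \<open>r\<close> span the space. Rounding the coefficients with respect to a basis chosen
  among them moves a target by at most \<open>(n + 1) r\<close>.
\<close>

theorem lattice_covering:
  assumes "0 < \<delta>"
  shows "\<exists>R>0. \<forall>d x. (\<forall>j. 0 < d j) \<longrightarrow> (\<Prod>j\<le>n. d j) = 1 \<longrightarrow> \<bar>x\<bar> \<le> 1 \<longrightarrow>
     (\<forall>p\<in>int_polys n. p \<noteq> 0 \<longrightarrow> (\<exists>j\<le>n. \<delta> \<le> d j * \<bar>poly (hasse j p) x\<bar>)) \<longrightarrow>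
     (\<forall>\<tau>. \<exists>q\<in>int_polys n. \<forall>j\<le>n. d j * \<bar>poly (hasse j q) x - \<tau> j\<bar> \<le> R)"
proof -
  define C where "C = 4 * (real (n + 1) * 2 ^ n)"
  define E where "E = 2 * (real (n + 1) / \<delta>) + 2"
  define r where "r = C ^ (n + 1) * E ^ n + 1"
  have C: "0 < C" by (simp add: C_def)
  have E: "0 < E" using assms by (simp add: E_def add_pos_pos)
  have r: "1 \<le> r" using C E by (simp add: r_def)
  have main: "\<exists>q\<in>int_polys n. \<forall>j\<le>n. d j * \<bar>poly (hasse j q) x - \<tau> j\<bar> \<le> real (n + 1) * r"
    if d: "\<And>j. 0 < d j" "(\<Prod>j\<le>n. d j) = 1" and x: "\<bar>x\<bar> \<le> 1"
      and sep: "\<And>p. p \<in> int_polys n \<Longrightarrow> p \<noteq> 0 \<Longrightarrow> \<exists>j\<le>n. \<delta> \<le> d j * \<bar>poly (hasse j p) x\<bar>"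
    for d x \<tau>
  proof -
    define L where "L = short_vectors n d x r"
    have L: "p \<in> int_polys n" "\<And>j. j \<le> n \<Longrightarrow> d j * \<bar>poly (hasse j p) x\<bar> \<le> r" if "p \<in> L" for p
      using that by (auto simp: L_def short_vectors_def)
    have fL: "finite L" unfolding L_def using r by (intro finite_short_vectors d x) auto
    define t where "t = (\<Sum>j\<le>n. smult (\<tau> j) ([:- x, 1:] ^ j))"
    have ht: "poly (hasse j t) x = \<tau> j" if "j \<le> n" for j
      using that by (simp add: t_def hasse_sum hasse_smult poly_sum hasse_shift_power if_distrib sum.delta cong: if_cong)
    have dt: "degree t \<le> n"
      unfolding t_def
      by (intro degree_sum_le order_trans[OF degree_smult_le]) (auto simp: degree_linear_power)
    obtain B where B: "B \<subseteq> L" "rpoly.independent B" "L \<subseteq> rpoly.span B"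
      using rpoly.maximal_independent_subset by blast
    have fB: "finite B" using B(1) fL finite_subset by blast
    have "t \<in> rpoly.span B"
    proof (rule ccontr)
      assume nt: "t \<notin> rpoly.span B"
      then have ind: "rpoly.independent (insert t B)" using B(2) by (rule rpoly.independent_insertI)
      \<comment> \<open>A linear functional that vanishes on the short vectors but not at \<open>t\<close>: a coordinate with respect to a basis of the whole space.\<close>
      define E' where "E' = rpoly.extend_basis (insert t B)"
      have E': "insert t B \<subseteq> E'" "rpoly.independent E'" "rpoly.span E' = UNIV"
        unfolding E'_def using ind
        by (auto intro: rpoly.extend_basis_superset[THEN subsetD] simp: rpoly.independent_extend_basis)
      define g where "g = (\<lambda>p. rpoly.representation E' p t)"
      have gadd: "g (p + q) = g p + g q" for p q
        using E' by (simp add: g_def rpoly.representation_add)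
      have gscale: "g (smult c p) = c * g p" for c p
        using E' by (simp add: g_def rpoly.representation_scale)
      have gsum: "g (\<Sum>i\<in>I. f i) = (\<Sum>i\<in>I. g (f i))" for f and I :: "nat set"
        using E' by (simp add: g_def rpoly.representation_sum)
      have gt: "g t = 1" using E' by (simp add: g_def rpoly.representation_basis)
      have gB: "g b = 0" if "b \<in> B" for b
      proof -
        have "b \<noteq> t" using that nt rpoly.span_base by blast
        then show ?thesis using E' that by (auto simp: g_def rpoly.representation_basis)
      qed
      have "rpoly.subspace {p. g p = 0}"
      proof (rule rpoly.subspaceI)
        show "0 \<in> {p. g p = 0}" using gscale[of 0 0] by simp
      qed (auto simp: gadd gscale)
      then have "rpoly.span B \<subseteq> {p. g p = 0}" using gB by (intro rpoly.span_minimal) auto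
      then have gL: "g p = 0" if "p \<in> L" for p using B(3) that by auto
      define a where "a = (\<lambda>j. g ([:- x, 1:] ^ j))"
      have gp: "g p = (\<Sum>j\<le>n. a j * poly (hasse j p) x)" if "degree p \<le> n" for p
        by (subst taylor_poly[OF that, of x]) (simp add: gsum gscale a_def mult.commute)
      have "\<exists>j1\<le>n. a j1 \<noteq> 0"
      proof (rule ccontr)
        assume "\<not> ?thesis"
        then have "g t = 0" unfolding gp[OF dt] by (intro sum.neutral) auto
        with gt show False by simp
      qed
      then obtain j1 where j1: "j1 \<le> n" "a j1 \<noteq> 0" by blast
      have "real (card L) \<le> (r * E) ^ n"
        unfolding L_def E_def
      proof (rule few_short_vectors_on_hyperplane[where a = a, OF d(1) x r assms sep j1])
        fix p assume "p \<in> short_vectors n d x r"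
        then have "p \<in> L" by (simp add: L_def)
        with L(1) gL gp[of p] show "(\<Sum>j\<le>n. a j * poly (hasse j p) x) = 0"
          by (simp add: int_polys_def)
      qed
      moreover have "(r / C) ^ (n + 1) \<le> real (card L)"
        unfolding L_def C_def using r by (intro many_short_vectors d x) auto
      ultimately have "(r / C) ^ (n + 1) \<le> (r * E) ^ n" by linarith
      then have "r ^ n * r \<le> r ^ n * (C ^ (n + 1) * E ^ n)"
        using C by (simp add: power_divide power_mult_distrib divide_simps mult_ac)
      then have "r \<le> C ^ (n + 1) * E ^ n"
        using r by (subst (asm) mult_le_cancel_left_pos) auto
      then show False by (simp add: r_def)
    qed
    then obtain u where u: "t = (\<Sum>b\<in>B. smult (u b) b)"
      using rpoly.span_finite[OF fB] by auto
    define q where "q = (\<Sum>b\<in>B. smult (of_int \<lfloor>u b\<rfloor>) b)"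
    have qI: "q \<in> int_polys n" unfolding q_def using B(1) L(1) by (intro int_polys_combination) auto
    have "card B \<le> Suc n"
      using B(1,2) L(1) by (intro independent_card_le_degree) (auto simp: int_polys_def)
    then have cB: "card B \<le> n + 1" by simp
    have "d j * \<bar>poly (hasse j q) x - \<tau> j\<bar> \<le> real (n + 1) * r" if j: "j \<le> n" for j
    proof -
      have "poly (hasse j q) x - \<tau> j = (\<Sum>b\<in>B. (of_int \<lfloor>u b\<rfloor> - u b) * poly (hasse j b) x)"
        unfolding ht[OF j, symmetric] u q_def
        by (simp add: hasse_sum hasse_smult poly_sum left_diff_distrib sum_subtractf)
      then have "\<bar>poly (hasse j q) x - \<tau> j\<bar> \<le> (\<Sum>b\<in>B. \<bar>(of_int \<lfloor>u b\<rfloor> - u b) * poly (hasse j b) x\<bar>)"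
        by (simp add: sum_abs)
      then have "d j * \<bar>poly (hasse j q) x - \<tau> j\<bar> \<le> d j * (\<Sum>b\<in>B. \<bar>(of_int \<lfloor>u b\<rfloor> - u b) * poly (hasse j b) x\<bar>)"
        using d(1)[of j] by (intro mult_left_mono) auto
      also have "\<dots> = (\<Sum>b\<in>B. \<bar>of_int \<lfloor>u b\<rfloor> - u b\<bar> * (d j * \<bar>poly (hasse j b) x\<bar>))"
        by (simp add: sum_distrib_left abs_mult mult_ac)
      also have "\<dots> \<le> (\<Sum>b\<in>B. 1 * r)"
      proof (intro sum_mono mult_mono)
        fix b assume "b \<in> B"
        then show "d j * \<bar>poly (hasse j b) x\<bar> \<le> r" using L(2)[of b j] B(1) j by auto
        show "\<bar>of_int \<lfloor>u b\<rfloor> - u b\<bar> \<le> 1" by linarith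
        show "0 \<le> d j * \<bar>poly (hasse j b) x\<bar>" using d(1)[of j] by simp
      qed auto
      also have "\<dots> \<le> real (n + 1) * r" using cB r by (simp add: mult_right_mono del: of_nat_add)
      finally show ?thesis .
    qed
    with qI show ?thesis by blast
  qed
  have R: "0 < real (n + 1) * r" using r by simp
  show ?thesis
    by (rule exI[of _ "real (n + 1) * r"], intro conjI R allI impI, rule main) auto
qed

section \<open>Two close real roots\<close>

text \<open>
  Near \<open>x\<close> the polynomial behaves like the quadratic \<open>c\<^sub>0 + c\<^sub>1 h + c\<^sub>2 h\<^sup>2\<close> with \<open>c\<^sub>0\<close> at most \<open>U s r\<close>,
  \<open>c\<^sub>1\<close> about \<open>100 U s\<close> and \<open>c\<^sub>2\<close> between \<open>U\<close> and \<open>3 U\<close>, whose roots are close to \<open>- c\<^sub>0 / c\<^sub>1\<close>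
  and \<open>- c\<^sub>1 / c\<^sub>2\<close>. The terms of higher order are negligible for small \<open>s\<close>, and sign changes locate both
  roots. The factor \<open>100\<close> separates the two scales even if \<open>r = s\<close>.
\<close>

lemma two_close_roots:
  fixes P :: "real poly"
  assumes N: "degree P \<le> N" "2 \<le> N" and U: "0 < U" and rs: "0 < r" "r \<le> s" "real N * 104 ^ 3 * s \<le> 1"
    and T: "\<bar>poly P x\<bar> \<le> U * s * r"
      "100 * U * s \<le> poly (hasse 1 P) x" "poly (hasse 1 P) x \<le> 102 * U * s"
      "U \<le> poly (hasse 2 P) x" "poly (hasse 2 P) x \<le> 3 * U"
      "\<And>j. 3 \<le> j \<Longrightarrow> j \<le> N \<Longrightarrow> \<bar>poly (hasse j P) x\<bar> \<le> U"
  obtains \<alpha> \<beta> where "poly P \<alpha> = 0" "poly P \<beta> = 0" "\<bar>\<alpha> - x\<bar> \<le> r / 4" "x - 104 * s \<le> \<beta>" "\<beta> \<le> x - s"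
proof -
  define c where "c = (\<lambda>j. poly (hasse j P) x)"
  define E where "E = (\<lambda>h. \<Sum>j\<in>{3..N}. c j * h ^ j)"
  have s: "0 < s" using rs by simp
  have N1: "1 \<le> real N" using N by simp
  have "104 ^ 3 * s \<le> real N * (104 ^ 3 * s)" using mult_right_mono[OF N1, of "104 ^ 3 * s"] s by simp
  then have "104 ^ 3 * s \<le> 1" using rs(3) by (simp add: mult.assoc)
  then have s1: "104 * s \<le> 1" using s by simp
  have Ns: "real N * s \<le> 1 / 104 ^ 3" using rs(3) by simp
  have ex: "poly P (x + h) = c 0 + c 1 * h + c 2 * h\<^sup>2 + E h" for h
  proof -
    have "{..N} = {0, 1, 2} \<union> {3..N}" using N(2) by auto
    then have "(\<Sum>j\<le>N. c j * h ^ j) = (\<Sum>j\<in>{0, 1, 2}. c j * h ^ j) + E h"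
      unfolding E_def by (subst sum.union_disjoint[symmetric]) auto
    then show ?thesis
      unfolding c_def taylor_expansion[OF N(1)] by (simp add: eval_nat_numeral)
  qed
  have E: "\<bar>E h\<bar> \<le> U * (real N * \<bar>h\<bar> ^ 3)" if h: "\<bar>h\<bar> \<le> 1" for h
  proof -
    have "\<bar>E h\<bar> \<le> (\<Sum>j\<in>{3..N}. \<bar>c j * h ^ j\<bar>)" unfolding E_def by (rule sum_abs)
    also have "\<dots> \<le> (\<Sum>j\<in>{3..N}. U * \<bar>h\<bar> ^ 3)"
    proof (rule sum_mono)
      fix j assume j: "j \<in> {3..N}"
      then have "\<bar>c j\<bar> \<le> U" using T(6) by (simp add: c_def)
      moreover have "\<bar>h\<bar> ^ j \<le> \<bar>h\<bar> ^ 3" using h j by (intro power_decreasing) auto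
      ultimately have "\<bar>c j\<bar> * \<bar>h\<bar> ^ j \<le> U * \<bar>h\<bar> ^ 3" using U by (intro mult_mono) auto
      then show "\<bar>c j * h ^ j\<bar> \<le> U * \<bar>h\<bar> ^ 3" by (simp add: abs_mult power_abs)
    qed
    also have "\<dots> = real (card {3..N}) * (U * \<bar>h\<bar> ^ 3)" by simp
    also have "\<dots> \<le> real N * (U * \<bar>h\<bar> ^ 3)" using U by (intro mult_right_mono) auto
    finally show ?thesis by (simp add: mult_ac)
  qed
  have c: "\<bar>c 0\<bar> \<le> U * s * r" "100 * U * s \<le> c 1" "c 1 \<le> 102 * U * s" "U \<le> c 2" "c 2 \<le> 3 * U"
    using T by (auto simp: c_def)
  have rr: "U * s * r > 0" using U s rs by simp
  have r1: "r \<le> 1" using s1 rs s by linarith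
  have Er: "\<bar>E h\<bar> \<le> U * s * r" if "\<bar>h\<bar> = r / 4" for h
  proof -
    have "\<bar>E h\<bar> \<le> U * (real N * (r / 4) ^ 3)" using E[of h] that r1 rs by simp
    also have "\<dots> \<le> U * (real N * (s * s * r))"
    proof -
      have "(r / 4) ^ 3 = (r / 4) * (r / 4) * (r / 4)" by (simp add: power3_eq_cube)
      also have "\<dots> \<le> s * s * r" using rs s by (intro mult_mono) auto
      finally show ?thesis using U by (intro mult_left_mono) auto
    qed
    also have "\<dots> = (real N * s) * (U * s * r)" by (simp add: mult_ac)
    also have "\<dots> \<le> 1 * (U * s * r)" using Ns rr by (intro mult_right_mono) auto
    finally show ?thesis by simp
  qed
  have "0 \<le> poly P (x + r / 4)"
  proof -
    have "100 * U * s * (r / 4) \<le> c 1 * (r / 4)" using c(2) rs by (intro mult_right_mono) auto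
    moreover have "0 \<le> c 2 * (r / 4)\<^sup>2" using c(4) U by (intro mult_nonneg_nonneg) auto
    moreover have "100 * U * s * (r / 4) = 25 * (U * s * r)" by simp
    moreover have "\<bar>E (r / 4)\<bar> \<le> U * s * r" using rs by (intro Er) simp
    ultimately show ?thesis using c(1) rr unfolding ex by linarith
  qed
  moreover have "poly P (x + - (r / 4)) \<le> 0"
  proof -
    have "100 * U * s * (r / 4) \<le> c 1 * (r / 4)" using c(2) rs by (intro mult_right_mono) auto
    moreover have "c 2 * (r / 4)\<^sup>2 \<le> U * s * r"
    proof -
      have "c 2 * (r / 4)\<^sup>2 \<le> (3 * U) * (r / 4)\<^sup>2" using c(5) by (intro mult_right_mono) auto
      also have "\<dots> = (3 / 16) * U * (r * r)" by (simp add: power2_eq_square)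
      also have "\<dots> \<le> U * (s * r)"
        using U rs by (intro mult_mono) auto
      finally show ?thesis by (simp add: mult_ac)
    qed
    moreover have "100 * U * s * (r / 4) = 25 * (U * s * r)" by simp
    moreover have "\<bar>E (- (r / 4))\<bar> \<le> U * s * r" using rs by (intro Er) simp
    ultimately show ?thesis using c(1) rr unfolding ex mult_minus_right power2_minus by linarith
  qed
  ultimately obtain \<alpha> where \<alpha>: "x - r / 4 \<le> \<alpha>" "\<alpha> \<le> x + r / 4" "poly P \<alpha> = 0"
    using IVT[of "poly P" "x - r / 4" 0 "x + r / 4"] rs by (auto intro: poly_isCont)
  have ss: "U * s * s > 0" using U s by simp
  have rs': "U * s * r \<le> U * s * s" using rs U s by (intro mult_left_mono) auto
  have "poly P (x + - s) \<le> 0"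
  proof -
    have "100 * U * s * s \<le> c 1 * s" using c(2) s by (intro mult_right_mono) auto
    moreover have "c 2 * s\<^sup>2 \<le> 3 * (U * s * s)"
      using mult_right_mono[OF c(5), of "s\<^sup>2"] by (simp add: power2_eq_square)
    moreover have "\<bar>E (- s)\<bar> \<le> U * s * s"
    proof -
      have "\<bar>E (- s)\<bar> \<le> U * (real N * s ^ 3)" using E[of "- s"] s s1 by simp
      also have "\<dots> = (real N * s) * (U * s * s)" by (simp add: power3_eq_cube mult_ac)
      also have "\<dots> \<le> 1 * (U * s * s)" using Ns ss by (intro mult_right_mono) auto
      finally show ?thesis by simp
    qed
    moreover have "100 * U * s * s = 100 * (U * s * s)" by simp
    ultimately show ?thesis using c(1) rs' ss unfolding ex mult_minus_right power2_minus by linarith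
  qed
  moreover have "0 \<le> poly P (x + - (104 * s))"
  proof -
    have "c 1 * (104 * s) \<le> 102 * U * s * (104 * s)" using c(3) s by (intro mult_right_mono) auto
    moreover have "U * (104 * s)\<^sup>2 \<le> c 2 * (104 * s)\<^sup>2" using c(4) by (intro mult_right_mono) auto
    moreover have "\<bar>E (- (104 * s))\<bar> \<le> U * s * s"
    proof -
      have "\<bar>E (- (104 * s))\<bar> \<le> U * (real N * (104 * s) ^ 3)" using E[of "- (104 * s)"] s s1 by simp
      also have "\<dots> = (real N * 104 ^ 3 * s) * (U * s * s)" by (simp add: power3_eq_cube mult_ac)
      also have "\<dots> \<le> 1 * (U * s * s)" using rs(3) ss by (intro mult_right_mono) auto
      finally show ?thesis by simp
    qed
    moreover have "102 * U * s * (104 * s) = 10608 * (U * s * s)" "U * (104 * s)\<^sup>2 = 10816 * (U * s * s)"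
      by (simp_all add: power2_eq_square)
    ultimately show ?thesis using c(1) rs' ss unfolding ex mult_minus_right power2_minus by linarith
  qed
  ultimately obtain \<beta> where \<beta>: "x - 104 * s \<le> \<beta>" "\<beta> \<le> x - s" "poly P \<beta> = 0"
    using IVT2[of "poly P" "x - s" 0 "x - 104 * s"] s by (auto intro: poly_isCont)
  show thesis
    by (rule that[OF \<alpha>(3) \<beta>(3) _ \<beta>(1,2)]) (use \<alpha> in linarith)
qed

section \<open>Irreducibility and minimal polynomials\<close>

text \<open>
  Eisenstein's criterion at the prime \<open>2\<close>. One factor has an odd constant coefficient; the lowest odd
  coefficient of the other one then yields an odd coefficient of the product, necessarily the leading
  one, so this other factor carries the whole degree.
\<close>

lemma eisenstein_two:
  fixes P :: "int poly"
  assumes P: "odd (coeff P m)" "degree P = m" "\<And>i. i < m \<Longrightarrow> even (coeff P i)" "\<not> 4 dvd coeff P 0"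
    and AB: "P = A * B"
  shows "degree A = 0 \<or> degree B = 0"
proof -
  have key: "degree B = 0" if AB: "P = A * B" and B0: "odd (coeff B 0)" and m: "degree P = m" for A B :: "int poly"
  proof -
    have P0: "P \<noteq> 0" using P(1) by auto
    then have "A \<noteq> 0" "B \<noteq> 0" using AB by auto
    have "lead_coeff P = lead_coeff A * lead_coeff B" by (simp add: AB lead_coeff_mult)
    then have "odd (lead_coeff A)" using P(1) m by auto
    define k where "k = (LEAST k. odd (coeff A k))"
    have k: "odd (coeff A k)" unfolding k_def by (rule LeastI) fact
    have lt: "even (coeff A i)" if "i < k" for i using that not_less_Least unfolding k_def by blast
    have "k \<le> degree A" using k by (intro le_degree) auto
    have "coeff P k = (\<Sum>i\<le>k. coeff A i * coeff B (k - i))" by (simp add: AB coeff_mult)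
    also have "\<dots> = coeff A k * coeff B 0 + (\<Sum>i<k. coeff A i * coeff B (k - i))"
      by (simp add: lessThan_Suc_atMost[symmetric])
    finally have "odd (coeff P k)" using k B0 lt by (auto intro!: dvd_sum)
    then have "m \<le> k" using P(3) not_le by blast
    moreover have "m = degree A + degree B"
      using \<open>A \<noteq> 0\<close> \<open>B \<noteq> 0\<close> m by (simp add: AB degree_mult_eq)
    ultimately show ?thesis using \<open>k \<le> degree A\<close> by simp
  qed
  have "coeff P 0 = coeff A 0 * coeff B 0" by (simp add: AB coeff_mult)
  then have "\<not> (even (coeff A 0) \<and> even (coeff B 0))"
    using P(4) mult_dvd_mono[of 2 "coeff A 0" 2 "coeff B 0"] by auto
  then show ?thesis
    using key[of A B] key[of B A] AB P(2) by (auto simp: mult.commute)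
qed

lemma irreducible_primitive_part_if:
  fixes P :: "int poly"
  assumes "0 < degree P" "\<And>A B. P = A * B \<Longrightarrow> degree A = 0 \<or> degree B = 0"
  shows "irreducible (primitive_part P)"
proof (rule irreducibleI)
  have P0: "P \<noteq> 0" using assms(1) by auto
  then show "primitive_part P \<noteq> 0" by simp
  show "\<not> is_unit (primitive_part P)"
  proof
    assume "is_unit (primitive_part P)"
    then obtain c where "primitive_part P = [:c:]" by (auto simp: is_unit_poly_iff)
    then have "degree (primitive_part P) = 0" by (metis degree_pCons_0)
    then show False using assms(1) by simp
  qed
next
  fix A B assume AB: "primitive_part P = A * B"
  have const: "is_unit C" if "degree C = 0" "C dvd primitive_part P" for C
  proof -
    from that(1) obtain c where c: "C = [:c:]" by (elim degree_eq_zeroE)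
    have "c dvd content (primitive_part P)" using that(2) c by (simp add: const_poly_dvd_iff_dvd_content)
    moreover have "P \<noteq> 0" using assms(1) by auto
    ultimately show ?thesis using c by (simp add: is_unit_poly_iff)
  qed
  have "P = smult (content P) (A * B)" by (metis AB content_times_primitive_part)
  then have "P = smult (content P) A * B" by simp
  from assms(2)[OF this] have "degree A = 0 \<or> degree B = 0"
    using assms(1) by (auto split: if_splits)
  then show "is_unit A \<or> is_unit B" using const AB by auto
qed

lemma rat_poly_clear_denominators:
  "\<exists>a q. a \<noteq> 0 \<and> map_poly rat_of_int q = smult (rat_of_int a) p"
proof (induction p)
  case 0
  show ?case by (intro exI[of _ 1] exI[of _ 0]) simp
next
  case (pCons c p)
  then obtain a q where aq: "a \<noteq> 0" "map_poly rat_of_int q = smult (rat_of_int a) p" by blast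
  obtain u w where uw: "quotient_of c = (u, w)" by force
  have w: "w > 0" "c = rat_of_int u / rat_of_int w"
    using quotient_of_denom_pos[OF uw] quotient_of_div[OF uw] by auto
  have "map_poly rat_of_int (pCons (u * a) (smult w q)) = smult (rat_of_int (a * w)) (pCons c p)"
    using w aq by (simp add: map_poly_pCons of_int_poly_smult mult_ac)
  then show ?case using aq(1) w(1) by (intro exI[of _ "a * w"] exI[of _ "pCons (u * a) (smult w q)"]) auto
qed

text \<open>
  Gauss's lemma: clear the denominators of a rational factorization and use that \<open>Q\<close> is prime among the
  integer polynomials.
\<close>

lemma irreducible_int_imp_rat:
  fixes Q :: "int poly"
  assumes Q: "irreducible Q" "0 < degree Q"
  shows "irreducible (map_poly rat_of_int Q)"
proof (rule irreducibleI)
  let ?h = "map_poly rat_of_int"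
  have dh: "degree (?h p) = degree p" for p by (rule degree_map_poly) simp
  show "?h Q \<noteq> 0" using Q(2) dh[of Q] by auto
  show "\<not> is_unit (?h Q)" using Q(2) dh[of Q] by (auto simp: is_unit_poly_iff)
  fix A B assume AB: "?h Q = A * B"
  have nz: "A \<noteq> 0" "B \<noteq> 0" using AB \<open>?h Q \<noteq> 0\<close> by auto
  then have deg: "degree Q = degree A + degree B" using AB dh[of Q] by (simp add: degree_mult_eq)
  obtain a A' where A': "a \<noteq> 0" "?h A' = smult (rat_of_int a) A" using rat_poly_clear_denominators by blast
  obtain b B' where B': "b \<noteq> 0" "?h B' = smult (rat_of_int b) B" using rat_poly_clear_denominators by blast
  have dA: "degree A' = degree A" using A' dh[of A'] by simp
  have dB: "degree B' = degree B" using B' dh[of B'] by simp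
  have nz': "A' \<noteq> 0" "B' \<noteq> 0" using A' B' nz by auto
  have "?h (smult (a * b) Q) = ?h (A' * B')"
    by (simp add: of_int_poly_smult of_int_poly_mult A' B' AB mult_ac)
  then have "smult (a * b) Q = A' * B'"
    by (intro poly_eqI) (metis coeff_map_poly of_int_0 of_int_eq_iff)
  then have "Q dvd A' * B'" by (metis dvd_refl dvd_smult)
  moreover have "prime_elem Q" using Q(1) by (simp add: irreducible_imp_prime_elem)
  ultimately have "Q dvd A' \<or> Q dvd B'" by (simp add: prime_elem_dvd_mult_iff)
  then have "degree A = 0 \<or> degree B = 0"
    using dvd_imp_degree_le[of Q A'] dvd_imp_degree_le[of Q B'] nz' dA dB deg by auto
  then show "is_unit A \<or> is_unit B" using nz by (auto simp: is_unit_iff_degree)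
qed

lemma degree_real_of_int_poly: "degree (map_poly real_of_int p) = degree p"
  by (rule degree_map_poly) simp

lemma min_int_poly_cases:
  fixes x :: real
  assumes "irreducible Q" "poly (map_poly of_int Q) x = 0"
  shows "algebraic x \<and> (min_int_poly x = Q \<or> min_int_poly x = - Q)"
proof -
  have Q0: "Q \<noteq> 0" using assms(1) by auto
  have alg: "algebraic x"
  proof (rule algebraicI)
    show "map_poly of_int Q \<noteq> (0 :: real poly)"
      using of_int_poly_root_degree[OF Q0 assms(2)] degree_real_of_int_poly[of Q] by force
  qed (use assms(2) in \<open>auto simp: coeff_map_poly\<close>)
  have "irreducible (- Q)" using assms(1) irreducible_mult_unit_left[of "-1" Q] by simp
  moreover have "poly (map_poly of_int (- Q)) x = 0"
    using assms(2) of_int_poly_smult[of "-1" Q, where 'a = real] by simp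
  moreover from leading_coeff_neq_0[OF Q0] have "lead_coeff Q > 0 \<or> lead_coeff Q < 0" by linarith
  then have "lead_coeff Q > 0 \<or> lead_coeff (- Q) > 0" by auto
  ultimately have "is_min_int_poly x Q \<or> is_min_int_poly x (- Q)"
    unfolding is_min_int_poly_def using assms by auto
  then show ?thesis
    using the1_equality[OF ex1_min_int_poly[OF alg]] alg unfolding min_int_poly_def by auto
qed

lemma min_int_poly_real:
  fixes x :: real
  assumes "algebraic x"
  shows "min_int_poly x \<noteq> 0" "poly (map_poly of_int (min_int_poly x)) x = 0"
proof -
  have "is_min_int_poly x (min_int_poly x)"
    unfolding min_int_poly_def by (rule theI'[OF ex1_min_int_poly[OF assms]])
  then show "min_int_poly x \<noteq> 0" "poly (map_poly of_int (min_int_poly x)) x = 0"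
    by (auto simp: is_min_int_poly_def)
qed

text \<open>
  This ensures that the cardinality in the theorem is that of a finite set.
\<close>

lemma finite_bounded_height:
  "finite {x :: real. algebraic x \<and> alg_degree x = m \<and> real_of_int (alg_height x) \<le> H}"
proof (rule finite_subset)
  let ?P = "{p \<in> int_polys m. \<forall>i\<le>m. \<bar>coeff p i\<bar> \<le> H} - {0}"
  show "finite (\<Union>p\<in>?P. {x. poly p x = 0})"
    using finite_int_polys_bounded by (intro finite_UN_I poly_roots_finite) auto
  show "{x :: real. algebraic x \<and> alg_degree x = m \<and> real_of_int (alg_height x) \<le> H} \<subseteq> (\<Union>p\<in>?P. {x. poly p x = 0})"
  proof safe
    fix x :: real assume x: "algebraic x" "m = alg_degree x" "real_of_int (alg_height x) \<le> H"
    define q where "q = min_int_poly x"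
    let ?q = "map_poly of_int q :: real poly"
    have q: "q \<noteq> 0" "poly ?q x = 0" using min_int_poly_real[OF x(1)] by (auto simp: q_def)
    have dq: "degree ?q = degree q" by (rule degree_real_of_int_poly)
    have "?q \<in> int_polys (alg_degree x)"
      by (auto simp: int_polys_def coeff_map_poly degree_real_of_int_poly alg_degree_def q_def)
    moreover have "\<bar>coeff ?q i\<bar> \<le> H" if "i \<le> alg_degree x" for i
    proof -
      have "\<bar>coeff q i\<bar> \<le> alg_height x"
        unfolding alg_height_def q_def[symmetric]
        using that by (intro Max_ge) (auto simp: alg_degree_def q_def)
      then have "real_of_int \<bar>coeff q i\<bar> \<le> real_of_int (alg_height x)" by (simp only: of_int_le_iff)
      then show ?thesis using x(3) by (simp add: coeff_map_poly)
    qed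
    moreover have "?q \<noteq> 0" using q(1) dq of_int_poly_root_degree[OF q] by force
    ultimately have "?q \<in> {p \<in> int_polys (alg_degree x). \<forall>i\<le>alg_degree x. \<bar>coeff p i\<bar> \<le> H} - {0}" by blast
    then show "x \<in> (\<Union>p\<in>{p \<in> int_polys (alg_degree x). \<forall>i\<le>alg_degree x. \<bar>coeff p i\<bar> \<le> H} - {0}. {x. poly p x = 0})"
      using q(2) by blast
  qed
qed

section \<open>Counting close conjugates\<close>

text \<open>
  The weights for which a lattice vector of bounded size is a polynomial whose value is at most of
  order \<open>Q\<close> to the power \<open>\<mu> - n\<close>, whose derivative is at most of order \<open>Q\<close> to the power \<open>1 - \<mu>\<close>, and
  whose higher derivatives are at most of order \<open>Q\<close>.
\<close>

definition weight :: "nat \<Rightarrow> real \<Rightarrow> real \<Rightarrow> nat \<Rightarrow> real" where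
  "weight n \<mu> Q j = (if j = 0 then Q powr (real n - \<mu>) else if j = 1 then Q powr (\<mu> - 1) else 1 / Q)"

lemma weight_pos: "0 < Q \<Longrightarrow> 0 < weight n \<mu> Q j"
  by (simp add: weight_def)

lemma prod_weight:
  assumes "0 < Q" "2 \<le> k"
  shows "(\<Prod>j<k. weight n \<mu> Q j) = Q powr (real n + 1 - real k)"
  using assms(2)
proof (induction k rule: dec_induct)
  case base
  have "{..<2::nat} = {0, 1}" by auto
  then show ?case using assms(1) by (simp add: weight_def powr_add[symmetric])
next
  case (step k)
  have "(\<Prod>j<Suc k. weight n \<mu> Q j) = Q powr (real n + 1 - real k) * (1 / Q)"
    using step by (simp add: weight_def)
  also have "1 / Q = Q powr (- 1)" using assms(1) by (simp add: powr_minus_divide)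
  also have "Q powr (real n + 1 - real k) * Q powr (- 1) = Q powr (real n + 1 - real (Suc k))"
    unfolding powr_add[symmetric] by (rule arg_cong[where f = "(powr) Q"]) simp
  finally show ?case .
qed

text \<open>
  Aim at the Taylor coefficients that \<open>two_close_roots\<close> requires, with \<open>U = 4 R Q\<close>, so that the error
  of the approximation, \<open>4 R\<close> in each weighted coordinate, is as large as the permitted deviation.
  The minimal polynomial of the root is up to sign the primitive part of \<open>P\<close>, so its height is that of \<open>P\<close> divided by
  the content. The content is at most the constant \<open>K\<close>: it is \<open>1\<close> for monic \<open>P\<close>, and otherwise the
  primitive part is itself a lattice vector, of size at least \<open>\<delta>\<close>.
\<close>

lemma close_roots_near_point:
  fixes \<delta> R \<mu> Q x \<nu> :: real
  assumes n: "2 \<le> n" and m: "m \<in> {n, Suc n}" and \<delta>: "0 < \<delta>" and R: "0 < R"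
    and \<mu>: "0 < \<mu>" "\<mu> \<le> (real n + 1) / 3"
    and Q: "1 \<le> Q" "real (Suc n) * 104 ^ 3 * Q powr (- \<mu>) \<le> 1" "1 \<le> 4 * R * Q"
    and x: "\<bar>x\<bar> \<le> 1"
    and sep: "\<And>p. p \<in> int_polys n \<Longrightarrow> p \<noteq> 0 \<Longrightarrow> \<exists>j\<le>n. \<delta> \<le> weight n \<mu> Q j * \<bar>poly (hasse j p) x\<bar>"
    and cover: "\<And>\<tau>. \<exists>q\<in>int_polys n. \<forall>j\<le>n. weight n \<mu> Q j * \<bar>poly (hasse j q) x - \<tau> j\<bar> \<le> R"
    and C: "C = real (Suc n + 1) * 2 ^ Suc n" and K: "K = 408 * R / \<delta> + 1"
    and \<nu>: "0 < \<nu>" "\<nu> \<le> 1 / 105" "\<nu> \<le> 4 * R / (C * K)" "\<nu> \<le> 1 / (C * (408 * R))"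
  shows "\<exists>\<alpha>. \<bar>\<alpha> - x\<bar> \<le> Q powr (2 * \<mu> - real n - 1) / 4 \<and> algebraic \<alpha> \<and> alg_degree \<alpha> = m \<and>
      (m = Suc n \<longrightarrow> algebraic_int \<alpha>) \<and> height_and_distance \<nu> Q \<mu> \<alpha>"
proof -
  define d where "d = weight n \<mu> Q"
  define s where "s = Q powr (- \<mu>)"
  define r where "r = Q powr (2 * \<mu> - real n - 1)"
  define U where "U = 4 * R * Q"
  have Q0: "0 < Q" using Q by simp
  have C0: "0 < C" by (simp add: C)
  have K1: "1 \<le> K" using R \<delta> by (simp add: K)
  have d0: "0 < d j" for j by (simp add: d_def weight_pos Q0)
  have s0: "0 < s" and r0: "0 < r" using Q0 by (auto simp: s_def r_def)
  have s1: "s \<le> 1" using Q \<mu> powr_mono[of "- \<mu>" 0 Q] by (simp add: s_def)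
  have rs: "r \<le> s" unfolding r_def s_def using Q \<mu> by (intro powr_mono) auto
  have r1: "r \<le> 1" using rs s1 by simp
  have U0: "0 < U" using R Q0 by (simp add: U_def)
  have U1: "1 \<le> U" using Q by (simp add: U_def)
  \<comment> \<open>The error permitted in the \<open>j\<close>-th Taylor coefficient, equal to \<open>4 R\<close> in the weighted coordinate.\<close>
  define w where "w = (\<lambda>j::nat. if j = 0 then U * s * r else if j = 1 then U * s else U)"
  have w: "d j * w j = 4 * R" for j
  proof -
    have "Q powr (real n - \<mu>) * (Q * Q powr (- \<mu>) * Q powr (2 * \<mu> - real n - 1)) = 1"
    proof -
      have "Q powr (real n - \<mu>) * (Q * Q powr (- \<mu>) * Q powr (2 * \<mu> - real n - 1))
          = Q powr (real n - \<mu>) * (Q powr 1 * Q powr (- \<mu>) * Q powr (2 * \<mu> - real n - 1))"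
        using Q0 by simp
      also have "\<dots> = Q powr 0" unfolding powr_add[symmetric] by (rule arg_cong[where f = "(powr) Q"]) simp
      finally show ?thesis using Q0 by simp
    qed
    moreover have "Q powr (\<mu> - 1) * (Q * Q powr (- \<mu>)) = 1"
    proof -
      have "Q powr (\<mu> - 1) * (Q * Q powr (- \<mu>)) = Q powr (\<mu> - 1) * (Q powr 1 * Q powr (- \<mu>))"
        using Q0 by simp
      also have "\<dots> = Q powr 0" unfolding powr_add[symmetric] by (rule arg_cong[where f = "(powr) Q"]) simp
      finally show ?thesis using Q0 by simp
    qed
    ultimately show ?thesis using Q0 unfolding d_def weight_def w_def U_def s_def r_def
      by (simp add: mult_ac)
  qed
  \<comment> \<open>The targets: the middles of the ranges allowed for the Taylor coefficients.\<close>
  define \<sigma> where "\<sigma> = (\<lambda>j::nat. if j = 1 then 101 * (U * s) else if j = 2 then 2 * U else 0)"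
  \<comment> \<open>Adding four times an integer polynomial to this preserves the congruences of Eisenstein's criterion.\<close>
  define E where "E = monom (1::real) m + [:2:]"
  obtain L where L: "L \<in> int_polys n"
    "\<And>j. j \<le> n \<Longrightarrow> d j * \<bar>poly (hasse j L) x - (\<sigma> j - poly (hasse j E) x) / 4\<bar> \<le> R"
    using cover[of "\<lambda>j. (\<sigma> j - poly (hasse j E) x) / 4"] unfolding d_def by auto
  define P where "P = E + smult 4 L"
  have dL: "degree L \<le> n" using L(1) by (simp add: int_polys_def)
  have dE: "degree E \<le> m" unfolding E_def by (intro degree_add_le degree_monom_le) simp
  have mN: "n \<le> m" "m \<le> Suc n" using m by auto
  have dP: "degree P \<le> Suc n"
    unfolding P_def using dL dE mN by (intro degree_add_le order_trans[OF degree_smult_le]) auto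
  have near: "\<bar>poly (hasse j P) x - \<sigma> j\<bar> \<le> w j" if j: "j \<le> n" for j
  proof -
    have "poly (hasse j P) x - \<sigma> j = 4 * (poly (hasse j L) x - (\<sigma> j - poly (hasse j E) x) / 4)"
      by (simp add: P_def hasse_add hasse_smult field_simps)
    then have "d j * \<bar>poly (hasse j P) x - \<sigma> j\<bar>
        = 4 * (d j * \<bar>poly (hasse j L) x - (\<sigma> j - poly (hasse j E) x) / 4\<bar>)"
      by (simp only: abs_mult)
    also have "\<dots> \<le> d j * w j" using L(2)[OF j] by (simp add: w)
    finally show ?thesis using d0[of j] by (simp only: mult_le_cancel_left_pos)
  qed
  have T0: "\<bar>poly P x\<bar> \<le> U * s * r" using near[of 0] by (simp add: \<sigma>_def w_def)
  have T1: "100 * U * s \<le> poly (hasse 1 P) x" "poly (hasse 1 P) x \<le> 102 * U * s"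
    using near[of 1] n by (auto simp: \<sigma>_def w_def abs_le_iff)
  have T2: "U \<le> poly (hasse 2 P) x" "poly (hasse 2 P) x \<le> 3 * U"
    using near[of 2] n by (auto simp: \<sigma>_def w_def abs_le_iff)
  have T3: "\<bar>poly (hasse j P) x\<bar> \<le> U" if j: "3 \<le> j" "j \<le> Suc n" for j
  proof (cases "j \<le> n")
    case True
    then show ?thesis using near[of j] j by (simp add: \<sigma>_def w_def)
  next
    case False
    then have "j = Suc n" using j by simp
    then have "poly (hasse j P) x = coeff P (Suc n)" using hasse_top[OF dP] by simp
    also have "\<dots> = (if m = Suc n then 1 else 0)"
      using dL by (simp add: P_def E_def coeff_eq_0)
    finally show ?thesis using U1 by auto
  qed
  obtain \<alpha> \<beta> where ab: "poly P \<alpha> = 0" "poly P \<beta> = 0" "\<bar>\<alpha> - x\<bar> \<le> r / 4" "x - 104 * s \<le> \<beta>" "\<beta> \<le> x - s"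
    by (rule two_close_roots[OF dP _ U0 r0 rs _ T0 T1 T2 T3]) (use n Q in \<open>auto simp: s_def\<close>)
  obtain L' where L': "L = map_poly of_int L'" "degree L' \<le> n" using int_polys_cast[OF L(1)] .
  define P' where "P' = monom 1 m + [:2:] + smult 4 L'"
  have PP': "P = map_poly of_int P'"
    by (rule poly_eqI) (simp add: P_def P'_def E_def L' coeff_map_poly coeff_pCons split: nat.split)
  have m2: "2 \<le> m" using n mN by simp
  have cm: "coeff P' m = 1 + 4 * coeff L' m"
    using m2 by (cases m) (auto simp: P'_def)
  have odd: "odd (coeff P' m)" by (simp add: cm)
  have dP': "degree P' = m"
  proof (rule antisym)
    show "degree P' \<le> m"
      unfolding P'_def using L'(2) mN by (intro degree_add_le degree_monom_le order_trans[OF degree_smult_le]) auto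
    show "m \<le> degree P'" using odd by (intro le_degree) auto
  qed
  have even: "even (coeff P' i)" if "i < m" for i
    using that by (cases i) (auto simp: P'_def)
  have not4: "\<not> 4 dvd coeff P' 0"
  proof -
    have "coeff P' 0 = 2 + 4 * coeff L' 0" using m2 by (simp add: P'_def)
    then show ?thesis by presburger
  qed
  define q where "q = primitive_part P'"
  define c where "c = content P'"
  have P'0: "P' \<noteq> 0" using odd by auto
  have Pq: "P' = smult c q" by (simp add: q_def c_def)
  have dq: "degree q = m" using dP' by (simp add: q_def)
  have irr: "irreducible q" unfolding q_def
    by (rule irreducible_primitive_part_if) (use dP' m2 eisenstein_two[OF odd dP' even not4] in auto)
  have c1: "1 \<le> c"
  proof -
    have "c \<noteq> 0" using P'0 by (simp add: c_def)
    moreover have "normalize c = c" unfolding c_def by (rule normalize_content)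
    ultimately show ?thesis by simp
  qed
  have Prq: "P = smult (of_int c) (map_poly of_int q)"
    unfolding PP' by (subst Pq) (rule of_int_poly_smult)
  have qroot: "poly (map_poly of_int q) \<gamma> = 0" if "poly P \<gamma> = 0" for \<gamma>
    using that c1 by (simp add: Prq)
  have min: "algebraic \<alpha> \<and> (min_int_poly \<alpha> = q \<or> min_int_poly \<alpha> = - q)"
    by (rule min_int_poly_cases[OF irr qroot[OF ab(1)]])
  have deg: "alg_degree \<alpha> = m" using min dq by (auto simp: alg_degree_def)
  have height: "alg_height \<alpha> = Max ((\<lambda>i. \<bar>coeff q i\<bar>) ` {..m})"
    using min dq by (auto simp: alg_height_def)
  have hle: "\<bar>coeff q i\<bar> \<le> alg_height \<alpha>" for i
  proof (cases "i \<le> m")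
    case True
    then show ?thesis unfolding height by (intro Max_ge) auto
  next
    case False
    then have "coeff q i = 0" using dq by (simp add: coeff_eq_0)
    moreover have "\<bar>coeff q 0\<bar> \<le> alg_height \<alpha>" unfolding height by (intro Max_ge) auto
    ultimately show ?thesis by simp
  qed
  have Pcoeff: "\<bar>coeff P i\<bar> = real_of_int c * real_of_int \<bar>coeff q i\<bar>" for i
    using c1 by (simp add: Prq coeff_map_poly abs_mult)
  have TP: "\<bar>poly (hasse j P) x\<bar> \<le> 102 * U" if j: "j \<le> Suc n" for j
  proof -
    consider "j = 0" | "j = 1" | "j = 2" | "3 \<le> j" by linarith
    then show ?thesis
    proof cases
      case 1
      have "U * s * r \<le> U * 1 * 1" using U0 s0 r0 s1 r1 by (intro mult_mono) auto
      then have "\<bar>poly P x\<bar> \<le> 102 * U" using T0 U0 by linarith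
      then show ?thesis using 1 by simp
    next
      case 2
      have "U * s \<le> U * 1" using U0 s1 by (intro mult_left_mono) auto
      moreover have "0 \<le> U * s" using U0 s0 by simp
      ultimately have "\<bar>poly (hasse 1 P) x\<bar> \<le> 102 * U" using T1 by linarith
      then show ?thesis using 2 by simp
    next
      case 3
      have "\<bar>poly (hasse 2 P) x\<bar> \<le> 102 * U" using T2 U0 by linarith
      then show ?thesis using 3 by simp
    next
      case 4
      then show ?thesis using T3[of j] j U0 by simp
    qed
  qed
  have upper: "real_of_int (alg_height \<alpha>) \<le> C * (102 * U)"
  proof -
    have "alg_height \<alpha> \<in> (\<lambda>i. \<bar>coeff q i\<bar>) ` {..m}" unfolding height by (intro Max_in) auto
    then obtain i where i: "alg_height \<alpha> = \<bar>coeff q i\<bar>" by auto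
    have "1 * real_of_int \<bar>coeff q i\<bar> \<le> real_of_int c * real_of_int \<bar>coeff q i\<bar>"
      using c1 by (intro mult_right_mono) auto
    also have "\<dots> = \<bar>coeff P i\<bar>" by (simp only: Pcoeff)
    also have "\<dots> \<le> C * (102 * U)" unfolding C by (rule coeff_bound[OF dP TP x])
    finally show ?thesis by (simp add: i)
  qed
  have cK: "real_of_int c \<le> K"
  proof (cases "m = Suc n")
    case True
    have "coeff L' m = 0" using L'(2) True by (simp add: coeff_eq_0)
    then have "coeff P' m = 1" by (simp add: cm)
    then have "c dvd 1" using content_dvd_coeff[of P' m] by (simp add: c_def)
    then have "c = 1" using c1 by simp
    then show ?thesis using K1 by simp
  next
    case False
    then have mn: "m = n" using m by simp
    have "map_poly real_of_int q \<in> int_polys n"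
      using dq mn by (auto simp: int_polys_def degree_real_of_int_poly coeff_map_poly)
    moreover have "map_poly real_of_int q \<noteq> 0"
      using degree_real_of_int_poly[of q] dq m2 by auto
    ultimately obtain j where j: "j \<le> n" "\<delta> \<le> d j * \<bar>poly (hasse j (map_poly real_of_int q)) x\<bar>"
      using sep unfolding d_def by blast
    have "\<bar>\<sigma> j\<bar> \<le> 101 * w j"
      using U0 s0 r0 by (auto simp: \<sigma>_def w_def abs_mult)
    then have "\<bar>poly (hasse j P) x\<bar> \<le> 102 * w j" using near[OF j(1)] by linarith
    then have "d j * \<bar>poly (hasse j P) x\<bar> \<le> d j * (102 * w j)" using d0[of j] by (intro mult_left_mono) auto
    also have "\<dots> = 408 * R" using w[of j] by (simp add: mult.left_commute)
    finally have u: "d j * \<bar>poly (hasse j P) x\<bar> \<le> 408 * R" .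
    have "real_of_int c * \<delta> \<le> real_of_int c * (d j * \<bar>poly (hasse j (map_poly real_of_int q)) x\<bar>)"
      using j(2) c1 by (intro mult_left_mono) auto
    also have "\<dots> = d j * \<bar>poly (hasse j P) x\<bar>"
      using c1 by (simp add: Prq hasse_smult abs_mult)
    also note u
    finally have "real_of_int c \<le> 408 * R / \<delta>" using \<delta> by (simp add: pos_le_divide_eq)
    then show ?thesis by (simp add: K)
  qed
  have lower: "U \<le> C * (K * real_of_int (alg_height \<alpha>))"
  proof -
    have "\<bar>coeff P i\<bar> \<le> K * real_of_int (alg_height \<alpha>)" for i
    proof -
      have "real_of_int \<bar>coeff q i\<bar> \<le> real_of_int (alg_height \<alpha>)" using hle[of i] by (simp only: of_int_le_iff)
      then show ?thesis unfolding Pcoeff using cK c1 K1 by (intro mult_mono) auto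
    qed
    then have "\<bar>poly (hasse 2 P) x\<bar> \<le> C * (K * real_of_int (alg_height \<alpha>))"
      unfolding C by (intro hasse_bound[OF dP _ x])
    then show ?thesis using T2 by linarith
  qed
  have conj: "alg_conjugate \<alpha> \<beta>"
    unfolding alg_conjugate_def using irr dq m2 qroot[OF ab(1)] qroot[OF ab(2)]
    by (intro exI[of _ q] conjI irreducible_int_imp_rat) auto
  have "\<nu> * Q \<le> real_of_int (alg_height \<alpha>)"
  proof -
    have "\<nu> * (C * K) \<le> 4 * R" using \<nu>(3) C0 K1 by (simp add: pos_le_divide_eq)
    then have "\<nu> * (C * K) * Q \<le> 4 * R * Q" using Q0 by (intro mult_right_mono) auto
    also have "\<dots> \<le> C * (K * real_of_int (alg_height \<alpha>))" using lower by (simp add: U_def)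
    finally have "(C * K) * (\<nu> * Q) \<le> (C * K) * real_of_int (alg_height \<alpha>)" by (simp add: mult_ac)
    moreover have "0 < C * K" using C0 K1 by simp
    ultimately show ?thesis by (simp only: mult_le_cancel_left_pos)
  qed
  moreover have "real_of_int (alg_height \<alpha>) \<le> inverse \<nu> * Q"
  proof -
    have "\<nu> * (C * (408 * R)) \<le> 1" using \<nu>(4) C0 R by (simp add: pos_le_divide_eq)
    then have "C * (408 * R) \<le> inverse \<nu>" using \<nu>(1) by (simp add: field_simps)
    then have "C * (408 * R) * Q \<le> inverse \<nu> * Q" using Q0 by (intro mult_right_mono) auto
    then show ?thesis using upper by (simp add: U_def mult_ac)
  qed
  moreover have "\<nu> * s \<le> \<bar>\<alpha> - \<beta>\<bar>"
  proof -
    have "\<nu> * s \<le> 1 / 105 * s" using \<nu>(2) s0 by (intro mult_right_mono) auto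
    then show ?thesis using ab(3,5) rs s0 by linarith
  qed
  moreover have "\<bar>\<alpha> - \<beta>\<bar> \<le> inverse \<nu> * s"
  proof -
    have "105 \<le> inverse \<nu>" using \<nu>(1,2) by (simp add: field_simps)
    then have "105 * s \<le> inverse \<nu> * s" using s0 by (intro mult_right_mono) auto
    then show ?thesis using ab(3,4,5) rs s0 by linarith
  qed
  ultimately have hd: "height_and_distance \<nu> Q \<mu> \<alpha>"
    unfolding height_and_distance_def s_def using conj by blast
  have "algebraic_int \<alpha>" if "m = Suc n"
  proof (rule algebraic_int.intros)
    have "degree P = m" using dP' by (simp add: PP' degree_real_of_int_poly)
    moreover have "coeff L m = 0" using dL that by (simp add: coeff_eq_0)
    ultimately show "lead_coeff P = 1" using m2 by (cases m) (auto simp: P_def E_def)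
    show "\<forall>i. coeff P i \<in> \<int>" by (simp add: PP' coeff_map_poly)
  qed (rule ab(1))
  then show ?thesis using ab(3) min deg hd unfolding r_def by blast
qed

lemma interval_endpoints:
  fixes J :: "real set"
  assumes "is_interval J" "J \<subseteq> {- 1 / 2..1 / 2}" "measure lborel J \<noteq> 0"
  obtains a b where "- 1 / 2 \<le> a" "a < b" "b \<le> 1 / 2" "{a<..<b} \<subseteq> J" "measure lborel J \<le> b - a"
proof -
  have ne: "J \<noteq> {}" using assms(3) by auto
  have bd: "bdd_below J" "bdd_above J" using assms(2) by (meson bdd_below_Icc bdd_above_Icc bdd_below_mono bdd_above_mono)+
  define a where "a = Inf J"
  define b where "b = Sup J"
  have Jab: "J \<subseteq> {a..b}" using bd by (auto simp: a_def b_def intro: cInf_lower cSup_upper)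
  have a: "- 1 / 2 \<le> a" unfolding a_def using ne assms(2) by (intro cInf_greatest) auto
  have b: "b \<le> 1 / 2" unfolding b_def using ne assms(2) by (intro cSup_least) auto
  have le: "a \<le> b" using ne Jab by fastforce
  have "emeasure lborel J \<le> emeasure lborel {a..b}" using Jab by (intro emeasure_mono) auto
  then have meas: "measure lborel J \<le> b - a"
    unfolding measure_def using le by (metis emeasure_lborel_Icc enn2real_ennreal enn2real_mono ennreal_less_top diff_ge_0_iff_ge)
  then have "a < b" using assms(3) measure_nonneg[of lborel J] le by (cases "a = b") auto
  moreover have "{a<..<b} \<subseteq> J"
  proof
    fix x assume x: "x \<in> {a<..<b}"
    obtain u where u: "u \<in> J" "u < x" using x ne bd cInf_less_iff[of J x] by (auto simp: a_def)
    obtain v where v: "v \<in> J" "x < v" using x ne bd less_cSup_iff[of J x] by (auto simp: b_def)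
    show "x \<in> J" using assms(1) u v unfolding is_interval_1 by (meson less_imp_le)
  qed
  ultimately show thesis using a b meas by (intro that)
qed

text \<open>
  The good points at distance more than \<open>r / 4\<close> from the ends of the interval have measure at least
  \<open>(b - a) / 2 - r / 2\<close>, hence at least \<open>(b - a) / 4\<close> for large \<open>Q\<close>. They are covered by intervals of
  length \<open>r / 2\<close> around the numbers to be counted.
\<close>

lemma many_close_conjugates:
  assumes n: "2 \<le> n" and m: "m \<in> {n, Suc n}"
  shows "\<exists>\<nu>::real. 0 < \<nu> \<and> \<nu> < 1 \<and> (\<forall>(\<mu>::real) (J :: real set).
      0 < \<mu> \<and> \<mu> \<le> (real n + 1) / 3 \<and> is_interval J \<and> J \<subseteq> {- 1 / 2 .. 1 / 2} \<longrightarrow>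
      (\<forall>\<^sub>F Q :: real in at_top. real (card ({\<alpha>. algebraic \<alpha> \<and> alg_degree \<alpha> = m \<and>
          (m = Suc n \<longrightarrow> algebraic_int \<alpha>) \<and> height_and_distance \<nu> Q \<mu> \<alpha>} \<inter> J))
        \<ge> 1 / 2 * Q powr (real n + 1 - 2 * \<mu>) * measure lborel J))"
proof -
  obtain \<delta> where \<delta>: "0 < \<delta>" and rare: "\<And>a b. -1 \<le> a \<Longrightarrow> a < b \<Longrightarrow> b \<le> 1 \<Longrightarrow>
     \<exists>M>0. \<forall>d. (\<forall>j. 0 < d j) \<longrightarrow> (\<Prod>j\<le>n. d j) = 1 \<longrightarrow>
     (\<forall>k. 1 \<le> k \<longrightarrow> k \<le> n \<longrightarrow> M \<le> (\<Prod>j<k. d j)) \<longrightarrow>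
     (\<exists>X\<in>sets lborel. emeasure lborel X \<le> ennreal ((b - a) / 2) \<and>
       (\<forall>x\<in>{a<..<b} - X. \<forall>p\<in>int_polys n. p \<noteq> 0 \<longrightarrow> (\<exists>j\<le>n. \<delta> \<le> d j * \<bar>poly (hasse j p) x\<bar>)))"
    using short_vectors_rare[of n] by metis
  obtain R where R: "0 < R" and cover: "\<And>d x. (\<forall>j. 0 < d j) \<Longrightarrow> (\<Prod>j\<le>n. d j) = 1 \<Longrightarrow> \<bar>x\<bar> \<le> 1 \<Longrightarrow>
     (\<forall>p\<in>int_polys n. p \<noteq> 0 \<longrightarrow> (\<exists>j\<le>n. \<delta> \<le> d j * \<bar>poly (hasse j p) x\<bar>)) \<Longrightarrow>
     (\<forall>\<tau>. \<exists>q\<in>int_polys n. \<forall>j\<le>n. d j * \<bar>poly (hasse j q) x - \<tau> j\<bar> \<le> R)"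
    using lattice_covering[OF \<delta>, of n] by metis
  define C where "C = real (Suc n + 1) * 2 ^ Suc n"
  define K where "K = 408 * R / \<delta> + 1"
  define \<nu> where "\<nu> = min (1 / 105) (min (4 * R / (C * K)) (1 / (C * (408 * R))))"
  have C0: "0 < C" by (simp add: C_def)
  have K0: "0 < K" using R \<delta> by (simp add: K_def add_pos_pos)
  have \<nu>: "0 < \<nu>" "\<nu> \<le> 1 / 105" "\<nu> \<le> 4 * R / (C * K)" "\<nu> \<le> 1 / (C * (408 * R))"
    using C0 K0 R by (auto simp: \<nu>_def)
  define Z where "Z = (\<lambda>Q \<mu>. {\<alpha>. algebraic \<alpha> \<and> alg_degree \<alpha> = m \<and>
          (m = Suc n \<longrightarrow> algebraic_int \<alpha>) \<and> height_and_distance \<nu> Q \<mu> \<alpha>})"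
  have finZ: "finite (Z Q \<mu>)" for Q \<mu>
    by (rule finite_subset[OF _ finite_bounded_height[of m "inverse \<nu> * Q"]])
       (auto simp: Z_def height_and_distance_def)
  have "\<forall>\<^sub>F Q in at_top. 1 / 2 * Q powr (real n + 1 - 2 * \<mu>) * measure lborel J \<le> real (card (Z Q \<mu> \<inter> J))"
    if \<mu>: "0 < \<mu>" "\<mu> \<le> (real n + 1) / 3" and J: "is_interval J" "J \<subseteq> {- 1 / 2 .. 1 / 2}" for \<mu> :: real and J
  proof (cases "measure lborel J = 0")
    case True
    then show ?thesis by simp
  next
    case False
    then obtain a b where ab: "- 1 / 2 \<le> a" "a < b" "b \<le> 1 / 2" "{a<..<b} \<subseteq> J" "measure lborel J \<le> b - a"
      using interval_endpoints[OF J] by blast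
    from rare[of a b] ab obtain M where M: "\<And>d. (\<forall>j. 0 < d j) \<Longrightarrow> (\<Prod>j\<le>n. d j) = 1 \<Longrightarrow>
       (\<forall>k. 1 \<le> k \<longrightarrow> k \<le> n \<longrightarrow> M \<le> (\<Prod>j<k. d j)) \<Longrightarrow>
       (\<exists>X\<in>sets lborel. emeasure lborel X \<le> ennreal ((b - a) / 2) \<and>
       (\<forall>x\<in>{a<..<b} - X. \<forall>p\<in>int_polys n. p \<noteq> 0 \<longrightarrow> (\<exists>j\<le>n. \<delta> \<le> d j * \<bar>poly (hasse j p) x\<bar>)))"
      by auto
    have expo: "2 * \<mu> - real n - 1 < 0" using \<mu> n by simp
    have lim1: "((\<lambda>Q. Q powr (- \<mu>)) \<longlongrightarrow> 0) at_top"
      using \<mu> by (intro tendsto_neg_powr filterlim_ident) auto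
    have lim2: "((\<lambda>Q. Q powr (2 * \<mu> - real n - 1)) \<longlongrightarrow> 0) at_top"
      using expo by (intro tendsto_neg_powr filterlim_ident) auto
    have ev1: "\<forall>\<^sub>F Q in at_top. Q powr (- \<mu>) < 1 / (real (Suc n) * 104 ^ 3)"
      by (rule order_tendstoD(2)[OF lim1]) simp
    have ev2: "\<forall>\<^sub>F Q in at_top. Q powr (2 * \<mu> - real n - 1) < (b - a) / 2"
      by (rule order_tendstoD(2)[OF lim2]) (use ab in simp)
    show ?thesis
      using ev1 ev2 eventually_ge_at_top[of 1] eventually_ge_at_top[of M] eventually_ge_at_top[of "1 / (4 * R)"]
    proof eventually_elim
      case (elim Q)
      define r where "r = Q powr (2 * \<mu> - real n - 1)"
      have Q0: "0 < Q" using elim(3) by simp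
      have r0: "0 < r" using Q0 by (simp add: r_def)
      have r_small: "r < (b - a) / 2" using elim(2) by (simp add: r_def)
      have wp: "\<forall>j. 0 < weight n \<mu> Q j" using weight_pos[OF Q0] by blast
      have w1: "(\<Prod>j\<le>n. weight n \<mu> Q j) = 1"
        using prod_weight[OF Q0, of "Suc n" n \<mu>] n Q0 by (simp add: lessThan_Suc_atMost)
      have wM: "M \<le> (\<Prod>j<k. weight n \<mu> Q j)" if k: "1 \<le> k" "k \<le> n" for k
      proof -
        have "\<exists>e\<ge>1. (\<Prod>j<k. weight n \<mu> Q j) = Q powr e"
        proof (cases "k = 1")
          case True
          have "1 \<le> real n - \<mu>" using \<mu>(2) n by simp
          then show ?thesis using True by (intro exI[of _ "real n - \<mu>"]) (simp add: weight_def)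
        next
          case False
          then show ?thesis using k prod_weight[OF Q0, of k n \<mu>]
            by (intro exI[of _ "real n + 1 - real k"]) auto
        qed
        then obtain e where e: "1 \<le> e" "(\<Prod>j<k. weight n \<mu> Q j) = Q powr e" by blast
        have "M \<le> Q powr 1" using elim(4) Q0 by simp
        also have "\<dots> \<le> Q powr e" using e(1) elim(3) by (intro powr_mono)
        finally show ?thesis using e(2) by simp
      qed
      have wM': "\<forall>k. 1 \<le> k \<longrightarrow> k \<le> n \<longrightarrow> M \<le> (\<Prod>j<k. weight n \<mu> Q j)" using wM by blast
      from M[OF wp w1 wM'] obtain X where X: "X \<in> sets lborel" "emeasure lborel X \<le> ennreal ((b - a) / 2)"
        "\<forall>x\<in>{a<..<b} - X. \<forall>p\<in>int_polys n. p \<noteq> 0 \<longrightarrow> (\<exists>j\<le>n. \<delta> \<le> weight n \<mu> Q j * \<bar>poly (hasse j p) x\<bar>)"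
        by (elim bexE conjE) (rule that)
      have near: "\<exists>\<alpha>\<in>Z Q \<mu>. \<bar>\<alpha> - x\<bar> \<le> r / 4" if x: "x \<in> {a<..<b} - X" for x
      proof -
        have x1: "\<bar>x\<bar> \<le> 1" using x ab by auto
        have sep: "\<forall>p\<in>int_polys n. p \<noteq> 0 \<longrightarrow> (\<exists>j\<le>n. \<delta> \<le> weight n \<mu> Q j * \<bar>poly (hasse j p) x\<bar>)"
          using X(3) x by blast
        have Q2: "real (Suc n) * 104 ^ 3 * Q powr (- \<mu>) \<le> 1"
          using elim(1) by (simp add: field_simps)
        have Q3: "1 \<le> 4 * R * Q" using elim(5) R by (simp add: field_simps)
        have "\<exists>\<alpha>. \<bar>\<alpha> - x\<bar> \<le> Q powr (2 * \<mu> - real n - 1) / 4 \<and> algebraic \<alpha> \<and> alg_degree \<alpha> = m \<and>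
          (m = Suc n \<longrightarrow> algebraic_int \<alpha>) \<and> height_and_distance \<nu> Q \<mu> \<alpha>"
          by (rule close_roots_near_point[OF n m \<delta> R \<mu> elim(3) Q2 Q3 x1 _ _ C_def K_def \<nu>])
             (use sep cover[OF wp w1 x1 sep] in auto)
        then show ?thesis unfolding Z_def r_def by blast
      qed
      define Y where "Y = Z Q \<mu> \<inter> J"
      have fY: "finite Y" using finZ by (simp add: Y_def)
      have cov: "{a + r / 4<..<b - r / 4} \<subseteq> X \<union> (\<Union>\<alpha>\<in>Y. {\<alpha> - r / 4..\<alpha> + r / 4})"
      proof
        fix x assume x: "x \<in> {a + r / 4<..<b - r / 4}"
        show "x \<in> X \<union> (\<Union>\<alpha>\<in>Y. {\<alpha> - r / 4..\<alpha> + r / 4})"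
        proof (cases "x \<in> X")
          case False
          with x r0 have "x \<in> {a<..<b} - X" by auto
          from near[OF this] obtain \<alpha> where \<alpha>: "\<alpha> \<in> Z Q \<mu>" "\<bar>\<alpha> - x\<bar> \<le> r / 4" by blast
          have x': "a + r / 4 < x" "x < b - r / 4" using x by auto
          have "a < \<alpha>" "\<alpha> < b" using x' \<alpha>(2) by linarith+
          then have "\<alpha> \<in> Y" using \<alpha>(1) ab(4) by (auto simp: Y_def)
          moreover have "\<alpha> - r / 4 \<le> x" "x \<le> \<alpha> + r / 4" using \<alpha>(2) by linarith+
          ultimately show ?thesis by auto
        qed simp
      qed
      have mY: "(\<Union>\<alpha>\<in>Y. {\<alpha> - r / 4..\<alpha> + r / 4}) \<in> sets lborel"
        using fY by (intro sets.finite_UN) auto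
      have "ennreal (b - a - r / 2) = emeasure lborel {a + r / 4<..<b - r / 4}"
        using r_small r0 ab(2) by (subst emeasure_lborel_Ioo) (auto simp: field_simps)
      also have "\<dots> \<le> emeasure lborel (X \<union> (\<Union>\<alpha>\<in>Y. {\<alpha> - r / 4..\<alpha> + r / 4}))"
        using X(1) mY cov by (intro emeasure_mono sets.Un)
      also have "\<dots> \<le> emeasure lborel X + emeasure lborel (\<Union>\<alpha>\<in>Y. {\<alpha> - r / 4..\<alpha> + r / 4})"
        using X(1) mY by (intro emeasure_subadditive)
      also have "\<dots> \<le> ennreal ((b - a) / 2) + (\<Sum>\<alpha>\<in>Y. emeasure lborel {\<alpha> - r / 4..\<alpha> + r / 4})"
        using fY by (intro add_mono X(2) emeasure_subadditive_finite) auto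
      also have "(\<Sum>\<alpha>\<in>Y. emeasure lborel {\<alpha> - r / 4..\<alpha> + r / 4}) = (\<Sum>\<alpha>\<in>Y. ennreal (r / 2))"
        using r0 by (intro sum.cong) auto
      also have "\<dots> = ennreal (\<Sum>\<alpha>\<in>Y. r / 2)" using r0 by (intro sum_ennreal) simp
      also have "(\<Sum>\<alpha>\<in>Y. r / 2) = real (card Y) * (r / 2)" by simp
      also have "ennreal ((b - a) / 2) + ennreal (real (card Y) * (r / 2)) = ennreal ((b - a) / 2 + real (card Y) * (r / 2))"
        using ab(2) r0 by (intro ennreal_plus[symmetric]) auto
      finally have "b - a - r / 2 \<le> (b - a) / 2 + real (card Y) * (r / 2)"
        using ab(2) r0 by (subst (asm) ennreal_le_iff) auto
      then have "b - a - r / 2 \<le> (b - a) / 2 + (real (card Y) * r) / 2" by (simp only: times_divide_eq_right)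
      then have "(b - a) + (b - a - r) \<le> (b - a) + real (card Y) * r" by (simp add: field_simps)
      then have cY: "(b - a) / 2 \<le> real (card Y) * r" using r_small by (simp add: field_simps)
      have inv: "Q powr (real n + 1 - 2 * \<mu>) * r = 1"
        using Q0 by (simp add: r_def powr_add[symmetric])
      have "1 / 2 * Q powr (real n + 1 - 2 * \<mu>) * measure lborel J \<le> 1 / 2 * Q powr (real n + 1 - 2 * \<mu>) * (b - a)"
        using ab(5) by (intro mult_left_mono) auto
      also have "\<dots> = Q powr (real n + 1 - 2 * \<mu>) * ((b - a) / 2)" by simp
      also have "\<dots> \<le> Q powr (real n + 1 - 2 * \<mu>) * (real (card Y) * r)"
        using cY by (intro mult_left_mono) auto
      also have "\<dots> = real (card Y) * (Q powr (real n + 1 - 2 * \<mu>) * r)" by (simp add: mult_ac)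
      finally show ?case using inv by (simp add: Y_def)
    qed
  qed
  then show ?thesis using \<nu> unfolding Z_def by (intro exI[of _ \<nu>]) auto
qed

theorem corollary1:
  fixes n :: nat
  assumes "n \<ge> 2"
  shows "\<forall>A \<in> {close_algebraic_numbers, close_algebraic_integers}.
    \<exists>\<nu> :: real. 0 < \<nu> \<and> \<nu> < 1 \<and>
      (\<forall>(\<mu> :: real) (J :: real set).
         0 < \<mu> \<and> \<mu> \<le> (real n + 1) / 3 \<and> is_interval J \<and> J \<subseteq> {- 1 / 2 .. 1 / 2} \<longrightarrow>
         (\<forall>\<^sub>F Q :: real in at_top.
            real (card (A n \<nu> Q \<mu> \<inter> J)) \<ge> 1 / 2 * Q powr (real n + 1 - 2 * \<mu>) * measure lborel J))"
proof
  fix A assume A: "A \<in> {close_algebraic_numbers, close_algebraic_integers}"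
  define m where "m = (if A = close_algebraic_numbers then n else Suc n)"
  have "m \<in> {n, Suc n}" by (simp add: m_def)
  have eq: "A n \<nu> Q \<mu> = {\<alpha>. algebraic \<alpha> \<and> alg_degree \<alpha> = m \<and>
      (m = Suc n \<longrightarrow> algebraic_int \<alpha>) \<and> height_and_distance \<nu> Q \<mu> \<alpha>}" for \<nu> Q \<mu>
    using A by (auto simp: m_def close_algebraic_numbers_def close_algebraic_integers_def
      intro: algebraic_int_imp_algebraic)
  show "\<exists>\<nu> :: real. 0 < \<nu> \<and> \<nu> < 1 \<and>
      (\<forall>(\<mu> :: real) (J :: real set).
         0 < \<mu> \<and> \<mu> \<le> (real n + 1) / 3 \<and> is_interval J \<and> J \<subseteq> {- 1 / 2 .. 1 / 2} \<longrightarrow>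
         (\<forall>\<^sub>F Q :: real in at_top.
            real (card (A n \<nu> Q \<mu> \<inter> J)) \<ge> 1 / 2 * Q powr (real n + 1 - 2 * \<mu>) * measure lborel J))"
    unfolding eq by (rule many_close_conjugates[OF assms \<open>m \<in> {n, Suc n}\<close>])
qed

end
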